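(* Let $\mathcal{G}$ be a $\sigma$-compact locally compact (Hausdorff) group, $1\le p\le\infty$, $p^{-1}+q^{-1}=1$, $m$ a moderate weight on $\mathcal{G}$ and $w$ a $p$-control-weight of $m$. Let $G\in W(L^1_w)\cap L^q_{1/m}(\mathcal{G})$ satisfy $G=G^\triangledown=G*G$, and let $\mathcal{M}^p_m=\{F\in L^p_m(\mathcal{G}): F=F*G\}$. Let $U$ be a compact neighbourhood of the neutral element $e$ such that $$\|\mathrm{osc}_U(G)\|_{L^1_w}\,\|G\|_{L^1_w}<1 .$$ Then for every $U$-well-spread family $(x_i)_{i\in I}\subset\mathcal{G}$ there are constants $0<a\le b<\infty$ such that $$a\|F\|_{L^p_m}\le\Big(\sum_{i\in I}|F(x_i)|^pm(x_i)^p\Big)^{1/p}\le b\|F\|_{L^p_m}$$ for all $F\in\mathcal{M}^p_m$ (with the supremum $\sup_{i\in I}|F(x_i)|m(x_i)$ in the middle if $p=\infty$). In addition, there is a bounded linear operator $R:\ell^p_{\widetilde m}(I)\to\mathcal{M}^p_m$ with $R((F(x_i))_{i\in I})=F$ for all $F\in\mathcal{M}^p_m$. This means that $(L_{x_i}G)_{i\in I}$ is a Banach frame of $\mathcal{M}^p_m$ with respect to the sequence space $\ell^p_{\widetilde m}(I)$.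
   Context: $dx$ is a left Haar measure on $\mathcal{G}$, $\Delta$ the modular function, normalized by $d(xy)=\Delta(y)\,dx$ for fixed $y$. Notation: $F^\vee(x)=F(x^{-1})$, $F^\triangledown(x)=\overline{F(x^{-1})}$, $L_yF(x)=F(y^{-1}x)$, $(F*G)(x)=\int_{\mathcal{G}}F(y)G(y^{-1}x)\,dy$. A weight is a measurable, locally integrable function $\mathcal{G}\to(0,\infty)$; $\|F\|_{L^p_v}=\|Fv\|_{L^p}$. A weight $m$ is moderate if $\alpha_0(y)=\sup_x m(yx)/m(x)$ and $\beta_0(y)=\sup_x m(xy)/m(x)$ are finite for all $y$. A weight $w$ is submultiplicative if $w(xy)\le w(x)w(y)$. A $p$-control-weight of $m$ is a submultiplicative weight $w$ with $w(y)\ge\max\{\alpha_0(y),\alpha_0(y^{-1}),\beta_0(y^{-1})\Delta(y)^{-1/p},\beta_0(y)\Delta(y)^{-1/q}\}$ for all $y$ (with $1/\infty=0$). For a compact neighbourhood $U$ of $e$, $\mathrm{osc}_U(G)(x)=\operatorname{ess\,sup}_{u\in U}|G(ux)-G(x)|$. $W(L^1_w)$ is the set of $G\in L^1_w(\mathcal{G})$ such that $\mathrm{osc}_U(G)\in L^1_w(\mathcal{G})$ for some (equivalently, every) compact neighbourhood $U$ of $e$. A countable family $(x_i)_{i\in I}\subset\mathcal{G}$ is $U$-dense if $\bigcup_i x_iU=\mathcal{G}$; relatively separated if for each compact $K\subset\mathcal{G}$, $\sup_{i\in I}|\{j\in I: x_iK\cap x_jK\neq\emptyset\}|<\infty$;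 $U$-well-spread if both. $\widetilde m(i)=m(x_i)$, and $\ell^p_{\widetilde m}(I)$ is the space of sequences with finite norm $\|(c_i m(x_i))_i\|_{\ell^p}$. Elements $F\in\mathcal{M}^p_m$ are identified with their continuous representatives $F*G$ (so point values make sense), and $F(x)=\int_{\mathcal{G}}F(y)\overline{L_xG(y)}\,dy$. A family $(g_i)$ acting on a Banach space $B$ by bounded functionals $f\mapsto\langle f,g_i\rangle$ is a Banach frame for $B$ with respect to a Banach space of sequences $B_d$ if $\|(\langle f,g_i\rangle)_i\|_{B_d}$ is an equivalent norm on $B$ and there is a bounded $R:B_d\to B$ with $R((\langle f,g_i\rangle)_i)=f$ for all $f\in B$; here $\langle F,L_{x_i}G\rangle=\int F\,\overline{L_{x_i}G}=F(x_i)$. *)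

theory Defs
  imports "HOL-Analysis.Analysis" "HOL-Probability.Essential_Supremum"
begin

text \<open>
  Groups are elements of the class \<^class>\<open>topological_group_add\<close>, which despite its name does not
  assume commutativity. The group law is thus written \<open>x + y\<close> (for the product \<open>xy\<close>), the inverse
  \<open>- x\<close> and the neutral element \<open>0\<close>; the order of the summands matters throughout.
\<close>

definition sigma_compact_space :: "'a topology \<Rightarrow> bool" where
  "sigma_compact_space X \<longleftrightarrow>
     (\<exists>K :: nat \<Rightarrow> 'a set. (\<forall>n. compactin X (K n)) \<and> (\<Union>n. K n) = topspace X)"

definition left_haar_measure :: "'a::{topological_group_add, t2_space} measure \<Rightarrow> bool" where
  "left_haar_measure M \<longleftrightarrow>
     sets M = sets borel \<and>
     emeasure M UNIV \<noteq> 0 \<and>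
     (\<forall>K. compact K \<longrightarrow> emeasure M K < top) \<and>
     (\<forall>A \<in> sets borel. emeasure M A = (INF V\<in>{V. open V \<and> A \<subseteq> V}. emeasure M V)) \<and>
     (\<forall>V. open V \<longrightarrow> emeasure M V = (SUP K\<in>{K. compact K \<and> K \<subseteq> V}. emeasure M K)) \<and>
     (\<forall>y. \<forall>A \<in> sets borel. emeasure M ((\<lambda>x. y + x) ` A) = emeasure M A)"

text \<open>\<open>d(xy) = \<Delta>(y) dx\<close> for fixed \<open>y\<close>:\<close>

definition modular_function ::
    "'a::{topological_group_add, t2_space} measure \<Rightarrow> ('a \<Rightarrow> real) \<Rightarrow> bool" where
  "modular_function M \<Delta> \<longleftrightarrow>
     (\<forall>y. 0 < \<Delta> y \<and>
          (\<forall>A \<in> sets borel. emeasure M ((\<lambda>x. x + y) ` A) = ennreal (\<Delta> y) * emeasure M A))"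

definition left_translate :: "'a::group_add \<Rightarrow> ('a \<Rightarrow> complex) \<Rightarrow> 'a \<Rightarrow> complex" where
  "left_translate y F = (\<lambda>x. F (- y + x))"

definition involution :: "('a::group_add \<Rightarrow> complex) \<Rightarrow> 'a \<Rightarrow> complex" where
  "involution F = (\<lambda>x. cnj (F (- x)))"

definition convolution ::
    "'a::group_add measure \<Rightarrow> ('a \<Rightarrow> complex) \<Rightarrow> ('a \<Rightarrow> complex) \<Rightarrow> 'a \<Rightarrow> complex" where
  "convolution M F G = (\<lambda>x. LINT y|M. F y * G (- y + x))"

definition compact_nhd_neutral :: "'a::topological_group_add set \<Rightarrow> bool" where
  "compact_nhd_neutral U \<longleftrightarrow> compact U \<and> 0 \<in> interior U"


text \<open>Only used with exponents \<open>r > 0\<close>.\<close>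

definition ennreal_powr :: "ennreal \<Rightarrow> real \<Rightarrow> ennreal" where
  "ennreal_powr a r = (if a = top then top else ennreal (enn2real a powr r))"

definition Lp_enorm :: "'a measure \<Rightarrow> ennreal \<Rightarrow> ('a \<Rightarrow> ennreal) \<Rightarrow> ennreal" where
  "Lp_enorm M p h =
     (if p = top then esssup M h
      else ennreal_powr (\<integral>\<^sup>+x. ennreal_powr (h x) (enn2real p) \<partial>M) (1 / enn2real p))"

definition weighted_Lp_norm ::
    "'a measure \<Rightarrow> ennreal \<Rightarrow> ('a \<Rightarrow> real) \<Rightarrow> ('a \<Rightarrow> complex) \<Rightarrow> ennreal" where
  "weighted_Lp_norm M p v F = Lp_enorm M p (\<lambda>x. ennreal (cmod (F x) * v x))"

text \<open>Functions, not classes modulo null sets.\<close>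

definition weighted_Lp ::
    "'a measure \<Rightarrow> ennreal \<Rightarrow> ('a \<Rightarrow> real) \<Rightarrow> ('a \<Rightarrow> complex) set" where
  "weighted_Lp M p v = {F \<in> borel_measurable M. weighted_Lp_norm M p v F < top}"

definition weighted_lp_norm :: "ennreal \<Rightarrow> ('i \<Rightarrow> real) \<Rightarrow> ('i \<Rightarrow> complex) \<Rightarrow> ennreal" where
  "weighted_lp_norm p v c =
     (if p = top then (SUP i. ennreal (cmod (c i) * v i))
      else ennreal_powr (\<Sum>\<^sub>\<infinity>i. ennreal ((cmod (c i) * v i) powr enn2real p)) (1 / enn2real p))"

definition weighted_lp :: "ennreal \<Rightarrow> ('i \<Rightarrow> real) \<Rightarrow> ('i \<Rightarrow> complex) set" where
  "weighted_lp p v = {c. weighted_lp_norm p v c < top}"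


definition weight :: "'a::topological_space measure \<Rightarrow> ('a \<Rightarrow> real) \<Rightarrow> bool" where
  "weight M v \<longleftrightarrow>
     v \<in> borel_measurable M \<and> (\<forall>x. 0 < v x) \<and> (\<forall>K. compact K \<longrightarrow> set_integrable M K v)"

definition moderate_weight ::
    "'a::topological_group_add measure \<Rightarrow> ('a \<Rightarrow> real) \<Rightarrow> bool" where
  "moderate_weight M m \<longleftrightarrow>
     weight M m \<and>
     (\<forall>y. bdd_above (range (\<lambda>x. m (y + x) / m x))) \<and>
     (\<forall>y. bdd_above (range (\<lambda>x. m (x + y) / m x)))"

definition alpha0 :: "('a::group_add \<Rightarrow> real) \<Rightarrow> 'a \<Rightarrow> real" where
  "alpha0 m y = (SUP x. m (y + x) / m x)"

definition beta0 :: "('a::group_add \<Rightarrow> real) \<Rightarrow> 'a \<Rightarrow> real" where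
  "beta0 m y = (SUP x. m (x + y) / m x)"

definition submultiplicative_weight ::
    "'a::topological_group_add measure \<Rightarrow> ('a \<Rightarrow> real) \<Rightarrow> bool" where
  "submultiplicative_weight M w \<longleftrightarrow> weight M w \<and> (\<forall>x y. w (x + y) \<le> w x * w y)"

text \<open>
  The exponent \<open>q\<close> is the conjugate of \<open>p\<close>. As \<^prop>\<open>inverse top = (0::ennreal)\<close>, the convention
  \<open>1 / \<infinity> = 0\<close> is built in.
\<close>

definition control_weight ::
    "'a::topological_group_add measure \<Rightarrow> ('a \<Rightarrow> real) \<Rightarrow> ennreal \<Rightarrow> ennreal \<Rightarrow>
     ('a \<Rightarrow> real) \<Rightarrow> ('a \<Rightarrow> real) \<Rightarrow> bool" where
  "control_weight M \<Delta> p q m w \<longleftrightarrow>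
     submultiplicative_weight M w \<and>
     (\<forall>y. w y \<ge> Max {alpha0 m y,
                     alpha0 m (- y),
                     beta0 m (- y) * \<Delta> y powr (- enn2real (inverse p)),
                     beta0 m y * \<Delta> y powr (- enn2real (inverse q))})"


definition osc ::
    "'a::topological_group_add measure \<Rightarrow> 'a set \<Rightarrow> ('a \<Rightarrow> complex) \<Rightarrow> 'a \<Rightarrow> ennreal" where
  "osc M U G x = esssup (restrict_space M U) (\<lambda>u. ennreal (cmod (G (u + x) - G x)))"

definition osc_norm ::
    "'a::topological_group_add measure \<Rightarrow> ('a \<Rightarrow> real) \<Rightarrow> 'a set \<Rightarrow> ('a \<Rightarrow> complex) \<Rightarrow> ennreal" where
  "osc_norm M w U G = Lp_enorm M 1 (\<lambda>x. osc M U G x * ennreal (w x))"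

definition W_L1 ::
    "'a::topological_group_add measure \<Rightarrow> ('a \<Rightarrow> real) \<Rightarrow> ('a \<Rightarrow> complex) set" where
  "W_L1 M w =
     {G \<in> weighted_Lp M 1 w.
        \<exists>U. compact_nhd_neutral U \<and> osc M U G \<in> borel_measurable M \<and> osc_norm M w U G < top}"

text \<open>
  The equation \<open>F = F * G\<close> is required at every point, so each class of functions modulo null sets
  is represented here by exactly one element, its continuous representative \<open>F * G\<close>.
\<close>

definition repr_space ::
    "'a::topological_group_add measure \<Rightarrow> ennreal \<Rightarrow> ('a \<Rightarrow> real) \<Rightarrow> ('a \<Rightarrow> complex) \<Rightarrow>
     ('a \<Rightarrow> complex) set" where
  "repr_space M p m G = {F \<in> weighted_Lp M p m. F = convolution M F G}"


definition dense_family :: "'a::group_add set \<Rightarrow> ('i \<Rightarrow> 'a) \<Rightarrow> bool" where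
  "dense_family U x \<longleftrightarrow> (\<Union>i. (\<lambda>u. x i + u) ` U) = UNIV"

definition relatively_separated :: "('i \<Rightarrow> 'a::topological_group_add) \<Rightarrow> bool" where
  "relatively_separated x \<longleftrightarrow>
     (\<forall>K. compact K \<longrightarrow>
        (\<exists>N. \<forall>i. finite {j. (\<lambda>k. x i + k) ` K \<inter> (\<lambda>k. x j + k) ` K \<noteq> {}} \<and>
                 card {j. (\<lambda>k. x i + k) ` K \<inter> (\<lambda>k. x j + k) ` K \<noteq> {}} \<le> N))"

definition well_spread :: "'a::topological_group_add set \<Rightarrow> ('i \<Rightarrow> 'a) \<Rightarrow> bool" where
  "well_spread U x \<longleftrightarrow>
     countable (UNIV :: 'i set) \<and> dense_family U x \<and> relatively_separated x"


text \<open>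
  Complex normed spaces whose elements are functions; the vector space operations are pointwise and
  the norm takes values in \<^typ>\<open>ennreal\<close> but is finite on the space.
\<close>

definition is_normed_fun_space ::
    "('s \<Rightarrow> complex) set \<Rightarrow> (('s \<Rightarrow> complex) \<Rightarrow> ennreal) \<Rightarrow> bool" where
  "is_normed_fun_space B N \<longleftrightarrow>
     (\<lambda>s. 0) \<in> B \<and>
     (\<forall>f\<in>B. \<forall>g\<in>B. (\<lambda>s. f s + g s) \<in> B \<and> N (\<lambda>s. f s + g s) \<le> N f + N g) \<and>
     (\<forall>c. \<forall>f\<in>B. (\<lambda>s. c * f s) \<in> B \<and> N (\<lambda>s. c * f s) = ennreal (cmod c) * N f) \<and>
     (\<forall>f\<in>B. N f < top) \<and>
     (\<forall>f\<in>B. N f = 0 \<longrightarrow> f = (\<lambda>s. 0))"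

definition is_banach_fun_space ::
    "('s \<Rightarrow> complex) set \<Rightarrow> (('s \<Rightarrow> complex) \<Rightarrow> ennreal) \<Rightarrow> bool" where
  "is_banach_fun_space B N \<longleftrightarrow>
     is_normed_fun_space B N \<and>
     (\<forall>f :: nat \<Rightarrow> 's \<Rightarrow> complex.
        (\<forall>n. f n \<in> B) \<and>
        (\<forall>\<epsilon>>0. \<exists>n0. \<forall>k\<ge>n0. \<forall>n\<ge>n0. N (\<lambda>s. f k s - f n s) < \<epsilon>) \<longrightarrow>
        (\<exists>g\<in>B. (\<lambda>n. N (\<lambda>s. f n s - g s)) \<longlonglongrightarrow> 0))"

definition is_bounded_functional ::
    "('s \<Rightarrow> complex) set \<Rightarrow> (('s \<Rightarrow> complex) \<Rightarrow> ennreal) \<Rightarrow> (('s \<Rightarrow> complex) \<Rightarrow> complex) \<Rightarrow> bool" where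
  "is_bounded_functional B N \<phi> \<longleftrightarrow>
     (\<forall>f\<in>B. \<forall>g\<in>B. \<phi> (\<lambda>s. f s + g s) = \<phi> f + \<phi> g) \<and>
     (\<forall>c. \<forall>f\<in>B. \<phi> (\<lambda>s. c * f s) = c * \<phi> f) \<and>
     (\<exists>C::real. \<forall>f\<in>B. ennreal (cmod (\<phi> f)) \<le> ennreal C * N f)"

definition is_bounded_operator ::
    "('s \<Rightarrow> complex) set \<Rightarrow> (('s \<Rightarrow> complex) \<Rightarrow> ennreal) \<Rightarrow>
     ('t \<Rightarrow> complex) set \<Rightarrow> (('t \<Rightarrow> complex) \<Rightarrow> ennreal) \<Rightarrow>
     (('s \<Rightarrow> complex) \<Rightarrow> ('t \<Rightarrow> complex)) \<Rightarrow> bool" where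
  "is_bounded_operator B N B' N' T \<longleftrightarrow>
     (\<forall>f\<in>B. T f \<in> B') \<and>
     (\<forall>f\<in>B. \<forall>g\<in>B. T (\<lambda>s. f s + g s) = (\<lambda>t. T f t + T g t)) \<and>
     (\<forall>c. \<forall>f\<in>B. T (\<lambda>s. c * f s) = (\<lambda>t. c * T f t)) \<and>
     (\<exists>C::real. \<forall>f\<in>B. N' (T f) \<le> ennreal C * N f)"

definition banach_frame ::
    "('s \<Rightarrow> complex) set \<Rightarrow> (('s \<Rightarrow> complex) \<Rightarrow> ennreal) \<Rightarrow>
     ('i \<Rightarrow> complex) set \<Rightarrow> (('i \<Rightarrow> complex) \<Rightarrow> ennreal) \<Rightarrow>
     ('i \<Rightarrow> ('s \<Rightarrow> complex) \<Rightarrow> complex) \<Rightarrow> bool" where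
  "banach_frame B N Bd Nd \<phi> \<longleftrightarrow>
     is_banach_fun_space B N \<and>
     is_banach_fun_space Bd Nd \<and>
     (\<forall>i. is_bounded_functional B N (\<phi> i)) \<and>
     (\<forall>f\<in>B. (\<lambda>i. \<phi> i f) \<in> Bd) \<and>
     (\<exists>a b::real. 0 < a \<and> a \<le> b \<and>
        (\<forall>f\<in>B. ennreal a * N f \<le> Nd (\<lambda>i. \<phi> i f) \<and> Nd (\<lambda>i. \<phi> i f) \<le> ennreal b * N f)) \<and>
     (\<exists>R. is_bounded_operator Bd Nd B N R \<and> (\<forall>f\<in>B. R (\<lambda>i. \<phi> i f) = f))"

definition pairing ::
    "'a measure \<Rightarrow> ('a \<Rightarrow> complex) \<Rightarrow> ('a \<Rightarrow> complex) \<Rightarrow> complex" where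
  "pairing M F H = (LINT y|M. F y * cnj (H y))"

end

theory Submission
  imports Defs
begin

text \<open>
  Choose for almost every \<open>y\<close> a sampling point \<open>x\<^sub>i\<close> with \<open>y \<in> x\<^sub>i + U\<close> and put
  \<open>S c = (\<lambda>y. c\<^bsub>i(y)\<^esub>) * G\<close>. As \<open>F = F * G\<close> and \<open>G(-z)\<close> is the conjugate of \<open>G z\<close>, the
  difference \<open>F y - F (x\<^sub>i)\<close> is dominated by \<open>\<integral>|F v| osc G (-y + v) dv\<close>, whose weighted norm is at most
  \<open>\<parallel>osc G\<parallel> \<parallel>F\<parallel>\<close> by a weighted Young inequality. Convolving with \<open>G\<close> gives
  \<open>\<parallel>F - S (F (x\<^sub>i))\<^sub>i\<parallel> \<le> \<parallel>osc G\<parallel> \<parallel>G\<parallel> \<parallel>F\<parallel>\<close>, a contraction, so that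
  \<open>F \<mapsto> S (F (x\<^sub>i))\<^sub>i\<close> is invertible on the reproducing kernel space by a Neumann series. The
  upper sampling bound follows from the same local estimate and the bounded overlap of the
  \<open>x\<^sub>i + U\<close>. Everything rests on Fubini's theorem; no continuity of \<open>G\<close> is used.
\<close>

section \<open>Powers in the extended nonnegative reals\<close>

text \<open>The values \<open>F (x i)\<close> are taken at single points, whereas symmetry and
  idempotence of \<open>G\<close> and the bound by \<open>osc\<close> hold only almost everywhere.
  Convolution bridges the gap: at each point it integrates against one translate of
  \<open>G\<close>, so almost-everywhere identities for \<open>G\<close> give identities for
  \<open>F\<close> at every point. Finiteness of \<open>alpha0\<close> makes that integral converge
  at each point by Hoelder's inequality. The two \<open>beta0\<close> terms of the control weight
  serve the norm estimates: Young's inequality on a nonunimodular group carries a power of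
  \<open>\<Delta>\<close> depending on \<open>p\<close>, and the powers in the control weight are
  those that turn the constant into a plain \<open>L^1_w\<close> norm, once for a kernel and once
  for its reflection. The reflection occurs because \<open>osc\<close> moves the argument of
  \<open>G\<close> on the left, while comparing \<open>F\<close> at neighbouring points moves it on
  the right; the symmetry of \<open>G\<close> exchanges the sides. What is inverted is
  \<open>T = S o E\<close> with \<open>E\<close> the sampling map; the reconstruction operator is
  the inverse of \<open>T\<close> following \<open>S\<close>, so it is defined and bounded on all
  sequences of the space.\<close>

lemma ennreal_powr_ennreal: "0 \<le> x \<Longrightarrow> ennreal_powr (ennreal x) r = ennreal (x powr r)"
  by (simp add: ennreal_powr_def)

lemma ennreal_powr_top [simp]: "ennreal_powr top r = top"
  by (simp add: ennreal_powr_def)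

lemma ennreal_powr_0 [simp]: "ennreal_powr 0 r = 0"
  by (simp add: ennreal_powr_def)

lemma ennreal_powr_one_right [simp]: "ennreal_powr a 1 = a"
  by (cases a) (auto simp: ennreal_powr_def)

lemma ennreal_powr_eq_0_iff [simp]: "ennreal_powr a r = 0 \<longleftrightarrow> a = 0"
  by (cases a) (auto simp: ennreal_powr_ennreal)

lemma ennreal_powr_eq_top_iff [simp]: "ennreal_powr a r = top \<longleftrightarrow> a = top"
  by (auto simp: ennreal_powr_def)

lemma ennreal_powr_less_top_iff [simp]: "ennreal_powr a r < top \<longleftrightarrow> a < top"
  by (simp add: less_top[symmetric])

lemma ennreal_powr_mono: "a \<le> b \<Longrightarrow> 0 \<le> r \<Longrightarrow> ennreal_powr a r \<le> ennreal_powr b r"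
  by (cases a; cases b) (auto simp: ennreal_powr_ennreal top_unique intro!: ennreal_leI powr_mono2)

lemma ennreal_powr_powr: "ennreal_powr (ennreal_powr a r) s = ennreal_powr a (r * s)"
  by (cases a) (auto simp: ennreal_powr_ennreal powr_powr)

lemma ennreal_powr_inverse1: "0 < r \<Longrightarrow> ennreal_powr (ennreal_powr a r) (1 / r) = a"
  by (simp add: ennreal_powr_powr)

lemma ennreal_powr_inverse2: "0 < r \<Longrightarrow> ennreal_powr (ennreal_powr a (1 / r)) r = a"
  by (simp add: ennreal_powr_powr)

lemma ennreal_powr_mult: "ennreal_powr (a * b) r = ennreal_powr a r * ennreal_powr b r"
proof (cases "a = top \<or> b = top")
  case True
  then show ?thesis
    by (auto simp: ennreal_top_mult ennreal_mult_top)
next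
  case False
  then obtain x y where "a = ennreal x" "b = ennreal y" "0 \<le> x" "0 \<le> y"
    by (metis ennreal_cases)
  then show ?thesis
    by (simp add: ennreal_mult[symmetric] ennreal_powr_ennreal powr_mult)
qed

lemma ennreal_powr_root_le_iff:
  "0 < r \<Longrightarrow> ennreal_powr a (1 / r) \<le> b \<longleftrightarrow> a \<le> ennreal_powr b r"
  by (metis ennreal_powr_inverse1 ennreal_powr_inverse2 ennreal_powr_mono less_imp_le
      zero_le_divide_1_iff)

lemma measurable_ennreal_powr [measurable]:
  assumes [measurable]: "f \<in> borel_measurable M"
  shows "(\<lambda>x. ennreal_powr (f x) r) \<in> borel_measurable M"
  unfolding ennreal_powr_def by measurable

section \<open>Jensen and Minkowski inequalities\<close>

text \<open>The tangent at \<open>s\<close> to the convex function \<open>u powr r\<close> lies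
  below it; put \<open>u = t / c\<close> and multiply by \<open>c\<close>. The bound is linear in
  \<open>t\<close>, so it can be integrated before \<open>s\<close> is chosen.\<close>

lemma weighted_young:
  fixes r s t c :: real
  assumes "1 \<le> r" "0 < s" "0 \<le> t" "0 < c"
  shows "r * s powr (r - 1) * t \<le> t powr r * c powr (1 - r) + (r - 1) * s powr r * c"
proof (cases "r = 1")
  case True
  then show ?thesis using assms by simp
next
  case False
  with assms have r: "r > 1" by simp
  define u where "u = t / c"
  have u: "0 \<le> u" "t = u * c" using assms by (auto simp: u_def)
  have "u * s powr (r - 1) \<le> u powr r / r + (s powr (r - 1)) powr (r / (r - 1)) / (r / (r - 1))"
    using r u by (intro Youngs_inequality) (auto simp: field_simps)
  also have "(s powr (r - 1)) powr (r / (r - 1)) = s powr r"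
    using r by (simp add: powr_powr)
  finally have "r * (u * s powr (r - 1)) \<le> r * (u powr r / r + s powr r / (r / (r - 1)))"
    using r by (intro mult_left_mono) auto
  also have "\<dots> = u powr r + (r - 1) * s powr r"
    using r by (simp add: field_simps)
  finally have "r * (u * s powr (r - 1)) * c \<le> (u powr r + (r - 1) * s powr r) * c"
    using assms by (intro mult_right_mono) auto
  moreover have "t powr r * c powr (1 - r) = u powr r * c"
    using assms u by (simp add: powr_mult powr_diff)
  ultimately show ?thesis
    using u by (simp add: algebra_simps)
qed

text \<open>Jensen's inequality for \<open>f / c\<close> and the measure with density
  \<open>c\<close>, where \<open>f\<close> may be infinite and the measure is not
  normalized.\<close>

lemma nn_integral_powr_Jensen:
  fixes c :: "'z \<Rightarrow> real" and f :: "'z \<Rightarrow> ennreal"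
  assumes r: "1 \<le> r"
    and [measurable]: "c \<in> borel_measurable N" "f \<in> borel_measurable N"
    and c: "\<And>z. 0 < c z"
    and fin: "(\<integral>\<^sup>+z. ennreal (c z) \<partial>N) < top"
  shows "ennreal_powr (\<integral>\<^sup>+z. f z \<partial>N) r
    \<le> ennreal_powr (\<integral>\<^sup>+z. ennreal (c z) \<partial>N) (r - 1)
       * (\<integral>\<^sup>+z. ennreal_powr (f z) r * ennreal (c z powr (1 - r)) \<partial>N)"
    (is "ennreal_powr ?A r \<le> ennreal_powr ?C (r - 1) * ?J")
proof (cases "?C = 0 \<or> ?J = top \<or> ?A = 0")
  case True
  \<comment> \<open>A positive density has integral zero only if \<open>N\<close> is the zero
    measure.\<close>
  moreover have "?A = 0" if "?C = 0"
  proof -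
    from that have "AE z in N. ennreal (c z) = 0"
      by (subst (asm) nn_integral_0_iff_AE) auto
    then have "AE z in N. False"
    proof eventually_elim
      case (elim z)
      then show ?case
        using c[of z] by (simp add: ennreal_eq_0_iff)
    qed
    then show ?thesis
      by (subst nn_integral_0_iff_AE) auto
  qed
  ultimately show ?thesis
    by (cases "?C = 0") (auto simp: ennreal_mult_top)
next
  case False
  obtain C where C: "?C = ennreal C" "0 < C"
    using False fin by (cases ?C) (auto simp: less_le)
  obtain J where J: "?J = ennreal J" "0 \<le> J"
    using False by (cases ?J) auto
  \<comment> \<open>\<open>weighted_young\<close> is integrated pointwise; the free parameter
    \<open>s\<close> is optimized afterwards.\<close>
  have key: "ennreal (r * s powr (r - 1)) * ?A \<le> ennreal (J + (r - 1) * s powr r * C)"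
    if s: "0 < s" for s
  proof -
    have "ennreal (r * s powr (r - 1)) * ?A = (\<integral>\<^sup>+z. ennreal (r * s powr (r - 1)) * f z \<partial>N)"
      by (simp add: nn_integral_cmult)
    also have "\<dots> \<le> (\<integral>\<^sup>+z. ennreal_powr (f z) r * ennreal (c z powr (1 - r))
        + ennreal ((r - 1) * s powr r) * ennreal (c z) \<partial>N)"
    proof (rule nn_integral_mono)
      fix z
      show "ennreal (r * s powr (r - 1)) * f z \<le> ennreal_powr (f z) r * ennreal (c z powr (1 - r))
        + ennreal ((r - 1) * s powr r) * ennreal (c z)"
      proof (cases "f z")
        case (real t)
        then have "ennreal (r * s powr (r - 1) * t)
            \<le> ennreal (t powr r * c z powr (1 - r) + (r - 1) * s powr r * c z)"
          using weighted_young[OF r s, of t "c z"] c by (intro ennreal_leI) auto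
        then show ?thesis
          using real r s c[of z] less_imp_le[OF c[of z]]
          by (simp add: ennreal_powr_ennreal ennreal_mult[symmetric] ennreal_plus[symmetric]
              del: ennreal_plus)
      next
        case top
        then show ?thesis using c[of z] by (simp add: ennreal_top_mult)
      qed
    qed
    also have "\<dots> = ?J + ennreal ((r - 1) * s powr r) * ?C"
      by (subst nn_integral_add) (auto simp: nn_integral_cmult)
    also have "\<dots> = ennreal (J + (r - 1) * s powr r * C)"
      using C J r by (simp add: ennreal_mult[symmetric] ennreal_plus[symmetric] del: ennreal_plus)
    finally show ?thesis .
  qed
  \<comment> \<open>Any single \<open>s\<close> bounds \<open>?A\<close>, which is therefore
    finite.\<close>
  have "?A \<noteq> top"
    using key[of 1] r by (auto simp: ennreal_mult_top top_unique)
  then obtain A where A: "?A = ennreal A" "0 < A"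
    using False by (cases ?A) (auto simp: less_le)
  \<comment> \<open>The mean of \<open>f / c\<close>; with the tangent at this point Jensen's
    inequality comes out with its sharp constant.\<close>
  define s where "s = A / C"
  have s: "0 < s" using A C by (simp add: s_def)
  have "ennreal (r * s powr (r - 1) * A) \<le> ennreal (J + (r - 1) * s powr r * C)"
    using key[OF s] A r by (simp add: ennreal_mult)
  then have "r * s powr (r - 1) * A \<le> J + (r - 1) * s powr r * C"
    using J C r by (subst (asm) ennreal_le_iff) auto
  moreover have "s powr (r - 1) * A = s powr r * C"
    using s A C by (simp add: powr_diff s_def)
  then have "r * s powr (r - 1) * A = r * (s powr r * C)"
    by (simp add: mult.assoc)
  ultimately have *: "s powr r * C \<le> J"
    by (simp add: left_diff_distrib)
  have "A powr r = s powr r * C powr r"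
    using A C by (simp add: s_def powr_divide)
  also have "\<dots> = C powr (r - 1) * (s powr r * C)"
    using C by (simp add: powr_diff)
  also have "\<dots> \<le> C powr (r - 1) * J"
    using * by (intro mult_left_mono) auto
  finally have "ennreal (A powr r) \<le> ennreal (C powr (r - 1) * J)"
    by (rule ennreal_leI)
  then show ?thesis
    using A C J by (simp add: ennreal_powr_ennreal ennreal_mult)
qed

text \<open>Minkowski's integral inequality, with \<open>c z\<close> bounding the norm of the slice
  at \<open>z\<close>. Strict positivity of \<open>c\<close> allows division by it in Jensen's
  inequality. The exchange of integrals is a hypothesis because the lemma serves counting measure as
  well as a density of Haar measure, where different Fubini theorems apply.\<close>

lemma nn_integral_powr_Minkowski:
  fixes c :: "'z \<Rightarrow> real" and f :: "'x \<Rightarrow> 'z \<Rightarrow> ennreal"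
  assumes r: "1 \<le> r"
    and [measurable]: "c \<in> borel_measurable N" "\<And>x. f x \<in> borel_measurable N"
    and c: "\<And>z. 0 < c z"
    and f: "\<And>z. (\<integral>\<^sup>+x. ennreal_powr (f x z) r \<partial>M) \<le> ennreal (c z powr r)"
    and fm [measurable]: "\<And>z. (\<lambda>x. f x z) \<in> borel_measurable M"
    and J [measurable]:
      "(\<lambda>x. \<integral>\<^sup>+z. ennreal_powr (f x z) r * ennreal (c z powr (1 - r)) \<partial>N) \<in> borel_measurable M"
    and swap:
      "(\<integral>\<^sup>+x. \<integral>\<^sup>+z. ennreal_powr (f x z) r * ennreal (c z powr (1 - r)) \<partial>N \<partial>M)
        = (\<integral>\<^sup>+z. \<integral>\<^sup>+x. ennreal_powr (f x z) r * ennreal (c z powr (1 - r)) \<partial>M \<partial>N)"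
  shows "(\<integral>\<^sup>+x. ennreal_powr (\<integral>\<^sup>+z. f x z \<partial>N) r \<partial>M)
    \<le> ennreal_powr (\<integral>\<^sup>+z. ennreal (c z) \<partial>N) r"
    (is "_ \<le> ennreal_powr ?C r")
proof (cases "?C = top")
  case False
  then have fin: "?C < top" by (simp add: less_top)
  have "(\<integral>\<^sup>+x. ennreal_powr (\<integral>\<^sup>+z. f x z \<partial>N) r \<partial>M)
      \<le> (\<integral>\<^sup>+x. ennreal_powr ?C (r - 1)
         * (\<integral>\<^sup>+z. ennreal_powr (f x z) r * ennreal (c z powr (1 - r)) \<partial>N) \<partial>M)"
    by (intro nn_integral_mono nn_integral_powr_Jensen r c fin) measurable
  also have "\<dots> = ennreal_powr ?C (r - 1)
      * (\<integral>\<^sup>+z. \<integral>\<^sup>+x. ennreal_powr (f x z) r * ennreal (c z powr (1 - r)) \<partial>M \<partial>N)"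
    by (simp add: nn_integral_cmult swap)
  also have "(\<integral>\<^sup>+z. \<integral>\<^sup>+x. ennreal_powr (f x z) r * ennreal (c z powr (1 - r)) \<partial>M \<partial>N)
      \<le> (\<integral>\<^sup>+z. ennreal (c z powr r) * ennreal (c z powr (1 - r)) \<partial>N)"
    by (intro nn_integral_mono) (auto simp: nn_integral_multc intro!: mult_right_mono f)
  also have "\<dots> = ?C"
    using c by (intro nn_integral_cong)
       (auto simp: ennreal_mult[symmetric] powr_add[symmetric] less_imp_le)
  finally have "(\<integral>\<^sup>+x. ennreal_powr (\<integral>\<^sup>+z. f x z \<partial>N) r \<partial>M) \<le> ennreal_powr ?C (r - 1) * ?C"
    by (simp add: mult_left_mono)
  also have "\<dots> = ennreal_powr ?C r"
    using fin by (cases ?C)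
      (auto simp: ennreal_powr_ennreal ennreal_mult[symmetric] powr_diff)
  finally show ?thesis .
qed simp

section \<open>The functional \<open>Lp_enorm\<close>\<close>

lemma exponent_cases [consumes 1, case_names top real]:
  fixes p :: ennreal
  assumes "1 \<le> p"
  obtains "p = top" | r where "p = ennreal r" "1 \<le> r"
  using assms by (cases p) auto

lemma Lp_enorm_top: "Lp_enorm M top h = esssup M h"
  by (simp add: Lp_enorm_def)

lemma Lp_enorm_ennreal:
  "1 \<le> r \<Longrightarrow> Lp_enorm M (ennreal r) h
     = ennreal_powr (\<integral>\<^sup>+x. ennreal_powr (h x) r \<partial>M) (1 / r)"
  by (simp add: Lp_enorm_def)

lemma Lp_enorm_one: "Lp_enorm M 1 h = (\<integral>\<^sup>+x. h x \<partial>M)"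
  using Lp_enorm_ennreal[of 1 M h] by simp

lemma Lp_enorm_ennreal_le_iff:
  "1 \<le> r \<Longrightarrow> Lp_enorm M (ennreal r) h \<le> t
     \<longleftrightarrow> (\<integral>\<^sup>+x. ennreal_powr (h x) r \<partial>M) \<le> ennreal_powr t r"
  by (simp add: Lp_enorm_ennreal ennreal_powr_root_le_iff)

lemma Lp_enorm_ennreal_powr:
  "1 \<le> r \<Longrightarrow> ennreal_powr (Lp_enorm M (ennreal r) h) r = (\<integral>\<^sup>+x. ennreal_powr (h x) r \<partial>M)"
  by (simp add: Lp_enorm_ennreal ennreal_powr_inverse2)

lemma Lp_enorm_top_le_iff:
  "h \<in> borel_measurable M \<Longrightarrow> Lp_enorm M top h \<le> t \<longleftrightarrow> (AE x in M. h x \<le> t)"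
  unfolding Lp_enorm_top using esssup_AE[of h M] by (auto intro: esssup_I elim: eventually_mono)

lemma Lp_enorm_mono_AE:
  assumes p: "1 \<le> p" and h: "h \<in> borel_measurable M" and le: "AE x in M. h x \<le> g x"
  shows "Lp_enorm M p h \<le> Lp_enorm M p g"
  using p
proof (cases rule: exponent_cases)
  case top
  then show ?thesis using h le by (simp add: Lp_enorm_top esssup_AE_mono)
next
  case (real r)
  have "(\<integral>\<^sup>+x. ennreal_powr (h x) r \<partial>M) \<le> (\<integral>\<^sup>+x. ennreal_powr (g x) r \<partial>M)"
    using real le by (intro nn_integral_mono_AE) (auto intro: ennreal_powr_mono elim!: eventually_mono)
  then show ?thesis
    using real by (simp add: Lp_enorm_ennreal ennreal_powr_mono)
qed

lemma Lp_enorm_0 [simp]: "1 \<le> p \<Longrightarrow> Lp_enorm M p (\<lambda>x. 0) = 0"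
  by (cases rule: exponent_cases[of p])
     (auto simp: Lp_enorm_ennreal le_zero_eq[symmetric] Lp_enorm_top_le_iff simp del: le_zero_eq)

lemma Lp_enorm_eq_0D:
  assumes p: "1 \<le> p" and [measurable]: "h \<in> borel_measurable M" and "Lp_enorm M p h = 0"
  shows "AE x in M. h x = 0"
  using p
proof (cases rule: exponent_cases)
  case top
  then show ?thesis
    using assms Lp_enorm_top_le_iff[of h M 0] by auto
next
  case (real r)
  then show ?thesis
    using assms by (simp add: Lp_enorm_ennreal nn_integral_0_iff_AE)
qed

lemma Lp_enorm_finite_AE:
  assumes p: "1 \<le> p" and [measurable]: "h \<in> borel_measurable M" and fin: "Lp_enorm M p h < top"
  shows "AE x in M. h x < top"
  using p
proof (cases rule: exponent_cases)
  case top
  then have "AE x in M. h x \<le> Lp_enorm M p h"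
    using Lp_enorm_top_le_iff[of h M "Lp_enorm M p h"] by auto
  then show ?thesis using fin by (auto elim!: eventually_mono)
next
  case (real r)
  then have "(\<integral>\<^sup>+x. ennreal_powr (h x) r \<partial>M) \<noteq> \<infinity>"
    using fin by (auto simp: Lp_enorm_ennreal)
  then have "AE x in M. ennreal_powr (h x) r \<noteq> \<infinity>"
    by (intro nn_integral_PInf_AE) measurable
  then show ?thesis by (auto simp: less_top elim!: eventually_mono)
qed

lemma Lp_enorm_cmult_le:
  assumes p: "1 \<le> p" and [measurable]: "h \<in> borel_measurable M"
  shows "Lp_enorm M p (\<lambda>x. c * h x) \<le> c * Lp_enorm M p h"
  using p
proof (cases rule: exponent_cases)
  case top
  have "AE x in M. h x \<le> Lp_enorm M top h"
    using Lp_enorm_top_le_iff[of h M "Lp_enorm M top h"] by auto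
  then show ?thesis
    unfolding top by (subst Lp_enorm_top_le_iff) (auto elim!: eventually_mono intro: mult_left_mono)
next
  case (real r)
  then show ?thesis
    by (simp add: Lp_enorm_ennreal ennreal_powr_mult nn_integral_cmult ennreal_powr_powr)
qed

lemma Lp_enorm_cmult:
  assumes p: "1 \<le> p" and [measurable]: "h \<in> borel_measurable M" and t: "0 \<le> t"
  shows "Lp_enorm M p (\<lambda>x. ennreal t * h x) = ennreal t * Lp_enorm M p h"
proof (cases "t = 0")
  case False
  with t have t: "0 < t" by simp
  have inv: "ennreal t * (ennreal (1 / t) * a) = a" "ennreal (1 / t) * (ennreal t * a) = a" for a
    using t by (simp_all add: mult.assoc[symmetric] ennreal_mult[symmetric])
  \<comment> \<open>The reverse inequality is the same bound with the factor
    \<open>1 / t\<close>.\<close>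
  have "ennreal t * Lp_enorm M p h = ennreal t * Lp_enorm M p (\<lambda>x. ennreal (1/t) * (ennreal t * h x))"
    by (simp add: inv)
  also have "\<dots> \<le> ennreal t * (ennreal (1/t) * Lp_enorm M p (\<lambda>x. ennreal t * h x))"
    by (intro mult_left_mono Lp_enorm_cmult_le p) auto
  finally have "ennreal t * Lp_enorm M p h \<le> Lp_enorm M p (\<lambda>x. ennreal t * h x)"
    by (simp add: inv)
  then show ?thesis
    using Lp_enorm_cmult_le[OF p assms(2), of "ennreal t"] by (rule antisym[rotated])
qed (simp add: p)

lemma Lp_enorm_suminf:
  fixes h :: "nat \<Rightarrow> 'a \<Rightarrow> ennreal"
  assumes p: "1 \<le> p" and h [measurable]: "\<And>n. h n \<in> borel_measurable M"
  shows "Lp_enorm M p (\<lambda>x. \<Sum>n. h n x) \<le> (\<Sum>n. Lp_enorm M p (h n))"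
  using p
proof (cases rule: exponent_cases)
  case top
  have "AE x in M. \<forall>n. h n x \<le> Lp_enorm M top (h n)"
    unfolding AE_all_countable using Lp_enorm_top_le_iff[OF h] by blast
  then show ?thesis
    unfolding top by (subst Lp_enorm_top_le_iff) (auto elim!: eventually_mono intro!: suminf_le)
next
  case (real r)
  show ?thesis
  proof (rule ennreal_le_epsilon)
    fix e :: real
    assume fin: "(\<Sum>n. Lp_enorm M p (h n)) < top" and e: "0 < e"
    have fin1: "Lp_enorm M p (h n) < top" for n
      using fin by (rule ennreal_suminf_lessD)
    \<comment> \<open>A norm may vanish, but Minkowski's inequality takes positive bounds; the
      excess terms sum to the arbitrary \<open>e\<close>.\<close>
    define c where "c n = enn2real (Lp_enorm M p (h n)) + e * (1/2) ^ Suc n" for n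
    have c: "0 < c n" for n
      using e by (auto simp: c_def intro!: add_nonneg_pos)
    have c': "ennreal (c n) = Lp_enorm M p (h n) + ennreal (e * (1/2) ^ Suc n)" for n
      using e fin1[of n] unfolding c_def by (subst ennreal_plus) auto
    have half: "(\<Sum>n. ennreal (e * (1/2) ^ Suc n)) = ennreal e"
      using sums_mult[OF power_half_series, of e] e
      by (subst suminf_ennreal_eq[where x = e]) (auto simp: sums_iff)
    have sumc: "(\<Sum>n. ennreal (c n)) = (\<Sum>n. Lp_enorm M p (h n)) + ennreal e"
      unfolding c' by (subst suminf_add[symmetric]) (simp_all only: half summableI)
    have "(\<integral>\<^sup>+x. ennreal_powr (\<integral>\<^sup>+n. h n x \<partial>count_space UNIV) r \<partial>M)
      \<le> ennreal_powr (\<integral>\<^sup>+n. ennreal (c n) \<partial>count_space UNIV) r"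
    proof (rule nn_integral_powr_Minkowski)
      fix n
      have "Lp_enorm M (ennreal r) (h n) \<le> ennreal (c n)"
        using c' real by simp
      then show "(\<integral>\<^sup>+x. ennreal_powr (h n x) r \<partial>M) \<le> ennreal (c n powr r)"
        using real c[of n] by (simp add: Lp_enorm_ennreal_le_iff ennreal_powr_ennreal)
    qed (use real c in \<open>auto simp: nn_integral_count_space_nat nn_integral_suminf\<close>)
    then show "Lp_enorm M p (\<lambda>x. \<Sum>n. h n x) \<le> (\<Sum>n. Lp_enorm M p (h n)) + ennreal e"
      using real sumc by (simp add: Lp_enorm_ennreal_le_iff nn_integral_count_space_nat)
  qed
qed

lemma Lp_enorm_add:
  assumes p: "1 \<le> p" and [measurable]: "f \<in> borel_measurable M" "g \<in> borel_measurable M"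
  shows "Lp_enorm M p (\<lambda>x. f x + g x) \<le> Lp_enorm M p f + Lp_enorm M p g"
proof -
  define h where "h n = (if n = 0 then f else if n = 1 then g else (\<lambda>x. 0))" for n :: nat
  have [measurable]: "h n \<in> borel_measurable M" for n
    by (simp add: h_def)
  have "(\<Sum>n. h n x) = (\<Sum>n\<in>{0, 1}. h n x)" for x
    by (rule suminf_finite) (auto simp: h_def)
  moreover have "(\<Sum>n. Lp_enorm M p (h n)) = (\<Sum>n\<in>{0, 1}. Lp_enorm M p (h n))"
    by (rule suminf_finite) (auto simp: h_def p)
  ultimately show ?thesis
    using Lp_enorm_suminf[OF p, of h M] by (simp add: h_def)
qed

section \<open>Weighted Lebesgue spaces\<close>

context
  fixes M :: "'a measure" and p :: ennreal and v :: "'a \<Rightarrow> real"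
  assumes p: "1 \<le> p" and v [measurable]: "v \<in> borel_measurable M" and v_pos: "\<And>x. 0 < v x"
begin

lemma weighted_Lp_measurable: "f \<in> weighted_Lp M p v \<Longrightarrow> f \<in> borel_measurable M"
  by (simp add: weighted_Lp_def)

lemma weighted_Lp_norm_add:
  assumes [measurable]: "f \<in> borel_measurable M" "g \<in> borel_measurable M"
  shows "weighted_Lp_norm M p v (\<lambda>x. f x + g x) \<le> weighted_Lp_norm M p v f + weighted_Lp_norm M p v g"
proof -
  have "weighted_Lp_norm M p v (\<lambda>x. f x + g x)
      \<le> Lp_enorm M p (\<lambda>x. ennreal (cmod (f x) * v x) + ennreal (cmod (g x) * v x))"
    unfolding weighted_Lp_norm_def
  proof (intro Lp_enorm_mono_AE p AE_I2)
    fix x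
    have "cmod (f x + g x) * v x \<le> cmod (f x) * v x + cmod (g x) * v x"
      using v_pos[of x] norm_triangle_ineq[of "f x" "g x"] 
      by (simp add: distrib_right[symmetric] mult_right_mono)
    then show "ennreal (cmod (f x + g x) * v x) \<le> ennreal (cmod (f x) * v x) + ennreal (cmod (g x) * v x)"
      using v_pos[of x] by (simp add: ennreal_plus[symmetric] less_imp_le ennreal_leI del: ennreal_plus)
  qed measurable
  also have "\<dots> \<le> weighted_Lp_norm M p v f + weighted_Lp_norm M p v g"
    unfolding weighted_Lp_norm_def by (intro Lp_enorm_add p) measurable
  finally show ?thesis .
qed

lemma weighted_Lp_norm_cmult:
  assumes [measurable]: "f \<in> borel_measurable M"
  shows "weighted_Lp_norm M p v (\<lambda>x. c * f x) = ennreal (cmod c) * weighted_Lp_norm M p v f"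
proof -
  have "(\<lambda>x. ennreal (cmod (c * f x) * v x)) = (\<lambda>x. ennreal (cmod c) * ennreal (cmod (f x) * v x))"
    using v_pos by (auto simp: fun_eq_iff norm_mult ennreal_mult[symmetric] less_imp_le mult.assoc)
  then show ?thesis
    unfolding weighted_Lp_norm_def by (simp add: Lp_enorm_cmult p)
qed

lemma weighted_Lp_norm_diff_commute:
  "weighted_Lp_norm M p v (\<lambda>x. f x - g x) = weighted_Lp_norm M p v (\<lambda>x. g x - f x)"
  by (simp add: weighted_Lp_norm_def norm_minus_commute)

lemma weighted_Lp_norm_zero [simp]: "weighted_Lp_norm M p v (\<lambda>x. 0) = 0"
  by (simp add: weighted_Lp_norm_def p)

lemma weighted_Lp_norm_mono:
  assumes [measurable]: "f \<in> borel_measurable M"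
    and "AE x in M. ennreal (cmod (f x) * v x) \<le> g x"
  shows "weighted_Lp_norm M p v f \<le> Lp_enorm M p g"
  unfolding weighted_Lp_norm_def by (intro Lp_enorm_mono_AE p assms(2)) measurable

lemma weighted_Lp_norm_eq_0D:
  assumes [measurable]: "f \<in> borel_measurable M" and 0: "weighted_Lp_norm M p v f = 0"
  shows "AE x in M. f x = 0"
proof -
  have "AE x in M. ennreal (cmod (f x) * v x) = 0"
    using 0 unfolding weighted_Lp_norm_def by (intro Lp_enorm_eq_0D[OF p]) auto
  then show ?thesis
  proof eventually_elim
    case (elim x)
    then show ?case
      using v_pos[of x] by (simp add: ennreal_eq_0_iff mult_le_0_iff)
  qed
qed

lemma weighted_Lp_add:
  "f \<in> weighted_Lp M p v \<Longrightarrow> g \<in> weighted_Lp M p v \<Longrightarrow> (\<lambda>x. f x + g x) \<in> weighted_Lp M p v"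
  using weighted_Lp_norm_add[of f g] by (auto simp: weighted_Lp_def intro: le_less_trans)

lemma weighted_Lp_cmult: "f \<in> weighted_Lp M p v \<Longrightarrow> (\<lambda>x. c * f x) \<in> weighted_Lp M p v"
  by (auto simp: weighted_Lp_def weighted_Lp_norm_cmult ennreal_mult_less_top)

lemma weighted_Lp_zero: "(\<lambda>x. 0) \<in> weighted_Lp M p v"
  by (simp add: weighted_Lp_def)

lemma weighted_Lp_diff:
  "f \<in> weighted_Lp M p v \<Longrightarrow> g \<in> weighted_Lp M p v \<Longrightarrow> (\<lambda>x. f x - g x) \<in> weighted_Lp M p v"
  using weighted_Lp_add[of f "\<lambda>x. (-1) * g x"] weighted_Lp_cmult[of g "-1"] by simp

lemma weighted_Lp_norm_diff_triangle:
  assumes [measurable]: "f \<in> borel_measurable M" "g \<in> borel_measurable M" "h \<in> borel_measurable M"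
  shows "weighted_Lp_norm M p v (\<lambda>x. f x - h x)
    \<le> weighted_Lp_norm M p v (\<lambda>x. f x - g x) + weighted_Lp_norm M p v (\<lambda>x. g x - h x)"
  using weighted_Lp_norm_add[of "\<lambda>x. f x - g x" "\<lambda>x. g x - h x"] by simp

text \<open>The Riesz-Fischer argument: along a fast subsequence the absolute differences sum to a
  function of finite norm, so the subsequence converges almost everywhere, and the tails of the sum
  bound the distance to the limit.\<close>

lemma weighted_Lp_complete:
  fixes f :: "nat \<Rightarrow> 'a \<Rightarrow> complex"
  assumes f: "\<And>n. f n \<in> weighted_Lp M p v"
    and Cauchy: "\<And>e. 0 < e \<Longrightarrow> \<exists>n0. \<forall>k\<ge>n0. \<forall>n\<ge>n0. weighted_Lp_norm M p v (\<lambda>x. f k x - f n x) < e"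
  shows "\<exists>g\<in>weighted_Lp M p v. (\<lambda>n. weighted_Lp_norm M p v (\<lambda>x. f n x - g x)) \<longlonglongrightarrow> 0"
proof -
  let ?N = "weighted_Lp_norm M p v"
  have fm [measurable]: "f n \<in> borel_measurable M" for n
    using f by (rule weighted_Lp_measurable)
  have "\<forall>k. \<exists>n0. \<forall>i\<ge>n0. \<forall>j\<ge>n0. ?N (\<lambda>x. f i x - f j x) < ennreal ((1/2)^k)"
    using Cauchy by simp
  then obtain \<nu> where \<nu>: "\<And>k i j. \<nu> k \<le> i \<Longrightarrow> \<nu> k \<le> j \<Longrightarrow> ?N (\<lambda>x. f i x - f j x) < ennreal ((1/2)^k)"
    by metis
  \<comment> \<open>The partial sums increase and dominate each \<open>\<nu> k\<close>, so the
    indices \<open>\<phi> k\<close> and \<open>\<phi> (Suc k)\<close> both lie beyond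
    \<open>\<nu> k\<close>.\<close>
  define \<phi> where "\<phi> k = (\<Sum>j\<le>k. \<nu> j)" for k
  have \<phi>: "\<nu> k \<le> \<phi> k" "\<nu> k \<le> \<phi> (Suc k)" for k
    unfolding \<phi>_def by (auto intro!: member_le_sum simp del: sum.atMost_Suc)
  define d where "d k x = ennreal (cmod (f (\<phi> (Suc k)) x - f (\<phi> k) x) * v x)" for k x
  have d [measurable]: "d k \<in> borel_measurable M" for k
    unfolding d_def by measurable
  have d_norm: "Lp_enorm M p (d k) \<le> ennreal ((1/2)^k)" for k
    using \<nu>[OF \<phi>(2) \<phi>(1), of k] unfolding d_def weighted_Lp_norm_def by (rule less_imp_le)
  define S where "S k x = (\<Sum>j. d (j + k) x)" for k x
  have [measurable]: "S k \<in> borel_measurable M" for k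
    unfolding S_def by measurable
  have S_norm: "Lp_enorm M p (S k) \<le> ennreal (2 * (1/2)^k)" for k
  proof -
    have "Lp_enorm M p (S k) \<le> (\<Sum>j. Lp_enorm M p (d (j + k)))"
      unfolding S_def by (intro Lp_enorm_suminf p d)
    also have "\<dots> \<le> (\<Sum>j. ennreal ((1/2)^(j + k)))"
      by (intro suminf_le d_norm summableI)
    also have "\<dots> = ennreal (2 * (1/2)^k)"
      using sums_mult2[OF geometric_sums[of "1/2::real"], of "(1/2)^k"]
      by (intro suminf_ennreal_eq) (auto simp: power_add)
    finally show ?thesis .
  qed
  \<comment> \<open>\<open>lim\<close> is total, so \<open>g\<close> is measurable without first
    removing the null set of divergence.\<close>
  define g where "g x = lim (\<lambda>k. f (\<phi> k) x)" for x
  have g [measurable]: "g \<in> borel_measurable M"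
    unfolding g_def by measurable
  have "AE x in M. S 0 x < top"
    using S_norm[of 0] by (intro Lp_enorm_finite_AE[OF p]) (auto intro: le_less_trans)
  then have close: "AE x in M. \<forall>k. ennreal (cmod (g x - f (\<phi> k) x) * v x) \<le> S k x"
  proof eventually_elim
    case (elim x)
    define a where "a j = cmod (f (\<phi> (Suc j)) x - f (\<phi> j) x)" for j
    have dx: "d j x = ennreal (a j * v x)" for j
      by (simp add: d_def a_def)
    have nn: "0 \<le> a j * v x" for j
      using v_pos[of x] by (simp add: a_def less_imp_le)
    have "summable (\<lambda>j. a j * v x)"
      using elim nn unfolding S_def dx by (intro summable_suminf_not_top) auto
    then have suma: "summable a"
      using v_pos[of x] summable_divide[of "\<lambda>j. a j * v x" "v x"] by simp
    then have sumk: "summable (\<lambda>j. a (j + k))" for k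
      by (rule summable_ignore_initial_segment)
    from suma have sumd: "summable (\<lambda>j. f (\<phi> (Suc j)) x - f (\<phi> j) x)"
      unfolding a_def by (rule summable_norm_cancel)
    have "convergent (\<lambda>n. f (\<phi> n) x)"
    proof -
      have "(\<lambda>n. \<Sum>j<n. f (\<phi> (Suc j)) x - f (\<phi> j) x) = (\<lambda>n. f (\<phi> n) x - f (\<phi> 0) x)"
        by (simp add: sum_lessThan_telescope[of "\<lambda>j. f (\<phi> j) x"])
      moreover have "convergent (\<lambda>n. \<Sum>j<n. f (\<phi> (Suc j)) x - f (\<phi> j) x)"
        using sumd summable_iff_convergent by blast
      ultimately show ?thesis
        using convergent_add[OF _ convergent_const[of "f (\<phi> 0) x"],
            of "\<lambda>n. f (\<phi> n) x - f (\<phi> 0) x"] by simp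
    qed
    then have lim: "(\<lambda>n. f (\<phi> n) x) \<longlonglongrightarrow> g x"
      by (simp add: g_def convergent_LIMSEQ_iff)
    show ?case
    proof
      fix k
      have "cmod (f (\<phi> (n + k)) x - f (\<phi> k) x) \<le> (\<Sum>j. a (j + k))" for n
      proof -
        have "f (\<phi> (n + k)) x - f (\<phi> k) x = (\<Sum>j<n. f (\<phi> (Suc (j + k))) x - f (\<phi> (j + k)) x)"
          using sum_lessThan_telescope[of "\<lambda>j. f (\<phi> (j + k)) x" n] by simp
        then have "cmod (f (\<phi> (n + k)) x - f (\<phi> k) x) \<le> (\<Sum>j<n. a (j + k))"
          unfolding a_def by (simp only: norm_sum)
        also have "\<dots> \<le> (\<Sum>j. a (j + k))"
          using sumk by (intro sum_le_suminf) (auto simp: a_def)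
        finally show ?thesis .
      qed
      moreover have "(\<lambda>n. cmod (f (\<phi> (n + k)) x - f (\<phi> k) x)) \<longlonglongrightarrow> cmod (g x - f (\<phi> k) x)"
        by (intro tendsto_intros LIMSEQ_ignore_initial_segment lim)
      ultimately have "cmod (g x - f (\<phi> k) x) \<le> (\<Sum>j. a (j + k))"
        by (intro LIMSEQ_le_const2) auto
      then have "cmod (g x - f (\<phi> k) x) * v x \<le> (\<Sum>j. a (j + k)) * v x"
        using v_pos[of x] by (intro mult_right_mono) auto
      also have "\<dots> = (\<Sum>j. a (j + k) * v x)"
        using sumk by (intro suminf_mult2)
      finally have "ennreal (cmod (g x - f (\<phi> k) x) * v x) \<le> ennreal (\<Sum>j. a (j + k) * v x)"
        by (rule ennreal_leI)
      also have "\<dots> = S k x"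
        unfolding S_def dx using sumk nn
        by (intro suminf_ennreal2[symmetric]) (auto intro: summable_mult2)
      finally show "ennreal (cmod (g x - f (\<phi> k) x) * v x) \<le> S k x" .
    qed
  qed
  have gf: "?N (\<lambda>x. g x - f (\<phi> k) x) \<le> ennreal (2 * (1/2)^k)" for k
    using close by (intro order_trans[OF weighted_Lp_norm_mono S_norm[of k]]) (auto elim: eventually_mono)
  have bound: "?N (\<lambda>x. f n x - g x) \<le> ennreal (3 * (1/2)^k)" if "\<nu> k \<le> n" for n k
  proof -
    have "?N (\<lambda>x. f n x - g x) \<le> ?N (\<lambda>x. f n x - f (\<phi> k) x) + ?N (\<lambda>x. f (\<phi> k) x - g x)"
      by (rule weighted_Lp_norm_diff_triangle) measurable
    also have "\<dots> \<le> ennreal ((1/2)^k) + ennreal (2 * (1/2)^k)"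
      using \<nu>[OF that \<phi>(1)] gf[of k] 
      by (intro add_mono) (auto simp: weighted_Lp_norm_diff_commute[of g] less_imp_le)
    also have "\<dots> = ennreal (3 * (1/2)^k)"
      by (subst ennreal_plus[symmetric]) auto
    finally show ?thesis .
  qed
  have "(\<lambda>x. (g x - f (\<phi> 0) x) + f (\<phi> 0) x) \<in> weighted_Lp M p v"
  proof (rule weighted_Lp_add)
    show "(\<lambda>x. g x - f (\<phi> 0) x) \<in> weighted_Lp M p v"
      using gf[of 0] by (auto simp: weighted_Lp_def intro: le_less_trans)
  qed (rule f)
  then have "g \<in> weighted_Lp M p v" by simp
  moreover have "(\<lambda>n. ?N (\<lambda>x. f n x - g x)) \<longlonglongrightarrow> 0"
  proof (rule order_tendstoI)
    fix e :: ennreal assume e: "0 < e"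
    have "(\<lambda>k. ennreal (3 * (1/2)^k)) \<longlonglongrightarrow> ennreal (3 * 0)"
      by (intro tendsto_ennrealI tendsto_mult tendsto_const LIMSEQ_power_zero) auto
    then have "eventually (\<lambda>k. ennreal (3 * (1/2)^k) < e) sequentially"
      using e by (intro order_tendstoD(2)) auto
    then obtain k where k: "ennreal (3 * (1/2)^k) < e"
      by (auto simp: eventually_sequentially)
    show "eventually (\<lambda>n. ?N (\<lambda>x. f n x - g x) < e) sequentially"
      using bound[of k] k by (intro eventually_sequentiallyI[of "\<nu> k"]) (blast intro: le_less_trans)
  qed auto
  ultimately show ?thesis by blast
qed

end

section \<open>Weighted sequence spaces as Lebesgue spaces of counting measure\<close>

lemma infsum_ennreal_eq_nn_integral:
  fixes f :: "'i \<Rightarrow> ennreal"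
  assumes "countable (UNIV :: 'i set)"
  shows "(\<Sum>\<^sub>\<infinity>i. f i) = (\<integral>\<^sup>+i. f i \<partial>count_space UNIV)"
proof (rule antisym)
  have fin: "sum f A = (\<integral>\<^sup>+i. f i * indicator A i \<partial>count_space UNIV)" if "finite A" for A
    using that by (subst nn_integral_count_space'[of A]) (auto simp: indicator_def)
  have SUP: "(\<Sum>\<^sub>\<infinity>i. f i) = (SUP A\<in>{A. finite A \<and> A \<subseteq> UNIV}. sum f A)"
    by (rule nonneg_infsum_complete) auto
  show "(\<Sum>\<^sub>\<infinity>i. f i) \<le> (\<integral>\<^sup>+i. f i \<partial>count_space UNIV)"
    unfolding SUP by (rule SUP_least) (auto simp: fin intro!: nn_integral_mono split: split_indicator)
  define A where "A n = from_nat_into (UNIV :: 'i set) ` {..<n}" for n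
  have A: "finite (A n)" for n
    by (simp add: A_def)
  have "incseq A"
    by (auto simp: A_def incseq_def)
  have "\<exists>n. i \<in> A n" for i
    using from_nat_into_surj[OF assms, of i] by (auto simp: A_def)
  then have "f i = (SUP n. f i * indicator (A n) i)" for i
  proof (intro antisym SUP_least)
    assume "\<And>i. \<exists>n. i \<in> A n"
    then obtain n where "i \<in> A n" by blast
    then show "f i \<le> (SUP n. f i * indicator (A n) i)"
      by (intro SUP_upper2[of n]) auto
  qed (auto split: split_indicator)
  then have "(\<integral>\<^sup>+i. f i \<partial>count_space UNIV) = (\<integral>\<^sup>+i. (SUP n. f i * indicator (A n) i) \<partial>count_space UNIV)"
    by simp
  also have "\<dots> = (SUP n. \<integral>\<^sup>+i. f i * indicator (A n) i \<partial>count_space UNIV)"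
    using \<open>incseq A\<close> by (intro nn_integral_monotone_convergence_SUP)
       (auto simp: incseq_def le_fun_def split: split_indicator)
  also have "\<dots> \<le> (\<Sum>\<^sub>\<infinity>i. f i)"
    unfolding SUP fin[OF A, symmetric] by (rule SUP_least) (auto intro: SUP_upper A)
  finally show "(\<integral>\<^sup>+i. f i \<partial>count_space UNIV) \<le> (\<Sum>\<^sub>\<infinity>i. f i)" .
qed

lemma weighted_lp_norm_eq:
  fixes v :: "'i \<Rightarrow> real"
  assumes "countable (UNIV :: 'i set)" and p: "1 \<le> p" and v: "\<And>i. 0 < v i"
  shows "weighted_lp_norm p v = weighted_Lp_norm (count_space UNIV) p v"
proof
  fix c
  from p show "weighted_lp_norm p v c = weighted_Lp_norm (count_space UNIV) p v c"
  proof (cases rule: exponent_cases)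
    case top
    show ?thesis
      unfolding weighted_lp_norm_def weighted_Lp_norm_def top Lp_enorm_top
      by (subst esssup_eq_AE) (auto simp: AE_count_space intro!: antisym SUP_least Inf_greatest
          Inf_lower SUP_upper)
  next
    case (real r)
    then show ?thesis
      using v by (simp add: weighted_lp_norm_def weighted_Lp_norm_def Lp_enorm_ennreal
          infsum_ennreal_eq_nn_integral[OF assms(1)] ennreal_powr_ennreal less_imp_le)
  qed
qed

lemma weighted_lp_eq:
  fixes v :: "'i \<Rightarrow> real"
  assumes "countable (UNIV :: 'i set)" "1 \<le> p" "\<And>i. 0 < v i"
  shows "weighted_lp p v = weighted_Lp (count_space UNIV) p v"
  by (simp add: weighted_lp_def weighted_Lp_def weighted_lp_norm_eq[OF assms])

lemma le_weighted_lp_norm: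
  fixes v :: "'i \<Rightarrow> real"
  assumes "countable (UNIV :: 'i set)" and p: "1 \<le> p" and v: "\<And>i. 0 < v i"
  shows "ennreal (cmod (c i) * v i) \<le> weighted_lp_norm p v c"
  using p
proof (cases rule: exponent_cases)
  case top
  then show ?thesis by (auto simp: weighted_lp_norm_def intro: SUP_upper)
next
  case (real r)
  have "ennreal_powr (ennreal (cmod (c i) * v i)) r
      \<le> (\<integral>\<^sup>+j. ennreal_powr (ennreal (cmod (c j) * v j)) r \<partial>count_space UNIV)"
    by (rule nn_integral_ge_point) simp
  then have "ennreal_powr (ennreal_powr (ennreal (cmod (c i) * v i)) r) (1 / r)
      \<le> weighted_Lp_norm (count_space UNIV) p v c"
    using real unfolding weighted_Lp_norm_def by (simp add: Lp_enorm_ennreal ennreal_powr_mono)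
  then show ?thesis
    using real assms by (simp add: ennreal_powr_inverse1 weighted_lp_norm_eq)
qed

section \<open>Fubini's theorem for Radon measures\<close>

text \<open>Directedness lets one index serve all summands at once, so the supremum may be taken
  outside a finite sum.\<close>

lemma ennreal_SUP_sum_directed:
  fixes f :: "'n \<Rightarrow> 'i \<Rightarrow> ennreal"
  assumes "finite A" "I \<noteq> {}"
    and "\<And>i j. i \<in> I \<Longrightarrow> j \<in> I \<Longrightarrow> \<exists>k\<in>I. \<forall>n\<in>A. f n i \<le> f n k \<and> f n j \<le> f n k"
  shows "(\<Sum>n\<in>A. SUP i\<in>I. f n i) = (SUP i\<in>I. \<Sum>n\<in>A. f n i)"
  using assms
proof (induction A rule: finite_induct)
  case (insert a A)
  have IH: "(\<Sum>n\<in>A. SUP i\<in>I. f n i) = (SUP i\<in>I. \<Sum>n\<in>A. f n i)"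
    using insert.prems by (intro insert.IH) (meson insertI2)+
  have "(SUP i\<in>I. f a i) + (SUP i\<in>I. \<Sum>n\<in>A. f n i) = (SUP i\<in>I. f a i + (\<Sum>n\<in>A. f n i))"
  proof (rule SUP_add_directed_ennreal[symmetric])
    fix i j assume "i \<in> I" "j \<in> I"
    then obtain k where k: "k \<in> I" "\<forall>n\<in>insert a A. f n i \<le> f n k \<and> f n j \<le> f n k"
      using insert.prems by meson
    then show "\<exists>k\<in>I. f a i + (\<Sum>n\<in>A. f n j) \<le> f a k + (\<Sum>n\<in>A. f n k)"
      by (intro bexI[of _ k] add_mono sum_mono) auto
  qed
  then show ?case
    using insert IH by simp
qed auto

text \<open>Writes the Bochner integral through nonnegative integrals, including its value 0 on
  non-integrable functions, so that measurability in a parameter reduces to nonnegative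
  integrands.\<close>

lemma integral_real_eq_if:
  fixes f :: "'b \<Rightarrow> real"
  assumes [measurable]: "f \<in> borel_measurable N"
  shows "(LINT y|N. f y) = (if (\<integral>\<^sup>+y. ennreal \<bar>f y\<bar> \<partial>N) < top
     then enn2real (\<integral>\<^sup>+y. ennreal (f y) \<partial>N) - enn2real (\<integral>\<^sup>+y. ennreal (- f y) \<partial>N) else 0)"
proof (cases "integrable N f")
  case True
  then show ?thesis
    by (auto simp: real_lebesgue_integral_def integrable_iff_bounded)
next
  case False
  then show ?thesis
    by (auto simp: integrable_iff_bounded not_integrable_integral_eq)
qed

lemma integral_complex_eq_if:
  fixes f :: "'b \<Rightarrow> complex"
  assumes [measurable]: "f \<in> borel_measurable N"
  shows "(LINT y|N. f y) = (if (\<integral>\<^sup>+y. ennreal (cmod (f y)) \<partial>N) < top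
     then Complex (LINT y|N. Re (f y)) (LINT y|N. Im (f y)) else 0)"
proof (cases "integrable N f")
  case True
  then show ?thesis
    by (auto simp: integrable_iff_bounded complex_eq_iff)
next
  case False
  then show ?thesis
    by (auto simp: integrable_iff_bounded not_integrable_integral_eq)
qed

section \<open>Radon measures and directed families\<close>

locale radon_measure =
  fixes M :: "'a::t2_space measure"
  assumes sets_eq_borel: "sets M = sets borel"
    and emeasure_compact: "\<And>K. compact K \<Longrightarrow> emeasure M K < top"
    and outer_regular: "\<And>A. A \<in> sets borel \<Longrightarrow>
      emeasure M A = (INF V\<in>{V. open V \<and> A \<subseteq> V}. emeasure M V)"
    and inner_regular: "\<And>V. open V \<Longrightarrow>
      emeasure M V = (SUP K\<in>{K. compact K \<and> K \<subseteq> V}. emeasure M K)"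
    and sigma_compact: "\<exists>K :: nat \<Rightarrow> 'a set. (\<forall>n. compact (K n)) \<and> (\<Union>n. K n) = UNIV"
begin

abbreviation borel_prod :: "('a \<times> 'a) measure" where
  "borel_prod \<equiv> borel"

lemma space_eq_UNIV [simp]: "space M = UNIV"
  using sets_eq_imp_space_eq[OF sets_eq_borel] by simp

lemma measurable_M_eq: "measurable M N = measurable borel N"
  by (rule measurable_cong_sets[OF sets_eq_borel refl])

text \<open>A compact subset of the union is covered by finitely many members, hence by a single
  one; inner regularity of the open union does the rest.\<close>

lemma emeasure_Union_directed:
  assumes opn: "\<And>V. V \<in> \<V> \<Longrightarrow> open V" and "\<V> \<noteq> {}"
    and dir: "\<And>V W. V \<in> \<V> \<Longrightarrow> W \<in> \<V> \<Longrightarrow> \<exists>X\<in>\<V>. V \<union> W \<subseteq> X"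
  shows "emeasure M (\<Union>\<V>) = (SUP V\<in>\<V>. emeasure M V)"
proof (rule antisym)
  have op: "open (\<Union>\<V>)" using opn by blast
  have fin: "\<exists>X\<in>\<V>. \<Union>\<F> \<subseteq> X" if "finite \<F>" "\<F> \<subseteq> \<V>" for \<F>
    using that
  proof (induction \<F> rule: finite_induct)
    case (insert V \<F>)
    then obtain X where X: "X \<in> \<V>" "\<Union>\<F> \<subseteq> X" by auto
    moreover have "V \<in> \<V>" using insert.prems by simp
    ultimately obtain Y where "Y \<in> \<V>" "V \<union> X \<subseteq> Y"
      using dir by metis
    with X show ?case by (intro bexI[of _ Y]) auto
  qed (use \<open>\<V> \<noteq> {}\<close> in auto)
  show "emeasure M (\<Union>\<V>) \<le> (SUP V\<in>\<V>. emeasure M V)"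
    unfolding inner_regular[OF op]
  proof (rule SUP_least, clarify)
    fix K assume K: "compact K" "K \<subseteq> \<Union>\<V>"
    obtain \<F> where "\<F> \<subseteq> \<V>" "finite \<F>" "K \<subseteq> \<Union>\<F>"
      by (rule compactE[OF K opn])
    with fin[of \<F>] obtain X where "X \<in> \<V>" "K \<subseteq> X" by auto
    then show "emeasure M K \<le> (SUP V\<in>\<V>. emeasure M V)"
      using opn[of X] by (intro SUP_upper2[of X] emeasure_mono) (auto simp: sets_eq_borel)
  qed
  show "(SUP V\<in>\<V>. emeasure M V) \<le> emeasure M (\<Union>\<V>)"
    using op by (intro SUP_least emeasure_mono) (auto simp: sets_eq_borel)
qed

text \<open>Monotone convergence for directed families of any cardinality. Slicing a function into
  its superlevel sets, which are open, reduces it to \<open>emeasure_Union_directed\<close>.\<close>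

lemma nn_integral_SUP_directed:
  fixes F :: "('a \<Rightarrow> ennreal) set"
  assumes lsc: "\<And>f c. f \<in> F \<Longrightarrow> open {x. c < f x}" and ne: "F \<noteq> {}"
    and dir: "\<And>f g. f \<in> F \<Longrightarrow> g \<in> F \<Longrightarrow> \<exists>h\<in>F. \<forall>x. f x \<le> h x \<and> g x \<le> h x"
  shows "(\<integral>\<^sup>+x. (SUP f\<in>F. f x) \<partial>M) = (SUP f\<in>F. \<integral>\<^sup>+x. f x \<partial>M)"
proof (rule antisym)
  define g where "g x = (SUP f\<in>F. f x)" for x
  have lev: "{x. c < g x} = (\<Union>f\<in>F. {x. c < f x})" for c
    by (auto simp: g_def less_SUP_iff)
  have [measurable]: "{x. c < f x} \<in> sets M" if "f \<in> F" for f c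
    using lsc[OF that] by (auto simp: sets_eq_borel)
  have [measurable]: "{x. c < g x} \<in> sets M" for c
    using lsc unfolding lev sets_eq_borel by (intro borel_open open_UN) auto
  \<comment> \<open>A layer sum with step \<open>1 / (n+1)\<close> up to height
    \<open>n + 1\<close>: it lies below \<open>f\<close>, and misses it by at most one step where
    \<open>f\<close> does not exceed that height.\<close>
  define s where "s f n x =
    (\<Sum>k\<in>{1..(n+1)^2}. ennreal (1 / (n+1)) * indicator {x. ennreal (k / (n+1)) < f x} x)"
    for f :: "'a \<Rightarrow> ennreal" and n :: nat and x
  have s_le: "s f n x \<le> f x" for f n x
  proof (cases "f x")
    case (real t)
    have "s f n x = (\<Sum>k\<in>{k\<in>{1..(n+1)^2}. ennreal (k / (n+1)) < f x}. ennreal (1 / (n+1)))"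
      unfolding s_def sum.inter_filter[OF finite_atLeastAtMost] by (intro sum.cong) auto
    also have "\<dots> \<le> (\<Sum>k\<in>{1..nat \<lfloor>t * (n+1)\<rfloor>}. ennreal (1 / (n+1)))"
      using real by (intro sum_mono2) (auto simp: ennreal_less_iff field_simps le_nat_iff le_floor_iff)
    also have "\<dots> = ennreal (nat \<lfloor>t * (n+1)\<rfloor> * (1 / (n+1)))"
      by (simp add: ennreal_mult[symmetric] ennreal_of_nat_eq_real_of_nat)
    also have "\<dots> \<le> ennreal t"
    proof (rule ennreal_leI)
      have "real (nat \<lfloor>t * (n+1)\<rfloor>) \<le> t * (n+1)"
        using real by (intro of_nat_floor) auto
      then show "real (nat \<lfloor>t * (n+1)\<rfloor>) * (1 / (n+1)) \<le> t"
        by (simp add: field_simps)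
    qed
    finally show ?thesis using real by simp
  qed simp
  have s_ge: "ennreal (a - 1 / real (n+1)) \<le> s f n x"
    if "ennreal a < f x" "0 \<le> a" "a \<le> n+1" for f n x a
  proof -
    define K where "K = nat \<lfloor>a * (n+1)\<rfloor>"
    have K: "real K \<le> a * (n+1)"
      using that unfolding K_def by (intro of_nat_floor) auto
    have K': "a * (n+1) < real K + 1"
      unfolding K_def by linarith
    have "a * real (n+1) \<le> real (n+1) * real (n+1)"
      using that by (intro mult_right_mono) auto
    with K have "real K \<le> real (n+1) * real (n+1)"
      by (rule order_trans)
    then have "real K \<le> real ((n+1)^2)"
      by (simp only: of_nat_power power2_eq_square of_nat_mult)
    then have K2: "K \<le> (n+1)^2"
      using of_nat_le_iff by blast
    have "a \<le> (real K + 1) / real (n+1)"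
      using K' by (subst pos_le_divide_eq) auto
    then have "a - 1 / (n+1) \<le> K * (1 / (n+1))"
      by (simp add: add_divide_distrib)
    then have "ennreal (a - 1 / (n+1)) \<le> ennreal (K * (1 / (n+1)))"
      by (rule ennreal_leI)
    also have "\<dots> = (\<Sum>k\<in>{1..K}. ennreal (1 / (n+1)) * indicator {x. ennreal (k / (n+1)) < f x} x)"
    proof -
      have "ennreal (k / (n+1)) < f x" if "k \<in> {1..K}" for k
      proof -
        have "real k / (n+1) \<le> a"
          using that K by (simp add: field_simps)
        then show ?thesis
          by (rule le_less_trans[OF ennreal_leI \<open>ennreal a < f x\<close>])
      qed
      then show ?thesis
        by (simp add: ennreal_mult[symmetric] ennreal_of_nat_eq_real_of_nat)
    qed
    also have "\<dots> \<le> s f n x"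
      unfolding s_def using K2 by (intro sum_mono2) auto
    finally show ?thesis .
  qed
  have liminf: "g x \<le> liminf (\<lambda>n. s g n x)" for x
  proof (rule dense_le)
    fix y assume "y < g x"
    then obtain a where a: "y = ennreal a" "0 \<le> a"
      by (cases y) auto
    obtain n0 :: nat where n0: "a \<le> n0" using real_arch_simple by blast
    have "ennreal a = liminf (\<lambda>n. ennreal (a - 1 / real (Suc n)))"
    proof (rule lim_imp_Liminf[symmetric])
      have "(\<lambda>n. ennreal (a - 1 / real (Suc n))) \<longlonglongrightarrow> ennreal (a - 0)"
        by (intro tendsto_ennrealI tendsto_diff tendsto_const LIMSEQ_Suc lim_1_over_n)
      then show "(\<lambda>n. ennreal (a - 1 / real (Suc n))) \<longlonglongrightarrow> ennreal a" by simp
    qed simp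
    also have "\<dots> \<le> liminf (\<lambda>n. s g n x)"
      using s_ge[of a g x] \<open>y < g x\<close> a n0
      by (intro Liminf_mono eventually_sequentiallyI[of n0]) (auto simp: add.commute)
    finally show "y \<le> liminf (\<lambda>n. s g n x)" using a by simp
  qed
  have "(\<integral>\<^sup>+x. g x \<partial>M) \<le> (\<integral>\<^sup>+x. liminf (\<lambda>n. s g n x) \<partial>M)"
    by (intro nn_integral_mono liminf)
  \<comment> \<open>The grids for successive \<open>n\<close> are not nested, so Fatou's lemma takes
    the place of monotone convergence.\<close>
  also have "\<dots> \<le> liminf (\<lambda>n. \<integral>\<^sup>+x. s g n x \<partial>M)"
    unfolding s_def by (intro nn_integral_liminf) measurable
  also have "\<dots> \<le> (SUP f\<in>F. \<integral>\<^sup>+x. f x \<partial>M)"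
  \<comment> \<open>For fixed \<open>n\<close> there are finitely many layers, and each commutes
    with the directed supremum because its sets are open.\<close>
  proof (rule order_trans[OF Liminf_mono[OF always_eventually]], rule allI)
    fix n :: nat
    have int_s: "(\<integral>\<^sup>+x. s f n x \<partial>M)
      = (\<Sum>k\<in>{1..(n+1)^2}. ennreal (1 / (n+1)) * emeasure M {x. ennreal (k / (n+1)) < f x})"
      if [measurable]: "\<And>c. {x. c < f x} \<in> sets M" for f
      unfolding s_def by (subst nn_integral_sum) (auto simp: nn_integral_cmult)
    have "emeasure M {x. c < g x} = (SUP f\<in>F. emeasure M {x. c < f x})" for c
      unfolding lev
    proof (subst emeasure_Union_directed)
      fix V W assume "V \<in> (\<lambda>f. {x. c < f x}) ` F" "W \<in> (\<lambda>f. {x. c < f x}) ` F"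
      then obtain f1 f2 where f: "f1 \<in> F" "f2 \<in> F" "V = {x. c < f1 x}" "W = {x. c < f2 x}" by auto
      then obtain h where "h \<in> F" "\<And>x. f1 x \<le> h x \<and> f2 x \<le> h x" using dir by metis
      with f show "\<exists>X\<in>(\<lambda>f. {x. c < f x}) ` F. V \<union> W \<subseteq> X"
        by (intro bexI[of _ "{x. c < h x}"]) (auto intro: less_le_trans)
    qed (use lsc ne in \<open>auto simp: image_image\<close>)
    then have "(\<integral>\<^sup>+x. s g n x \<partial>M) =
        (\<Sum>k\<in>{1..(n+1)^2}. SUP f\<in>F. ennreal (1 / (n+1)) * emeasure M {x. ennreal (k / (n+1)) < f x})"
      by (simp add: int_s SUP_mult_left_ennreal)
    also have "\<dots> = (SUP f\<in>F. \<integral>\<^sup>+x. s f n x \<partial>M)"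
    proof (subst ennreal_SUP_sum_directed)
      fix f1 f2 assume f: "f1 \<in> F" "f2 \<in> F"
      then obtain h where h: "h \<in> F" "\<And>x. f1 x \<le> h x \<and> f2 x \<le> h x" using dir by metis
      then have "{x. c < f1 x} \<subseteq> {x. c < h x}" "{x. c < f2 x} \<subseteq> {x. c < h x}" for c
        by (auto intro: less_le_trans)
      then show "\<exists>h\<in>F. \<forall>k\<in>{1..(n + 1)\<^sup>2}.
          ennreal (1 / real (n + 1)) * emeasure M {x. ennreal (real k / real (n + 1)) < f1 x}
          \<le> ennreal (1 / real (n + 1)) * emeasure M {x. ennreal (real k / real (n + 1)) < h x} \<and>
          ennreal (1 / real (n + 1)) * emeasure M {x. ennreal (real k / real (n + 1)) < f2 x}
          \<le> ennreal (1 / real (n + 1)) * emeasure M {x. ennreal (real k / real (n + 1)) < h x}"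
        using h by (intro bexI[of _ h] ballI conjI mult_left_mono emeasure_mono) auto
    qed (use ne int_s in auto)
    also have "\<dots> \<le> (SUP f\<in>F. \<integral>\<^sup>+x. f x \<partial>M)"
      by (intro SUP_mono) (auto intro!: nn_integral_mono s_le)
    finally show "(\<integral>\<^sup>+x. s g n x \<partial>M) \<le> (SUP f\<in>F. \<integral>\<^sup>+x. f x \<partial>M)" .
  qed (simp add: Liminf_const)
  finally show "(\<integral>\<^sup>+x. (SUP f\<in>F. f x) \<partial>M) \<le> (SUP f\<in>F. \<integral>\<^sup>+x. f x \<partial>M)"
    by (simp add: g_def)
qed (auto intro!: SUP_least nn_integral_mono SUP_upper)

text \<open>Outer regularity puts each of countably many compact sets into an open set of finite
  measure; finite unions make the sequence increasing.\<close>

lemma exhaustion: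
  obtains V :: "nat \<Rightarrow> 'a set" where "\<And>n. open (V n)" "incseq V" "(\<Union>n. V n) = UNIV"
    "\<And>n. emeasure M (V n) < top"
proof -
  obtain K :: "nat \<Rightarrow> 'a set" where K: "\<And>n. compact (K n)" "(\<Union>n. K n) = UNIV"
    using sigma_compact by auto
  have "\<exists>V. open V \<and> K n \<subseteq> V \<and> emeasure M V < top" for n
  proof -
    have "(INF V\<in>{V. open V \<and> K n \<subseteq> V}. emeasure M V) < top"
      using emeasure_compact[OF K(1)] K(1)[of n] by (subst outer_regular[symmetric]) (auto simp: compact_imp_closed)
    then show ?thesis by (auto simp: INF_less_iff)
  qed
  then obtain V where V: "\<And>n. open (V n)" "\<And>n. K n \<subseteq> V n" "\<And>n. emeasure M (V n) < top"
    by metis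
  show ?thesis
  proof (rule that[of "\<lambda>n. \<Union>k\<le>n. V k"])
    show "emeasure M (\<Union>k\<le>n. V k) < top" for n
    proof -
      have "emeasure M (\<Union>k\<le>n. V k) \<le> (\<Sum>k\<le>n. emeasure M (V k))"
        using V(1) by (intro emeasure_subadditive_finite) (auto simp: sets_eq_borel)
      also have "\<dots> < top"
        using V(3) by (simp add: less_top)
      finally show ?thesis .
    qed
    show "incseq (\<lambda>n. \<Union>k\<le>n. V k)"
      by (rule incseq_SucI) (auto simp: atMost_Suc)
    have "y \<in> (\<Union>n. \<Union>k\<le>n. V k)" for y
    proof -
      obtain n where "y \<in> K n" using K(2) by (metis UNIV_I UN_E)
      then show ?thesis using V(2)[of n] by auto
    qed
    then show "(\<Union>n. \<Union>k\<le>n. V k) = UNIV" by auto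
  qed (use V in auto)
qed

lemma sigma_finite_M: "sigma_finite_measure M"
proof -
  obtain V where V: "\<And>n. open (V n)" "incseq V" "(\<Union>n. V n) = UNIV" "\<And>n. emeasure M (V n) < top"
    by (rule exhaustion) (rule that)
  show ?thesis
    by (standard, rule exI[of _ "range V"]) (use V in \<open>auto simp: sets_eq_borel less_top\<close>)
qed

lemma Pair_measurable [measurable]:
  "Pair x \<in> borel \<rightarrow>\<^sub>M borel_prod"
  "(\<lambda>x. (x, y)) \<in> borel \<rightarrow>\<^sub>M borel_prod"
  by (intro borel_measurable_continuous_onI continuous_intros)+

lemma sections_in_sets:
  assumes "A \<in> sets borel_prod"
  shows "Pair x -` A \<in> sets M" "(\<lambda>x. (x, y)) -` A \<in> sets M"
  using measurable_sets[OF Pair_measurable(1) assms] measurable_sets[OF Pair_measurable(2) assms]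
  by (simp_all add: sets_eq_borel)

text \<open>
  The group need not be second countable, so the Borel sets of the product topology may exceed the
  product sigma algebra. For open sets Fubini's theorem still follows from the case of finite unions
  of open rectangles, because Radon measures commute with directed suprema of lower semicontinuous
  functions.
\<close>

definition open_figures :: "('a \<times> 'a) set \<Rightarrow> ('a \<times> 'a) set set" where
  "open_figures W = {R. R \<subseteq> W \<and>
     (\<exists>S. finite S \<and> (\<forall>(A, B)\<in>S. open A \<and> open B) \<and> R = (\<Union>(A, B)\<in>S. A \<times> B))}"

lemma open_figures_Un:
  assumes "R1 \<in> open_figures W" "R2 \<in> open_figures W"
  shows "R1 \<union> R2 \<in> open_figures W"
proof -
  obtain S1 S2 where "finite S1" "\<forall>(A, B)\<in>S1. open A \<and> open B" "R1 = (\<Union>(A, B)\<in>S1. A \<times> B)"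
    and "finite S2" "\<forall>(A, B)\<in>S2. open A \<and> open B" "R2 = (\<Union>(A, B)\<in>S2. A \<times> B)"
    using assms unfolding open_figures_def by blast
  then show ?thesis
    using assms unfolding open_figures_def by (auto intro!: exI[of _ "S1 \<union> S2"])
qed

lemma open_figures_empty: "{} \<in> open_figures W"
  unfolding open_figures_def by (auto intro!: exI[of _ "{}"])

text \<open>If \<open>y\<close> lies in every first factor that contains \<open>x\<close>, the
  section at \<open>y\<close> contains the section at \<open>x\<close>. There are finitely many
  factors, so such \<open>y\<close> fill a neighbourhood of \<open>x\<close>.\<close>

lemma open_figures_lsc:
  assumes "R \<in> open_figures W"
  shows "open {x. c < emeasure M (Pair x -` R)}"
proof -
  obtain S where S: "finite S" "\<forall>(A, B)\<in>S. open A \<and> open B" "R = (\<Union>(A, B)\<in>S. A \<times> B)"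
    using assms unfolding open_figures_def by blast
  have sec: "Pair x -` R = (\<Union>(A, B)\<in>{(A, B)\<in>S. x \<in> A}. B)" for x
    unfolding S(3) by auto
  show ?thesis
  proof (subst open_subopen, rule ballI)
    fix x assume x: "x \<in> {x. c < emeasure M (Pair x -` R)}"
    define T where "T = (\<Inter>(A, B)\<in>{(A, B)\<in>S. x \<in> A}. A)"
    have "open T" "x \<in> T"
      unfolding T_def using S by (auto intro!: open_INT finite_subset[OF _ S(1)])
    moreover have "T \<subseteq> {x. c < emeasure M (Pair x -` R)}"
    proof clarify
      fix y assume "y \<in> T"
      then have "Pair x -` R \<subseteq> Pair y -` R"
        unfolding sec T_def by auto
      moreover have "open (Pair y -` R)"
        unfolding sec using S by auto
      ultimately have "emeasure M (Pair x -` R) \<le> emeasure M (Pair y -` R)"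
        by (intro emeasure_mono) (auto simp: sets_eq_borel)
      then show "c < emeasure M (Pair y -` R)"
        using x by (auto intro: less_le_trans)
    qed
    ultimately show "\<exists>T. open T \<and> x \<in> T \<and> T \<subseteq> {x. c < emeasure M (Pair x -` R)}"
      by blast
  qed
qed

text \<open>The figures inside \<open>W\<close> form a directed family of open sets with union
  \<open>W\<close>, and so do their sections.\<close>

lemma emeasure_section_open:
  fixes W :: "('a \<times> 'a) set"
  assumes W: "open W"
  shows "emeasure M (Pair x -` W) = (SUP R\<in>open_figures W. emeasure M (Pair x -` R))"
proof -
  have "W \<subseteq> \<Union>(open_figures W)"
  proof
    fix z assume "z \<in> W"
    with W obtain A B where "open A" "open B" "z \<in> A \<times> B" "A \<times> B \<subseteq> W"
      by (rule open_prod_elim)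
    moreover from this have "A \<times> B \<in> open_figures W"
      unfolding open_figures_def by (auto intro!: exI[of _ "{(A, B)}"])
    ultimately show "z \<in> \<Union>(open_figures W)" by blast
  qed
  moreover have "\<Union>(open_figures W) \<subseteq> W"
    unfolding open_figures_def by auto
  ultimately have "\<Union>(open_figures W) = W"
    by (rule subset_antisym[rotated])
  then have "Pair x -` W = \<Union>((\<lambda>R. Pair x -` R) ` open_figures W)"
    by (metis vimage_Union)
  then have "emeasure M (Pair x -` W) = emeasure M (\<Union>((\<lambda>R. Pair x -` R) ` open_figures W))"
    by simp
  also have "\<dots> = (SUP V\<in>(\<lambda>R. Pair x -` R) ` open_figures W. emeasure M V)"
  proof (rule emeasure_Union_directed)
    fix V assume "V \<in> (\<lambda>R. Pair x -` R) ` open_figures W"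
    then obtain R where R: "V = Pair x -` R" "R \<in> open_figures W" by auto
    then have "open R" unfolding open_figures_def by (auto intro!: open_UN open_Times)
    then show "open V" unfolding R by (intro open_vimage continuous_intros)
  next
    fix V V' assume "V \<in> (\<lambda>R. Pair x -` R) ` open_figures W" "V' \<in> (\<lambda>R. Pair x -` R) ` open_figures W"
    then obtain R R' where "R \<in> open_figures W" "R' \<in> open_figures W" "V = Pair x -` R" "V' = Pair x -` R'"
      by auto
    then show "\<exists>X\<in>(\<lambda>R. Pair x -` R) ` open_figures W. V \<union> V' \<subseteq> X"
      using open_figures_Un by (intro bexI[OF _ imageI[where x = "R \<union> R'"]]) auto
  qed (use open_figures_empty in auto)
  finally show ?thesis by (simp add: image_image)
qed

lemma lsc_section_open:
  fixes W :: "('a \<times> 'a) set"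
  assumes W: "open W"
  shows "open {x. c < emeasure M (Pair x -` W)}"
proof -
  have "{x. c < emeasure M (Pair x -` W)} = (\<Union>R\<in>open_figures W. {x. c < emeasure M (Pair x -` R)})"
    by (auto simp: emeasure_section_open[OF W] less_SUP_iff)
  then show ?thesis using open_figures_lsc by auto
qed

lemma measurable_section_open:
  fixes W :: "('a \<times> 'a) set"
  shows "open W \<Longrightarrow> (\<lambda>x. emeasure M (Pair x -` W)) \<in> borel_measurable M"
  using lsc_section_open[of W] by (intro borel_measurableI_greater) (simp add: sets_eq_borel)

text \<open>Figures belong to the product sigma algebra, where the usual theorem applies. The
  passage to \<open>W\<close> uses lower semicontinuity on the left and mere monotonicity on the
  right; the reverse inequality is this one for the swapped set.\<close>

lemma Fubini_open_le:
  fixes W :: "('a \<times> 'a) set"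
  assumes W: "open W"
  shows "(\<integral>\<^sup>+x. emeasure M (Pair x -` W) \<partial>M) \<le> (\<integral>\<^sup>+y. emeasure M ((\<lambda>x. (x, y)) -` W) \<partial>M)"
proof -
  interpret pair_sigma_finite M M
    by (intro pair_sigma_finite.intro sigma_finite_M)
  have "(\<integral>\<^sup>+x. emeasure M (Pair x -` W) \<partial>M)
      = (\<integral>\<^sup>+x. (SUP f\<in>(\<lambda>R x. emeasure M (Pair x -` R)) ` open_figures W. f x) \<partial>M)"
    by (simp add: emeasure_section_open[OF W] image_image)
  also have "\<dots> = (SUP f\<in>(\<lambda>R x. emeasure M (Pair x -` R)) ` open_figures W. \<integral>\<^sup>+x. f x \<partial>M)"
  proof (rule nn_integral_SUP_directed)
    fix f g assume "f \<in> (\<lambda>R x. emeasure M (Pair x -` R)) ` open_figures W"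
      "g \<in> (\<lambda>R x. emeasure M (Pair x -` R)) ` open_figures W"
    then obtain R1 R2 where R: "R1 \<in> open_figures W" "R2 \<in> open_figures W"
      "f = (\<lambda>x. emeasure M (Pair x -` R1))" "g = (\<lambda>x. emeasure M (Pair x -` R2))"
      by auto
    have "open (R1 \<union> R2)"
      using R(1,2) unfolding open_figures_def by (auto intro!: open_UN open_Times open_Un)
    then have "Pair x -` (R1 \<union> R2) \<in> sets M" for x
      by (intro sections_in_sets) auto
    then show "\<exists>h\<in>(\<lambda>R x. emeasure M (Pair x -` R)) ` open_figures W. \<forall>x. f x \<le> h x \<and> g x \<le> h x"
      using R open_figures_Un[OF R(1,2)]
      by (intro bexI[OF _ imageI[where x = "R1 \<union> R2"]]) (auto intro!: emeasure_mono)
  qed (use open_figures_lsc open_figures_empty[of W] in auto)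
  also have "\<dots> \<le> (\<integral>\<^sup>+y. emeasure M ((\<lambda>x. (x, y)) -` W) \<partial>M)"
  proof (rule SUP_least, clarify)
    fix R assume R: "R \<in> open_figures W"
    then obtain S where S: "finite S" "\<forall>(A, B)\<in>S. open A \<and> open B" "R = (\<Union>(A, B)\<in>S. A \<times> B)"
      unfolding open_figures_def by blast
    then have RM: "R \<in> sets (M \<Otimes>\<^sub>M M)"
      by (auto simp: sets_eq_borel intro!: sets.finite_UN pair_measureI)
    have "(\<integral>\<^sup>+x. emeasure M (Pair x -` R) \<partial>M) = (\<integral>\<^sup>+y. emeasure M ((\<lambda>x. (x, y)) -` R) \<partial>M)"
      by (rule trans[OF sigma_finite_measure.emeasure_pair_measure_alt[OF sigma_finite_M RM, symmetric] emeasure_pair_measure_alt2[OF RM]])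
    also have "\<dots> \<le> (\<integral>\<^sup>+y. emeasure M ((\<lambda>x. (x, y)) -` W) \<partial>M)"
      using W R unfolding open_figures_def
      by (intro nn_integral_mono emeasure_mono sections_in_sets) auto
    finally show "(\<integral>\<^sup>+x. emeasure M (Pair x -` R) \<partial>M) \<le> (\<integral>\<^sup>+y. emeasure M ((\<lambda>x. (x, y)) -` W) \<partial>M)" .
  qed
  finally show ?thesis .
qed

lemma Fubini_open:
  fixes W :: "('a \<times> 'a) set"
  assumes W: "open W"
  shows "(\<integral>\<^sup>+x. emeasure M (Pair x -` W) \<partial>M) = (\<integral>\<^sup>+y. emeasure M ((\<lambda>x. (x, y)) -` W) \<partial>M)"
proof -
  have W': "open (prod.swap -` W)"
    by (intro open_vimage W) (auto simp: prod.swap_def intro!: continuous_intros)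
  have eq: "Pair x -` (prod.swap -` W) = (\<lambda>y. (y, x)) -` W"
    "(\<lambda>y. (y, x)) -` (prod.swap -` W) = Pair x -` W" for x
    by auto
  show ?thesis
    using Fubini_open_le[OF W] Fubini_open_le[OF W'] by (simp add: eq)
qed

section \<open>From open sets to all Borel sets of the product\<close>

lemma measurable_section:
  assumes A: "A \<in> sets borel_prod"
  shows "(\<lambda>x. emeasure M (Pair x -` A)) \<in> borel_measurable M"
proof -
  obtain V where V: "\<And>n. open (V n)" "incseq V" "(\<Union>n. V n) = UNIV" "\<And>n. emeasure M (V n) < top"
    by (rule exhaustion) (rule that)
  have VM: "V n \<in> sets M" for n
    using V(1) by (simp add: sets_eq_borel)
  have borel: "sets borel_prod = sigma_sets UNIV (Collect open)"
    by (simp add: borel_def)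
  \<comment> \<open>Dynkin induction from the open sets. Cutting by \<open>V n\<close> makes the
    measures finite, so that complements can be computed by subtraction.\<close>
  have [measurable]: "(\<lambda>x. emeasure M (Pair x -` A \<inter> V n)) \<in> borel_measurable M" for n
  proof -
    have "Int_stable (Collect (open :: ('a \<times> 'a) set \<Rightarrow> bool))"
      by (auto simp: Int_stable_def)
    moreover have "Collect (open :: ('a \<times> 'a) set \<Rightarrow> bool) \<subseteq> Pow UNIV"
      by simp
    moreover have "A \<in> sigma_sets UNIV (Collect open)"
      using A by (simp only: borel)
    ultimately show ?thesis
    proof (induction rule: sigma_sets_induct_disjoint)
      case (basic W)
      then have "open (W \<inter> UNIV \<times> V n)"
        using V by (auto intro!: open_Times)
      moreover have "Pair x -` W \<inter> V n = Pair x -` (W \<inter> UNIV \<times> V n)" for x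
        by auto
      ultimately show ?case
        by (simp only: measurable_section_open)
    next
      case (compl A)
      then have A: "A \<in> sets borel_prod" by (simp add: borel)
      have "emeasure M (Pair x -` (UNIV - A) \<inter> V n) = emeasure M (V n) - emeasure M (Pair x -` A \<inter> V n)" for x
      proof -
        have "Pair x -` (UNIV - A) \<inter> V n = V n - Pair x -` A \<inter> V n" by auto
        moreover have "emeasure M (Pair x -` A \<inter> V n) \<noteq> \<infinity>"
          using V(4)[of n] VM emeasure_mono[of "Pair x -` A \<inter> V n" "V n" M] by (auto simp: top_unique)
        ultimately show ?thesis
          using sections_in_sets(1)[OF A, of x] VM by (simp add: emeasure_Diff)
      qed
      then show ?case using compl.IH by simp
    next
      case (union A)
      then have A: "A i \<in> sets borel_prod" for i by (auto simp: borel)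
      have "emeasure M (Pair x -` (\<Union>i. A i) \<inter> V n) = (\<Sum>i. emeasure M (Pair x -` A i \<inter> V n))" for x
      proof (subst suminf_emeasure)
        show "range (\<lambda>i. Pair x -` A i \<inter> V n) \<subseteq> sets M"
          using sections_in_sets(1)[OF A, of x] VM by blast
        show "disjoint_family (\<lambda>i. Pair x -` A i \<inter> V n)"
          using union.hyps(1) by (auto simp: disjoint_family_on_def)
      qed (auto intro!: arg_cong[where f = "emeasure M"])
      then show ?case using union.IH by simp
    qed simp
  qed
  have "emeasure M (Pair x -` A) = (SUP n. emeasure M (Pair x -` A \<inter> V n))" for x
  proof (subst SUP_emeasure_incseq)
    show "range (\<lambda>n. Pair x -` A \<inter> V n) \<subseteq> sets M"
      using sections_in_sets(1)[OF A, of x] VM by blast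
    show "incseq (\<lambda>n. Pair x -` A \<inter> V n)"
      using V(2) by (auto simp: incseq_def)
    show "emeasure M (Pair x -` A) = emeasure M (\<Union>n. Pair x -` A \<inter> V n)"
      using V(3) by (simp only: Int_UN_distrib[symmetric] Int_UNIV_right)
  qed
  then show ?thesis by simp
qed

text \<open>An extension of the product measure from the product sigma algebra to all Borel sets of
  the product topology, defined through one order of integration.\<close>

definition section_measure :: "('a \<times> 'a) measure" where
  "section_measure = measure_of UNIV (sets borel) (\<lambda>A. \<integral>\<^sup>+x. emeasure M (Pair x -` A) \<partial>M)"

lemma sets_section_measure [simp, measurable_cong]: "sets section_measure = sets borel"
  using sets.sigma_sets_eq[of "borel :: ('a \<times> 'a) measure"] by (simp add: section_measure_def)

lemma emeasure_section_measure:
  assumes A: "A \<in> sets borel"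
  shows "emeasure section_measure A = (\<integral>\<^sup>+x. emeasure M (Pair x -` A) \<partial>M)"
proof (rule emeasure_measure_of[OF section_measure_def])
  show "countably_additive (sets section_measure) (\<lambda>A. \<integral>\<^sup>+x. emeasure M (Pair x -` A) \<partial>M)"
  proof (rule countably_additiveI)
    fix A :: "nat \<Rightarrow> ('a \<times> 'a) set"
    assume A: "range A \<subseteq> sets section_measure" "disjoint_family A"
    then have Ai: "A i \<in> sets borel" for i by auto
    have "emeasure M (Pair x -` (\<Union>i. A i)) = (\<Sum>i. emeasure M (Pair x -` A i))" for x
    proof (subst suminf_emeasure)
      show "range (\<lambda>i. Pair x -` A i) \<subseteq> sets M"
        using sections_in_sets(1)[OF Ai, of x] by blast
      show "disjoint_family (\<lambda>i. Pair x -` A i)"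
        using A(2) by (auto simp: disjoint_family_on_def)
    qed (auto intro!: arg_cong[where f = "emeasure M"])
    then show "(\<Sum>i. \<integral>\<^sup>+x. emeasure M (Pair x -` A i) \<partial>M) = (\<integral>\<^sup>+x. emeasure M (Pair x -` (\<Union>i. A i)) \<partial>M)"
      by (simp add: nn_integral_suminf measurable_section[OF Ai])
  qed
qed (use A in \<open>auto simp: positive_def\<close>)

lemma swap_Borel [measurable]: "prod.swap \<in> borel \<rightarrow>\<^sub>M borel_prod"
  by (intro borel_measurable_continuous_onI) (auto simp: prod.swap_def intro!: continuous_intros)

text \<open>Tonelli's theorem for Borel sets. The two measures agree on open sets by
  \<open>Fubini_open\<close>; these are stable under intersection and generate the Borel sets, and
  the squares \<open>V n \<times> V n\<close> exhaust the product with finite measure.\<close>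

lemma section_measure_swap: "distr section_measure borel prod.swap = section_measure"
proof -
  obtain V where V: "\<And>n. open (V n)" "incseq V" "(\<Union>n. V n) = UNIV" "\<And>n. emeasure M (V n) < top"
    by (rule exhaustion) (rule that)
  have opn: "emeasure section_measure W = emeasure (distr section_measure borel prod.swap) W" if W: "open W" for W
  proof -
    have "open (prod.swap -` W)"
      by (intro open_vimage W) (auto simp: prod.swap_def intro!: continuous_intros)
    moreover have "Pair x -` (prod.swap -` W) = (\<lambda>y. (y, x)) -` W" for x
      by auto
    moreover have "space section_measure = UNIV"
      using sets_eq_imp_space_eq[OF sets_section_measure] by simp
    ultimately show ?thesis
      using W by (simp add: emeasure_distr emeasure_section_measure Fubini_open)
  qed
  have "section_measure = distr section_measure borel prod.swap"
  proof (rule measure_eqI_generator_eq[where E = "Collect open" and \<Omega> = UNIV and A = "\<lambda>n. V n \<times> V n"])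
    show "Int_stable (Collect (open :: ('a \<times> 'a) set \<Rightarrow> bool))"
      by (auto simp: Int_stable_def)
    show "(\<Union>n. V n \<times> V n) = UNIV"
    proof -
      have "z \<in> (\<Union>n. V n \<times> V n)" for z
      proof -
        obtain i j where "fst z \<in> V i" "snd z \<in> V j"
          using V(3) by (metis UNIV_I UN_E)
        then have "z \<in> V (max i j) \<times> V (max i j)"
          using incseqD[OF V(2), of i "max i j"] incseqD[OF V(2), of j "max i j"]
          by (auto simp: mem_Times_iff)
        then show ?thesis by blast
      qed
      then show ?thesis by blast
    qed
    show "emeasure section_measure (V n \<times> V n) \<noteq> \<infinity>" for n
    proof -
      have "emeasure section_measure (V n \<times> V n) = (\<integral>\<^sup>+x. emeasure M (V n) * indicator (V n) x \<partial>M)"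
        using V(1) by (subst emeasure_section_measure)
          (auto intro!: nn_integral_cong borel_open open_Times split: split_indicator)
      also have "\<dots> = emeasure M (V n) * emeasure M (V n)"
        using V(1) by (simp add: nn_integral_cmult_indicator sets_eq_borel)
      finally show ?thesis
        using V(4)[of n] by (simp add: ennreal_mult_eq_top_iff less_top)
    qed
  qed (use V(1) opn in \<open>auto simp: borel_def intro!: open_Times\<close>)
  then show ?thesis by (rule sym)
qed

lemma nn_integral_section_measure:
  assumes "f \<in> borel_measurable borel_prod"
  shows "(\<lambda>x. \<integral>\<^sup>+y. f (x, y) \<partial>M) \<in> borel_measurable M \<and>
    (\<integral>\<^sup>+z. f z \<partial>section_measure) = (\<integral>\<^sup>+x. \<integral>\<^sup>+y. f (x, y) \<partial>M \<partial>M)"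
  using assms
proof (induction rule: borel_measurable_induct)
  case (cong f g)
  then have "f = g" by auto
  with cong show ?case by simp
next
  case (set A)
  have "(\<integral>\<^sup>+y. indicator A (x, y) \<partial>M) = emeasure M (Pair x -` A)" for x
  proof -
    have "indicator A (x, y) = (indicator (Pair x -` A) y :: ennreal)" for y
      by (simp add: indicator_def)
    then show ?thesis using sections_in_sets(1)[OF set] by simp
  qed
  then show ?case
    using set by (simp add: measurable_section emeasure_section_measure)
next
  case (mult u c)
  then have [measurable]: "u \<in> borel_measurable borel" "(\<lambda>y. u (x, y)) \<in> borel_measurable M" for x
    by (auto simp: measurable_M_eq intro: measurable_compose[OF Pair_measurable(1)])
  show ?case using mult.IH by (auto simp: nn_integral_cmult)
next
  case (add u v)
  then have [measurable]: "u \<in> borel_measurable borel" "(\<lambda>y. u (x, y)) \<in> borel_measurable M"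
    "v \<in> borel_measurable borel" "(\<lambda>y. v (x, y)) \<in> borel_measurable M" for x
    by (auto simp: measurable_M_eq intro: measurable_compose[OF Pair_measurable(1)])
  show ?case using add.IH by (auto simp: nn_integral_add)
next
  case (seq U)
  have [measurable]: "U i \<in> borel_measurable borel" "(\<lambda>y. U i (x, y)) \<in> borel_measurable M"
    "(\<lambda>x. \<integral>\<^sup>+y. U i (x, y) \<partial>M) \<in> borel_measurable M" for i x
    using seq.hyps(1)[of i] seq.IH[of i]
    by (auto simp: measurable_M_eq intro: measurable_compose[OF Pair_measurable(1)])
  have mono: "U i z \<le> U j z" if "i \<le> j" for i j z
    using \<open>incseq U\<close> that by (simp add: incseqD le_funD)
  have sec: "(\<integral>\<^sup>+y. (SUP i. U i) (x, y) \<partial>M) = (SUP i. \<integral>\<^sup>+y. U i (x, y) \<partial>M)" for x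
    unfolding SUP_apply using mono by (intro nn_integral_monotone_convergence_SUP) (auto simp: incseq_def le_fun_def)
  have "(\<integral>\<^sup>+x. (SUP i. \<integral>\<^sup>+y. U i (x, y) \<partial>M) \<partial>M) = (SUP i. \<integral>\<^sup>+x. \<integral>\<^sup>+y. U i (x, y) \<partial>M \<partial>M)"
    using mono by (intro nn_integral_monotone_convergence_SUP) (auto simp: incseq_def le_fun_def intro!: nn_integral_mono)
  moreover have "(\<integral>\<^sup>+z. (SUP i. U i) z \<partial>section_measure) = (SUP i. \<integral>\<^sup>+z. U i z \<partial>section_measure)"
    unfolding SUP_apply using \<open>incseq U\<close> by (intro nn_integral_monotone_convergence_SUP) auto
  ultimately show ?case
    unfolding sec using seq.IH by auto
qed

lemma measurable_nn_integral_Borel: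
  assumes "(\<lambda>(x, y). f x y) \<in> borel_measurable borel_prod"
  shows "(\<lambda>x. \<integral>\<^sup>+y. f x y \<partial>M) \<in> borel_measurable M"
  using nn_integral_section_measure[OF assms] by simp

lemma Fubini_nn_integral:
  assumes f: "(\<lambda>(x, y). f x y) \<in> borel_measurable borel_prod"
  shows "(\<integral>\<^sup>+x. \<integral>\<^sup>+y. f x y \<partial>M \<partial>M) = (\<integral>\<^sup>+y. \<integral>\<^sup>+x. f x y \<partial>M \<partial>M)"
proof -
  let ?f = "\<lambda>z. case z of (x, y) \<Rightarrow> f x y"
  have "(\<integral>\<^sup>+x. \<integral>\<^sup>+y. f x y \<partial>M \<partial>M) = (\<integral>\<^sup>+z. ?f z \<partial>distr section_measure borel prod.swap)"
    using nn_integral_section_measure[OF f] by (simp add: section_measure_swap)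
  also have "\<dots> = (\<integral>\<^sup>+z. ?f (prod.swap z) \<partial>section_measure)"
    using f by (intro nn_integral_distr) auto
  also have "\<dots> = (\<integral>\<^sup>+y. \<integral>\<^sup>+x. f x y \<partial>M \<partial>M)"
    using nn_integral_section_measure[OF measurable_compose[OF swap_Borel f]] by simp
  finally show ?thesis .
qed

section \<open>Fubini's theorem for complex integrals\<close>

lemma measurable_integral_real_Borel:
  fixes f :: "'a \<Rightarrow> 'a \<Rightarrow> real"
  assumes f [measurable]: "(\<lambda>(x, y). f x y) \<in> borel_measurable borel_prod"
  shows "(\<lambda>x. LINT y|M. f x y) \<in> borel_measurable M"
proof -
  have [measurable]: "f x \<in> borel_measurable M" for x
    using measurable_compose[OF Pair_measurable(1) f, of x] by (simp add: measurable_M_eq)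
  have [measurable]: "(\<lambda>x. \<integral>\<^sup>+y. ennreal \<bar>f x y\<bar> \<partial>M) \<in> borel_measurable M"
    "(\<lambda>x. \<integral>\<^sup>+y. ennreal (f x y) \<partial>M) \<in> borel_measurable M"
    "(\<lambda>x. \<integral>\<^sup>+y. ennreal (- f x y) \<partial>M) \<in> borel_measurable M"
    using f by (intro measurable_nn_integral_Borel; simp add: split_beta')+
  show ?thesis
    by (subst integral_real_eq_if) measurable
qed

lemma measurable_integral_Borel:
  fixes f :: "'a \<Rightarrow> 'a \<Rightarrow> complex"
  assumes f [measurable]: "(\<lambda>(x, y). f x y) \<in> borel_measurable borel_prod"
  shows "(\<lambda>x. LINT y|M. f x y) \<in> borel_measurable M"
proof -
  have [measurable]: "f x \<in> borel_measurable M" for x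
    using measurable_compose[OF Pair_measurable(1) f, of x] by (simp add: measurable_M_eq)
  have [measurable]: "(\<lambda>x. \<integral>\<^sup>+y. ennreal (cmod (f x y)) \<partial>M) \<in> borel_measurable M"
    using f by (intro measurable_nn_integral_Borel) (simp add: split_beta')
  have [measurable]: "(\<lambda>x. LINT y|M. Re (f x y)) \<in> borel_measurable M"
    "(\<lambda>x. LINT y|M. Im (f x y)) \<in> borel_measurable M"
    using f by (intro measurable_integral_real_Borel; simp add: split_beta')+
  have "(\<lambda>x. LINT y|M. f x y) = (\<lambda>x. if (\<integral>\<^sup>+y. ennreal (cmod (f x y)) \<partial>M) < top
     then of_real (LINT y|M. Re (f x y)) + \<i> * of_real (LINT y|M. Im (f x y)) else 0)"
    by (subst integral_complex_eq_if) (auto simp: complex_eq_iff)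
  then show ?thesis by simp
qed

text \<open>Each term on the right is an iterated integral of a nonnegative function, whose value
  does not depend on the order; Fubini's theorem for complex functions can be read off. As
  \<open>ennreal\<close> sends negative numbers to 0, \<open>I Re\<close> and
  \<open>I (\<lambda>z. - Re z)\<close> belong to the positive and the negative part of the real
  part.\<close>

lemma iterated_integral:
  fixes f :: "'a \<Rightarrow> 'a \<Rightarrow> complex"
  assumes f [measurable]: "(\<lambda>(x, y). f x y) \<in> borel_measurable borel_prod"
    and fin: "(\<integral>\<^sup>+x. \<integral>\<^sup>+y. ennreal (cmod (f x y)) \<partial>M \<partial>M) < top"
  defines "I \<equiv> \<lambda>h. complex_of_real (enn2real (\<integral>\<^sup>+x. \<integral>\<^sup>+y. ennreal (h (f x y)) \<partial>M \<partial>M))"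
  shows "(LINT x|M. LINT y|M. f x y) = I Re - I (\<lambda>z. - Re z) + \<i> * (I Im - I (\<lambda>z. - Im z))"
proof -
  have fx [measurable]: "f x \<in> borel_measurable M" for x
    using measurable_compose[OF Pair_measurable(1) f, of x] by (simp add: measurable_M_eq)
  define J where "J h x = enn2real (\<integral>\<^sup>+y. ennreal (h (f x y)) \<partial>M)" for h :: "complex \<Rightarrow> real" and x
  have m: "(\<lambda>x. \<integral>\<^sup>+y. ennreal (h (f x y)) \<partial>M) \<in> borel_measurable M"
    if [measurable]: "h \<in> borel_measurable borel" for h
    using f by (intro measurable_nn_integral_Borel) (simp add: split_beta')
  note [measurable] = m[of cmod]
  have J: "integrable M (J h)" "complex_of_real (LINT x|M. J h x) = I h"
    if h: "h \<in> borel_measurable borel" "\<And>z. h z \<le> cmod z" for h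
  proof -
    note [measurable] = h(1) m[OF h(1)]
    have finh: "(\<integral>\<^sup>+x. \<integral>\<^sup>+y. ennreal (h (f x y)) \<partial>M \<partial>M) < top"
      by (intro le_less_trans[OF _ fin] nn_integral_mono ennreal_leI h)
    then have "AE x in M. (\<integral>\<^sup>+y. ennreal (h (f x y)) \<partial>M) \<noteq> \<infinity>"
      by (intro nn_integral_PInf_AE) auto
    then have "AE x in M. ennreal (J h x) = (\<integral>\<^sup>+y. ennreal (h (f x y)) \<partial>M)"
      unfolding J_def by eventually_elim (simp add: less_top)
    then have eq: "(\<integral>\<^sup>+x. ennreal (J h x) \<partial>M) = (\<integral>\<^sup>+x. \<integral>\<^sup>+y. ennreal (h (f x y)) \<partial>M \<partial>M)"
      by (rule nn_integral_cong_AE)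
    have [measurable]: "J h \<in> borel_measurable M"
      unfolding J_def by measurable
    have nn: "0 \<le> J h x" for x by (simp add: J_def)
    show "integrable M (J h)"
      using finh nn by (simp add: integrable_iff_bounded eq)
    show "complex_of_real (LINT x|M. J h x) = I h"
      using nn by (simp add: I_def integral_eq_nn_integral eq)
  qed
  have h: "Re \<in> borel_measurable borel" "Im \<in> borel_measurable borel"
    "(\<lambda>z. - Re z) \<in> borel_measurable borel" "(\<lambda>z. - Im z) \<in> borel_measurable borel"
    "Re z \<le> cmod z" "Im z \<le> cmod z" "- Re z \<le> cmod z" "- Im z \<le> cmod z" for z
    using abs_Re_le_cmod[of z] abs_Im_le_cmod[of z] by auto
  note J' = J[OF h(1,5)] J[OF h(2,6)] J[OF h(3,7)] J[OF h(4,8)]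
  have "AE x in M. (\<integral>\<^sup>+y. ennreal (cmod (f x y)) \<partial>M) \<noteq> \<infinity>"
    using fin by (intro nn_integral_PInf_AE) auto
  then have "AE x in M. (LINT y|M. f x y) = of_real (J Re x) - of_real (J (\<lambda>z. - Re z) x)
      + \<i> * (of_real (J Im x) - of_real (J (\<lambda>z. - Im z) x))"
  proof eventually_elim
    case (elim x)
    then have fin': "(\<integral>\<^sup>+y. ennreal (cmod (f x y)) \<partial>M) < top"
      by (simp add: less_top)
    have "(\<integral>\<^sup>+y. ennreal \<bar>Re (f x y)\<bar> \<partial>M) < top" "(\<integral>\<^sup>+y. ennreal \<bar>Im (f x y)\<bar> \<partial>M) < top"
      by (rule le_less_trans[OF nn_integral_mono[OF ennreal_leI] fin'], rule abs_Re_le_cmod abs_Im_le_cmod)+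
    with fin' show ?case
      by (simp add: integral_complex_eq_if integral_real_eq_if J_def complex_eq_iff)
  qed
  moreover have "integrable M (\<lambda>x. of_real (J Re x) - of_real (J (\<lambda>z. - Re z) x)
      + \<i> * (of_real (J Im x) - of_real (J (\<lambda>z. - Im z) x)))"
    using J' by simp
  ultimately have "(LINT x|M. LINT y|M. f x y) = (LINT x|M. of_real (J Re x) - of_real (J (\<lambda>z. - Re z) x)
      + \<i> * (of_real (J Im x) - of_real (J (\<lambda>z. - Im z) x)))"
    by (intro integral_cong_AE measurable_integral_Borel f) auto
  then show ?thesis
    using J' by simp
qed

lemma Fubini_integral:
  fixes f :: "'a \<Rightarrow> 'a \<Rightarrow> complex"
  assumes f: "(\<lambda>(x, y). f x y) \<in> borel_measurable borel_prod"
    and fin: "(\<integral>\<^sup>+x. \<integral>\<^sup>+y. ennreal (cmod (f x y)) \<partial>M \<partial>M) < top"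
  shows "(LINT x|M. LINT y|M. f x y) = (LINT y|M. LINT x|M. f x y)"
proof -
  have f': "(\<lambda>(x, y). f y x) \<in> borel_measurable borel_prod"
    using measurable_compose[OF swap_Borel f] by (simp add: split_beta')
  have sw: "(\<integral>\<^sup>+x. \<integral>\<^sup>+y. ennreal (h (f x y)) \<partial>M \<partial>M) = (\<integral>\<^sup>+y. \<integral>\<^sup>+x. ennreal (h (f x y)) \<partial>M \<partial>M)"
    if [measurable]: "h \<in> borel_measurable borel" for h
    using f by (intro Fubini_nn_integral) (simp add: split_beta')
  have h: "Re \<in> borel_measurable borel" "Im \<in> borel_measurable borel" "cmod \<in> borel_measurable borel"
    "(\<lambda>z. - Re z) \<in> borel_measurable borel" "(\<lambda>z. - Im z) \<in> borel_measurable borel"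
    by auto
  show ?thesis
    using iterated_integral[OF f fin] iterated_integral[OF f' fin[unfolded sw[OF h(3)]]]
    by (simp only: sw[OF h(1)] sw[OF h(2)] sw[OF h(4)] sw[OF h(5)])
qed

end

section \<open>Integration on a locally compact group\<close>

locale haar_group =
  fixes M :: "'a::{topological_group_add, t2_space} measure" and \<Delta> :: "'a \<Rightarrow> real"
  assumes sigma: "sigma_compact_space (euclidean :: 'a topology)"
    and haar: "left_haar_measure M"
    and modular: "modular_function M \<Delta>"
begin

sublocale radon_measure M
  using haar sigma
  by unfold_locales (auto simp: left_haar_measure_def sigma_compact_space_def)

lemma cont_measurable [measurable]:
  "(\<lambda>x. y + x) \<in> M \<rightarrow>\<^sub>M M" "(\<lambda>x. x + y) \<in> M \<rightarrow>\<^sub>M M" "uminus \<in> M \<rightarrow>\<^sub>M M"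
  "(\<lambda>x. y - x) \<in> M \<rightarrow>\<^sub>M M" "(\<lambda>x. x - y) \<in> M \<rightarrow>\<^sub>M M"
  "(\<lambda>x. - x) \<in> M \<rightarrow>\<^sub>M M" "(\<lambda>x. - x + y) \<in> M \<rightarrow>\<^sub>M M" "(\<lambda>x. y + - x) \<in> M \<rightarrow>\<^sub>M M"
  unfolding measurable_cong_sets[OF sets_eq_borel sets_eq_borel]
  by (intro borel_measurable_continuous_onI continuous_intros)+

text \<open>Addition is continuous, hence Borel on the product, but need not be measurable for the
  product sigma algebra. This is why Fubini's theorem is set up on
  \<open>borel_prod\<close>.\<close>

lemma cont_measurable_pair [measurable]:
  "fst \<in> borel_prod \<rightarrow>\<^sub>M M" "snd \<in> borel_prod \<rightarrow>\<^sub>M M"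
  "(\<lambda>z. fst z + snd z) \<in> borel_prod \<rightarrow>\<^sub>M M"
  "(\<lambda>z. snd z + fst z) \<in> borel_prod \<rightarrow>\<^sub>M M"
  "(\<lambda>z. - fst z + snd z) \<in> borel_prod \<rightarrow>\<^sub>M M"
  "(\<lambda>z. - snd z + fst z) \<in> borel_prod \<rightarrow>\<^sub>M M"
  "(\<lambda>z. fst z - snd z) \<in> borel_prod \<rightarrow>\<^sub>M M"
  "(\<lambda>z. snd z - fst z) \<in> borel_prod \<rightarrow>\<^sub>M M"
  "(\<lambda>z. fst z + - snd z) \<in> borel_prod \<rightarrow>\<^sub>M M"
  "(\<lambda>z. snd z + - fst z) \<in> borel_prod \<rightarrow>\<^sub>M M"
  "(\<lambda>z. - snd z + y) \<in> borel_prod \<rightarrow>\<^sub>M M"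
  "(\<lambda>z. - fst z + y) \<in> borel_prod \<rightarrow>\<^sub>M M"
  unfolding measurable_cong_sets[OF refl sets_eq_borel]
  by (intro borel_measurable_continuous_onI continuous_intros)+

section \<open>Translations, the modular function and inversion\<close>

lemma modular_pos: "0 < \<Delta> y"
  using modular by (simp add: modular_function_def)

lemma emeasure_left_translation:
  "A \<in> sets borel \<Longrightarrow> emeasure M ((\<lambda>x. y + x) ` A) = emeasure M A"
  using haar unfolding left_haar_measure_def by blast

lemma distr_left_translation: "distr M M (\<lambda>x. y + x) = M"
proof (rule measure_eqI)
  fix A assume "A \<in> sets (distr M M (\<lambda>x. y + x))"
  then have A: "A \<in> sets borel" by (simp add: sets_eq_borel)
  have "(\<lambda>x. y + x) -` A = (\<lambda>x. - y + x) ` A"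
    by (force simp: image_iff add.assoc[symmetric] intro: bexI[of _ "y + _"])
  then show "emeasure (distr M M (\<lambda>x. y + x)) A = emeasure M A"
    using A by (simp add: emeasure_distr sets_eq_borel emeasure_left_translation)
qed simp

text \<open>The preimage of a set under right translation by \<open>y\<close> is its right translate
  by \<open>- y\<close>; hence the argument of \<open>\<Delta>\<close>.\<close>

lemma distr_right_translation: "distr M M (\<lambda>x. x + y) = scale_measure (ennreal (\<Delta> (- y))) M"
proof (rule measure_eqI)
  fix A assume "A \<in> sets (distr M M (\<lambda>x. x + y))"
  then have A: "A \<in> sets borel" by (simp add: sets_eq_borel)
  have "(\<lambda>x. x + y) -` A = (\<lambda>x. x + - y) ` A"
    by (force simp: image_iff add.assoc simp del: add_uminus_conv_diff intro: bexI[of _ "_ + y"])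
  then show "emeasure (distr M M (\<lambda>x. x + y)) A = emeasure (scale_measure (ennreal (\<Delta> (- y))) M) A"
    using modular A by (simp add: emeasure_distr sets_eq_borel modular_function_def del: add_uminus_conv_diff)
qed simp

lemma nn_integral_left_translation:
  assumes [measurable]: "f \<in> borel_measurable M"
  shows "(\<integral>\<^sup>+x. f (y + x) \<partial>M) = (\<integral>\<^sup>+x. f x \<partial>M)"
  by (subst distr_left_translation[of y, symmetric]) (simp add: nn_integral_distr)

lemma nn_integral_right_translation:
  assumes [measurable]: "f \<in> borel_measurable M"
  shows "(\<integral>\<^sup>+x. f (x + y) \<partial>M) = ennreal (\<Delta> (- y)) * (\<integral>\<^sup>+x. f x \<partial>M)"
proof -
  have "(\<integral>\<^sup>+x. f (x + y) \<partial>M) = (\<integral>\<^sup>+x. f x \<partial>distr M M (\<lambda>x. x + y))"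
    by (simp add: nn_integral_distr)
  then show ?thesis by (simp add: distr_right_translation nn_integral_scale_measure)
qed

lemma positive_compact:
  obtains K where "compact K" "0 < emeasure M K" "emeasure M K < top" "K \<in> sets M"
proof -
  have "emeasure M UNIV \<noteq> 0"
    using haar unfolding left_haar_measure_def by blast
  then have "0 < emeasure M UNIV"
    by (simp add: zero_less_iff_neq_zero)
  then obtain K where "compact K" "0 < emeasure M K"
    by (auto simp: inner_regular[OF open_UNIV] less_SUP_iff)
  then show ?thesis
    by (intro that[of K]) (auto simp: emeasure_compact sets_eq_borel compact_imp_closed)
qed

text \<open>Finitely many left translates of \<open>V\<close> cover a compact set of positive
  measure, and they all have the measure of \<open>V\<close>.\<close>

lemma emeasure_open_pos:
  assumes V: "open V" "v \<in> V"
  shows "0 < emeasure M V"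
proof -
  obtain K where K: "compact K" "0 < emeasure M K" "emeasure M K < top" "K \<in> sets M"
    by (rule positive_compact)
  have opn: "open ((\<lambda>z. y + z) ` V)" for y
  proof -
    have "(\<lambda>z. y + z) ` V = (\<lambda>z. - y + z) -` V"
      by (force simp: image_iff add.assoc[symmetric] intro: bexI[of _ "- y + _"])
    then show ?thesis using V by (auto intro!: open_vimage continuous_intros)
  qed
  have "K \<subseteq> \<Union>(range (\<lambda>k. (\<lambda>z. (k - v) + z) ` V))"
  proof
    fix k assume "k \<in> K"
    have "k = (k - v) + v" by simp
    then show "k \<in> \<Union>(range (\<lambda>k. (\<lambda>z. (k - v) + z) ` V))" using V by blast
  qed
  then obtain \<F> where F: "\<F> \<subseteq> range (\<lambda>k. (\<lambda>z. (k - v) + z) ` V)" "finite \<F>" "K \<subseteq> \<Union>\<F>"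
    by (rule compactE[OF K(1)]) (use opn in auto)
  have meas: "W \<in> sets M" "emeasure M W = emeasure M V" if "W \<in> \<F>" for W
    using F(1) that opn V by (auto simp: sets_eq_borel emeasure_left_translation)
  show ?thesis
  proof (rule ccontr)
    assume "\<not> 0 < emeasure M V"
    then have "W \<in> null_sets M" if "W \<in> \<F>" for W
      using meas[OF that] by (auto simp: null_sets_def zero_less_iff_neq_zero)
    then have "\<Union>\<F> \<in> null_sets M"
      using F(2) by (intro null_sets.finite_Union) auto
    then have "emeasure M K \<le> 0"
      using F(3) by (metis emeasure_mono null_setsD1 null_setsD2)
    then show False using K(2) by simp
  qed
qed

lemma nn_integral_cell:
  assumes [measurable]: "V \<in> sets M"
  shows "(\<integral>\<^sup>+y. indicator V (- z + y) \<partial>M) = emeasure M V"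
  using nn_integral_left_translation[of "indicator V" "- z"] by simp

text \<open>A compact set is translated in two steps and in one; its measure is positive and finite,
  so it cancels.\<close>

lemma modular_add: "\<Delta> (x + y) = \<Delta> x * \<Delta> y"
proof -
  obtain K where K: "compact K" "0 < emeasure M K" "emeasure M K < top" "K \<in> sets M"
    by (rule positive_compact)
  then obtain k where k: "emeasure M K = ennreal k" "0 < k"
    by (cases "emeasure M K") auto
  have *: "emeasure M ((\<lambda>x. x + y) ` A) = ennreal (\<Delta> y) * emeasure M A" if "A \<in> sets borel" for y A
    using modular that by (simp add: modular_function_def)
  have "compact ((\<lambda>z. z + x) ` K)"
    using K by (intro compact_continuous_image continuous_intros)
  then have "emeasure M ((\<lambda>z. z + y) ` (\<lambda>z. z + x) ` K) = ennreal (\<Delta> y) * (ennreal (\<Delta> x) * emeasure M K)"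
    using K by (simp add: * sets_eq_borel compact_imp_closed)
  moreover have "(\<lambda>z. z + y) ` (\<lambda>z. z + x) ` K = (\<lambda>z. z + (x + y)) ` K"
    by (simp add: image_image add.assoc)
  ultimately have "ennreal (\<Delta> (x + y)) * ennreal k = ennreal (\<Delta> y) * (ennreal (\<Delta> x) * ennreal k)"
    using *[of K "x + y"] K k by (simp add: sets_eq_borel)
  then show ?thesis
    using k modular_pos[THEN less_imp_le] by (simp add: ennreal_mult[symmetric])
qed

lemma modular_zero: "\<Delta> 0 = 1"
  using modular_add[of 0 0] modular_pos[of 0] by simp

lemma modular_minus: "\<Delta> (- x) = inverse (\<Delta> x)"
  using modular_add[of x "- x"] modular_pos[of x] by (simp add: modular_zero field_simps)

text \<open>Up to the factor \<open>emeasure M K\<close>, \<open>\<Delta> (- y)\<close> is an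
  integral with parameter \<open>y\<close>, so it is measurable by the Borel form of Fubini's
  theorem.\<close>

lemma measurable_modular [measurable]: "\<Delta> \<in> borel_measurable M"
proof -
  obtain K where K: "compact K" "0 < emeasure M K" "emeasure M K < top" "K \<in> sets M"
    by (rule positive_compact)
  note [measurable] = K(4)
  have "(\<lambda>y. \<integral>\<^sup>+x. indicator K (x + y) \<partial>M) \<in> borel_measurable M"
    by (intro measurable_nn_integral_Borel) (simp add: split_beta')
  also have "(\<lambda>y. \<integral>\<^sup>+x. indicator K (x + y) \<partial>M) = (\<lambda>y. ennreal (\<Delta> (- y)) * emeasure M K)"
    using nn_integral_right_translation[of "indicator K"] by simp
  finally have "(\<lambda>y. inverse (enn2real (ennreal (\<Delta> (- y)) * emeasure M K / emeasure M K))) \<in> borel_measurable M"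
    by measurable
  moreover have "inverse (enn2real (ennreal (\<Delta> (- y)) * emeasure M K / emeasure M K)) = \<Delta> y" for y
    using K(2,3) modular_pos[of y]
    by (simp add: ennreal_mult_divide_eq modular_minus less_top[symmetric])
  ultimately show ?thesis by simp
qed

lemma compact_plus:
  assumes "compact K" "compact C"
  shows "compact ((\<lambda>(x, y). x + y) ` (K \<times> C :: ('a \<times> 'a) set))"
  using assms by (intro compact_continuous_image compact_Times) (auto simp: split_beta' intro!: continuous_intros)

text \<open>For \<open>y\<close> in \<open>C\<close> the right translate of \<open>K\<close> by
  \<open>y\<close> stays inside the compact set \<open>K + C\<close>, whose measure bounds
  \<open>\<Delta> y\<close> times that of \<open>K\<close>.\<close>

lemma modular_bounded_on_compact:
  assumes C: "compact C"
  shows "\<exists>B. \<forall>y\<in>C. \<Delta> y \<le> B"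
proof -
  obtain K where K: "compact K" "0 < emeasure M K" "emeasure M K < top" "K \<in> sets M"
    by (rule positive_compact)
  then obtain k where k: "emeasure M K = ennreal k" "0 < k"
    by (cases "emeasure M K") auto
  let ?S = "(\<lambda>(x, y). x + y) ` (K \<times> C)"
  have S: "compact ?S" by (rule compact_plus[OF K(1) C])
  then obtain s where s: "emeasure M ?S = ennreal s" "0 \<le> s"
    using emeasure_compact[OF S] by (cases "emeasure M ?S") auto
  have "\<Delta> y \<le> s / k" if "y \<in> C" for y
  proof -
    have "ennreal (\<Delta> y) * emeasure M K = emeasure M ((\<lambda>x. x + y) ` K)"
      using modular K by (simp add: modular_function_def sets_eq_borel)
    also have "\<dots> \<le> emeasure M ?S"
      using that S by (intro emeasure_mono) (auto simp: sets_eq_borel compact_imp_closed)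
    finally have "\<Delta> y * k \<le> s"
      using k s modular_pos[of y] by (simp add: ennreal_mult[symmetric])
    then show ?thesis using k by (simp add: field_simps)
  qed
  then show ?thesis by blast
qed

text \<open>
  Both \<open>\<integral>f\<close> and \<open>\<integral>f(-x) \<Delta>(-x) dx\<close> are left invariant; they are compared by
  integrating \<open>1\<^sub>K(x) f(-y + x) \<Delta>(-y + x)\<close> in both orders.
\<close>

lemma nn_integral_minus_modular:
  assumes [measurable]: "f \<in> borel_measurable M"
  shows "(\<integral>\<^sup>+y. f (- y) * ennreal (\<Delta> (- y)) \<partial>M) = (\<integral>\<^sup>+x. f x \<partial>M)"
proof -
  obtain K where K: "compact K" "0 < emeasure M K" "emeasure M K < top" "K \<in> sets M"
    by (rule positive_compact)
  note [measurable] = K(4)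
  let ?I = "\<integral>\<^sup>+y. f (- y) * ennreal (\<Delta> (- y)) \<partial>M"
  have 1: "?I = (\<integral>\<^sup>+y. f (- y + x) * ennreal (\<Delta> (- y + x)) \<partial>M)" for x
    using nn_integral_left_translation[of "\<lambda>y. f (- y) * ennreal (\<Delta> (- y))" "- x"]
    by (simp add: minus_add)
  have 2: "(\<integral>\<^sup>+x. indicator K x * (f (- y + x) * ennreal (\<Delta> (- y + x))) \<partial>M)
      = (\<integral>\<^sup>+x. indicator K (y + x) * (f x * ennreal (\<Delta> x)) \<partial>M)" for y
    using nn_integral_left_translation[of "\<lambda>x. indicator K x * (f (- y + x) * ennreal (\<Delta> (- y + x)))" y]
    by (simp add: add.assoc[symmetric])
  have "emeasure M K * ?I = (\<integral>\<^sup>+x. indicator K x * ?I \<partial>M)"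
    by (simp add: nn_integral_multc)
  also have "\<dots> = (\<integral>\<^sup>+x. \<integral>\<^sup>+y. indicator K x * (f (- y + x) * ennreal (\<Delta> (- y + x))) \<partial>M \<partial>M)"
    by (simp add: nn_integral_cmult 1[symmetric])
  also have "\<dots> = (\<integral>\<^sup>+y. \<integral>\<^sup>+x. indicator K x * (f (- y + x) * ennreal (\<Delta> (- y + x))) \<partial>M \<partial>M)"
    by (intro Fubini_nn_integral) (simp add: split_beta')
  also have "\<dots> = (\<integral>\<^sup>+y. \<integral>\<^sup>+x. indicator K (y + x) * (f x * ennreal (\<Delta> x)) \<partial>M \<partial>M)"
    by (simp add: 2)
  also have "\<dots> = (\<integral>\<^sup>+x. \<integral>\<^sup>+y. indicator K (y + x) * (f x * ennreal (\<Delta> x)) \<partial>M \<partial>M)"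
    by (intro Fubini_nn_integral) (simp add: split_beta')
  also have "\<dots> = (\<integral>\<^sup>+x. emeasure M K * f x \<partial>M)"
  proof (intro nn_integral_cong)
    fix x
    have "(\<integral>\<^sup>+y. indicator K (y + x) \<partial>M) = ennreal (\<Delta> (- x)) * emeasure M K"
      using nn_integral_right_translation[of "indicator K" x] by simp
    moreover have "(\<integral>\<^sup>+y. indicator K (y + x) * (f x * ennreal (\<Delta> x)) \<partial>M)
        = (\<integral>\<^sup>+y. indicator K (y + x) \<partial>M) * (f x * ennreal (\<Delta> x))"
      by (rule nn_integral_multc) measurable
    ultimately have "(\<integral>\<^sup>+y. indicator K (y + x) * (f x * ennreal (\<Delta> x)) \<partial>M)
        = (ennreal (\<Delta> (- x)) * ennreal (\<Delta> x)) * (emeasure M K * f x)"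
      by (simp only: mult_ac)
    also have "ennreal (\<Delta> (- x)) * ennreal (\<Delta> x) = 1"
      using modular_pos[of x] by (simp add: ennreal_mult[symmetric] modular_minus)
    finally show "(\<integral>\<^sup>+y. indicator K (y + x) * (f x * ennreal (\<Delta> x)) \<partial>M) = emeasure M K * f x" by simp
  qed
  also have "\<dots> = emeasure M K * (\<integral>\<^sup>+x. f x \<partial>M)"
    by (simp add: nn_integral_cmult)
  finally show ?thesis
    using K by (subst (asm) ennreal_mult_cancel_left) auto
qed

lemma nn_integral_minus:
  assumes [measurable]: "f \<in> borel_measurable M"
  shows "(\<integral>\<^sup>+x. f (- x) \<partial>M) = (\<integral>\<^sup>+x. f x * ennreal (inverse (\<Delta> x)) \<partial>M)"
proof -
  have "f (- y) = f (- y) * ennreal (inverse (\<Delta> (- y))) * ennreal (\<Delta> (- y))" for y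
    using modular_pos[of "- y"] by (simp add: mult.assoc ennreal_mult[symmetric])
  then have "(\<integral>\<^sup>+x. f (- x) \<partial>M) = (\<integral>\<^sup>+y. f (- y) * ennreal (inverse (\<Delta> (- y))) * ennreal (\<Delta> (- y)) \<partial>M)"
    by simp
  also have "\<dots> = (\<integral>\<^sup>+x. f x * ennreal (inverse (\<Delta> x)) \<partial>M)"
    by (rule nn_integral_minus_modular) measurable
  finally show ?thesis .
qed

text \<open>Serves translations and inversion, which may change the measure of a set but keep null
  sets null.\<close>

lemma AE_compose:
  assumes "AE x in M. P x" and [measurable]: "h \<in> M \<rightarrow>\<^sub>M M"
    and null: "\<And>f. f \<in> borel_measurable M \<Longrightarrow> (\<integral>\<^sup>+x. f x \<partial>M) = 0 \<Longrightarrow> (\<integral>\<^sup>+x. f (h x) \<partial>M) = 0"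
  shows "AE x in M. P (h x)"
proof -
  obtain N where N: "N \<in> null_sets M" "{x \<in> space M. \<not> P x} \<subseteq> N"
    using assms(1) by (auto simp: eventually_ae_filter)
  then have [measurable]: "N \<in> sets M" by auto
  have "(\<integral>\<^sup>+x. indicator N (h x) \<partial>M) = 0"
    using N by (intro null) auto
  then have "AE x in M. indicator N (h x) = (0 :: ennreal)"
    by (subst (asm) nn_integral_0_iff_AE) auto
  then show ?thesis
    by eventually_elim (use N in \<open>auto split: split_indicator_asm\<close>)
qed

lemma AE_left_translation: "AE x in M. P x \<Longrightarrow> AE x in M. P (y + x)"
  by (rule AE_compose[where h = "\<lambda>x. y + x"]) (auto simp: nn_integral_left_translation)

lemma AE_right_translation: "AE x in M. P x \<Longrightarrow> AE x in M. P (x + y)"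
  by (rule AE_compose[where h = "\<lambda>x. x + y"]) (auto simp: nn_integral_right_translation)

lemma AE_minus: "AE x in M. P x \<Longrightarrow> AE x in M. P (- x)"
  by (rule AE_compose[where h = "\<lambda>x. - x"]) (auto simp: nn_integral_minus nn_integral_0_iff_AE)

lemma AE_minus_translation: "AE x in M. P x \<Longrightarrow> AE x in M. P (- x + y)"
  using AE_minus[OF AE_right_translation] .

text \<open>Submultiplicativity bounds \<open>w y\<close> by \<open>w (y + v) * w (- v)\<close>.
  Averaging over a set of \<open>v\<close> of positive measure on which \<open>w (- v)\<close> is
  bounded turns local integrability into a bound that is uniform on \<open>C\<close>.\<close>

lemma submultiplicative_bounded_on_compact:
  assumes w: "submultiplicative_weight M w" and C: "compact C"
  shows "\<exists>B. \<forall>y\<in>C. w y \<le> B"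
proof -
  have wm [measurable]: "w \<in> borel_measurable M" and w_pos: "\<And>x. 0 < w x"
    and w_int: "\<And>K. compact K \<Longrightarrow> set_integrable M K w"
    and w_mult: "\<And>x y. w (x + y) \<le> w x * w y"
    using w by (auto simp: submultiplicative_weight_def weight_def)
  obtain K where K: "compact K" "0 < emeasure M K" "emeasure M K < top" "K \<in> sets M"
    by (rule positive_compact)
  note [measurable] = K(4)
  \<comment> \<open>These sets exhaust \<open>K\<close>, so one of them has positive
    measure.\<close>
  define A where "A n = {v \<in> K. w (- v) \<le> real n}" for n
  have "A n = {v \<in> space M. v \<in> K \<and> w (- v) \<le> real n}" for n
    by (auto simp: A_def)
  then have A [measurable]: "A n \<in> sets M" for n
    by simp
  have "(\<Union>n. A n) = K"
    using real_arch_simple by (auto simp: A_def)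
  then obtain n where n: "emeasure M (A n) \<noteq> 0"
    using K(2) emeasure_UN_eq_0[of M A] A by (metis image_subsetI less_irrefl)
  have An: "emeasure M (A n) \<le> emeasure M K"
    by (intro emeasure_mono) (auto simp: A_def)
  let ?S = "(\<lambda>(x, y). x + y) ` (C \<times> K)"
  have S: "compact ?S" by (rule compact_plus[OF C K(1)])
  then have [measurable]: "?S \<in> sets M" by (simp add: sets_eq_borel compact_imp_closed)
  define I where "I = (\<integral>\<^sup>+x. ennreal (w x) * indicator ?S x \<partial>M)"
  have "I < top"
  proof -
    have "I = (\<integral>\<^sup>+x. ennreal (norm (indicator ?S x *\<^sub>R w x)) \<partial>M)"
      unfolding I_def using w_pos[THEN less_imp_le]
      by (intro nn_integral_cong) (auto split: split_indicator)
    then show ?thesis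
      using w_int[OF S] by (auto simp: set_integrable_def integrable_iff_bounded)
  qed
  have "ennreal (w y) \<le> ennreal n * I / emeasure M (A n)" if y: "y \<in> C" for y
  proof -
    have "ennreal (w y) * emeasure M (A n) = (\<integral>\<^sup>+v. ennreal (w y) * indicator (A n) v \<partial>M)"
      by (simp add: nn_integral_cmult)
    also have "\<dots> \<le> (\<integral>\<^sup>+v. ennreal n * (ennreal (w (y + v)) * indicator ?S (y + v)) \<partial>M)"
    proof (rule nn_integral_mono)
      fix v
      show "ennreal (w y) * indicator (A n) v \<le> ennreal n * (ennreal (w (y + v)) * indicator ?S (y + v))"
      proof (cases "v \<in> A n")
        case True
        then have v: "v \<in> K" "w (- v) \<le> n" by (auto simp: A_def)
        have "w y \<le> w (y + v) * w (- v)"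
          using w_mult[of "y + v" "- v"] by (simp add: add.assoc)
        also have "\<dots> \<le> w (y + v) * n"
          using v w_pos[of "y + v"] by (intro mult_left_mono) auto
        finally have "ennreal (w y) \<le> ennreal n * ennreal (w (y + v))"
          using w_pos[of "y + v"] by (simp add: ennreal_mult[symmetric] ennreal_leI mult.commute)
        moreover have "y + v \<in> ?S" using y v by force
        ultimately show ?thesis using True by simp
      qed simp
    qed
    also have "\<dots> = ennreal n * I"
      unfolding I_def using nn_integral_left_translation[of "\<lambda>v. ennreal (w v) * indicator ?S v" y]
      by (simp add: nn_integral_cmult)
    finally have "ennreal (w y) * emeasure M (A n) / emeasure M (A n) \<le> ennreal n * I / emeasure M (A n)"
      by (rule divide_right_mono_ennreal)
    then show ?thesis
      using n An K(3) by (subst (asm) ennreal_mult_divide_eq) auto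
  qed
  moreover have "ennreal n * I / emeasure M (A n) < top"
    using n \<open>I < top\<close> by (simp add: ennreal_mult_less_top ennreal_divide_eq_top_iff less_top[symmetric] ennreal_mult_eq_top_iff)
  ultimately show ?thesis
    by (intro exI[of _ "enn2real (ennreal n * I / emeasure M (A n))"] ballI)
       (metis enn2real_mono enn2real_ennreal less_imp_le w_pos)
qed

section \<open>The oscillation\<close>

lemma osc_le_iff:
  assumes [measurable]: "G \<in> borel_measurable M" and U: "compact U"
  shows "osc M U G x \<le> c \<longleftrightarrow> (AE u in M. u \<in> U \<longrightarrow> ennreal (cmod (G (u + x) - G x)) \<le> c)"
proof -
  have UM: "U \<inter> space M \<in> sets M" using U by (simp add: sets_eq_borel compact_imp_closed)
  have m: "(\<lambda>u. ennreal (cmod (G (u + x) - G x))) \<in> borel_measurable (restrict_space M U)"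
    by (intro measurable_restrict_space1) measurable
  show ?thesis
    unfolding osc_def Lp_enorm_top[symmetric] Lp_enorm_top_le_iff[OF m] AE_restrict_space_iff[OF UM] ..
qed

text \<open>The condition \<open>osc M U G x \<le> c\<close> says that an integral over
  \<open>u\<close> with parameter \<open>x\<close> vanishes, namely that of the indicator of the
  exceptional \<open>u\<close> in \<open>U\<close>.\<close>

lemma measurable_osc [measurable]:
  assumes [measurable]: "G \<in> borel_measurable M" and U: "compact U"
  shows "osc M U G \<in> borel_measurable M"
proof (rule borel_measurableI_le)
  fix c
  have [measurable]: "U \<in> sets M" using U by (simp add: sets_eq_borel compact_imp_closed)
  have "(\<lambda>x. \<integral>\<^sup>+u. indicator U u * indicator {c<..} (ennreal (cmod (G (u + x) - G x))) \<partial>M) \<in> borel_measurable M"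
    by (intro measurable_nn_integral_Borel) (simp add: split_beta')
  then have "{x \<in> space M. (\<integral>\<^sup>+u. indicator U u * indicator {c<..} (ennreal (cmod (G (u + x) - G x))) \<partial>M) = 0} \<in> sets M"
    by measurable
  also have "{x \<in> space M. (\<integral>\<^sup>+u. indicator U u * indicator {c<..} (ennreal (cmod (G (u + x) - G x))) \<partial>M) = 0}
      = {x \<in> space M. osc M U G x \<le> c}"
    unfolding osc_le_iff[OF assms]
    by (subst nn_integral_0_iff_AE) (auto split: split_indicator intro!: Collect_cong AE_cong simp: not_less)
  finally show "{x \<in> space M. osc M U G x \<le> c} \<in> sets M" .
qed

text \<open>For every \<open>z\<close> the bound holds for almost all \<open>u\<close> in
  \<open>U\<close>; Fubini's theorem exchanges the two quantifiers.\<close>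

lemma osc_AE:
  assumes [measurable]: "G \<in> borel_measurable M" and U: "compact U"
  shows "AE u in M. u \<in> U \<longrightarrow> (AE z in M. ennreal (cmod (G (u + z) - G z)) \<le> osc M U G z)"
proof -
  have [measurable]: "U \<in> sets M" using U by (simp add: sets_eq_borel compact_imp_closed)
  note [measurable] = measurable_osc[OF assms]
  let ?f = "\<lambda>u z. indicator U u * (if ennreal (cmod (G (u + z) - G z)) \<le> osc M U G z then 0 else 1 :: ennreal)"
  have m: "(\<lambda>(u, z). ?f u z) \<in> borel_measurable borel_prod"
    unfolding split_beta' by measurable
  have "(\<integral>\<^sup>+u. ?f u z \<partial>M) = 0" for z
    using osc_le_iff[OF assms, of z "osc M U G z"]
    by (subst nn_integral_0_iff_AE) (auto elim!: eventually_mono)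
  then have "(\<integral>\<^sup>+u. \<integral>\<^sup>+z. ?f u z \<partial>M \<partial>M) = 0"
    by (subst Fubini_nn_integral[OF m]) simp
  then have "AE u in M. (\<integral>\<^sup>+z. ?f u z \<partial>M) = 0"
    using measurable_nn_integral_Borel[OF m] by (subst (asm) nn_integral_0_iff_AE) auto
  then show ?thesis
  proof eventually_elim
    case (elim u)
    show ?case
    proof
      assume "u \<in> U"
      have "AE z in M. ?f u z = 0"
        using elim by (subst (asm) nn_integral_0_iff_AE) auto
      then show "AE z in M. ennreal (cmod (G (u + z) - G z)) \<le> osc M U G z"
        by eventually_elim (use \<open>u \<in> U\<close> in \<open>auto split: if_splits\<close>)
    qed
  qed
qed

end

section \<open>Weighted convolution inequalities\<close>

lemma conjugate_exponent_ge_1: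
  fixes p q :: ennreal
  assumes "inverse p + inverse q = 1"
  shows "1 \<le> q"
proof -
  have "inverse q \<le> inverse p + inverse q" by simp
  then have *: "inverse q \<le> 1" using assms by simp
  show ?thesis
  proof (cases q)
    case (real c)
    with * have "0 < c" by (auto simp: less_le top_unique)
    then have "inverse c \<le> 1" using * real by (simp add: inverse_ennreal)
    then show ?thesis using real \<open>0 < c\<close> by (simp add: field_simps)
  qed simp
qed

lemma ennreal_inverse_eq_1D:
  assumes "inverse (a :: ennreal) = 1"
  shows "a = 1"
proof (cases a)
  case (real c)
  with assms have "0 < c" by (auto simp: less_le)
  then have "inverse c = 1" using assms real by (simp add: inverse_ennreal)
  then show ?thesis using real by simp
qed (use assms in auto)

lemma enn2real_inverse_conjugate:
  fixes p q :: ennreal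
  assumes "inverse p + inverse q = 1"
  shows "enn2real (inverse p) + enn2real (inverse q) = 1"
proof -
  have "inverse p \<le> inverse p + inverse q" "inverse q \<le> inverse p + inverse q"
    by simp_all
  then have "inverse p < top" "inverse q < top"
    unfolding assms by (auto intro: le_less_trans)
  then have "enn2real (inverse p + inverse q) = enn2real (inverse p) + enn2real (inverse q)"
    by (rule enn2real_plus)
  then show ?thesis using assms by simp
qed

text \<open>The qualitative form of Hoelder's inequality. Only finiteness is claimed, so away from
  the endpoints Young's inequality for products can be applied pointwise without normalizing the
  functions.\<close>

lemma nn_integral_mult_finite:
  fixes p q :: ennreal
  assumes conj: "inverse p + inverse q = 1" and p: "1 \<le> p"
    and [measurable]: "f \<in> borel_measurable M" "g \<in> borel_measurable M"
    and f: "Lp_enorm M p f < top" and g: "Lp_enorm M q g < top"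
  shows "(\<integral>\<^sup>+x. f x * g x \<partial>M) < top"
proof -
  have endpoint: "(\<integral>\<^sup>+x. f x * g x \<partial>M) < top"
    if [measurable]: "f \<in> borel_measurable M" "g \<in> borel_measurable M"
      and "Lp_enorm M top f < top" "Lp_enorm M 1 g < top" for f g
  proof -
    have "AE x in M. f x * g x \<le> Lp_enorm M top f * g x"
      using Lp_enorm_top_le_iff[of f M "Lp_enorm M top f"] by (auto elim!: eventually_mono intro: mult_right_mono)
    then have "(\<integral>\<^sup>+x. f x * g x \<partial>M) \<le> (\<integral>\<^sup>+x. Lp_enorm M top f * g x \<partial>M)"
      by (rule nn_integral_mono_AE)
    also have "\<dots> < top"
      using that by (simp add: nn_integral_cmult Lp_enorm_one ennreal_mult_less_top)
    finally show ?thesis .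
  qed
  show ?thesis
    using p
  proof (cases rule: exponent_cases)
    case top
    then have "inverse q = 1" using conj by simp
    then have "q = 1" by (rule ennreal_inverse_eq_1D)
    then show ?thesis using endpoint[of f g] f g top by simp
  next
    case (real r)
    have q: "1 \<le> q" using conj by (rule conjugate_exponent_ge_1)
    show ?thesis
      using q
    proof (cases rule: exponent_cases)
      case top
      then have "inverse p = 1" using conj by simp
      then have "p = 1" by (rule ennreal_inverse_eq_1D)
      then show ?thesis using endpoint[of g f] f g top by (simp add: mult.commute)
    next
      case (real r')
      have rr: "1 / r + 1 / r' = 1"
        using enn2real_inverse_conjugate[OF conj] \<open>p = ennreal r\<close> \<open>1 \<le> r\<close> real
        by (simp add: inverse_ennreal inverse_eq_divide)
      then have r: "1 < r" "1 < r'"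
        using \<open>1 \<le> r\<close> \<open>1 \<le> r'\<close> by (auto simp: less_le field_simps)
      have "f x * g x \<le> ennreal_powr (f x) r + ennreal_powr (g x) r'" for x
      proof (cases "f x = top \<or> g x = top")
        case False
        then obtain a b where ab: "f x = ennreal a" "g x = ennreal b" "0 \<le> a" "0 \<le> b"
          by (metis ennreal_cases)
        have "a * b \<le> a powr r / r + b powr r' / r'"
          using r rr ab by (intro Youngs_inequality) auto
        also have "\<dots> \<le> a powr r + b powr r'"
          using r by (intro add_mono) (auto simp: divide_le_eq mult_le_cancel_left1)
        finally show ?thesis
          using ab by (simp add: ennreal_powr_ennreal ennreal_mult[symmetric] ennreal_plus[symmetric] ennreal_leI del: ennreal_plus)
      qed auto
      then have "(\<integral>\<^sup>+x. f x * g x \<partial>M) \<le> (\<integral>\<^sup>+x. ennreal_powr (f x) r + ennreal_powr (g x) r' \<partial>M)"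
        by (rule nn_integral_mono)
      also have "\<dots> = (\<integral>\<^sup>+x. ennreal_powr (f x) r \<partial>M) + (\<integral>\<^sup>+x. ennreal_powr (g x) r' \<partial>M)"
        by (rule nn_integral_add) measurable
      also have "\<dots> < top"
        using f g \<open>p = ennreal r\<close> \<open>1 \<le> r\<close> real by (simp add: Lp_enorm_ennreal)
      finally show ?thesis .
    qed
  qed
qed

section \<open>Young's inequality for convolutions on the group\<close>

context haar_group
begin

text \<open>The substitution \<open>y = x - z\<close> writes the convolution as a superposition of
  right translates of \<open>f\<close>, the form to which Minkowski's inequality applies; the
  inverse modular factor comes from the inversion.\<close>

lemma nn_convolution_alt:
  assumes [measurable]: "f \<in> borel_measurable M" "k \<in> borel_measurable M"
  shows "(\<integral>\<^sup>+y. f y * k (- y + x) \<partial>M) = (\<integral>\<^sup>+z. f (x + - z) * k z * ennreal (inverse (\<Delta> z)) \<partial>M)"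
proof -
  have "(\<integral>\<^sup>+y. f y * k (- y + x) \<partial>M) = (\<integral>\<^sup>+y. f (x + y) * k (- (x + y) + x) \<partial>M)"
    by (subst nn_integral_left_translation[symmetric, of _ x]) auto
  also have "\<dots> = (\<integral>\<^sup>+y. f (x + - (- y)) * k (- y) \<partial>M)"
    by (simp add: minus_add add.assoc)
  also have "\<dots> = (\<integral>\<^sup>+z. f (x + - z) * k z * ennreal (inverse (\<Delta> z)) \<partial>M)"
    by (subst nn_integral_minus[symmetric]) measurable
  finally show ?thesis .
qed

lemma measurable_nn_convolution [measurable]:
  assumes [measurable]: "f \<in> borel_measurable M" "k \<in> borel_measurable M"
  shows "(\<lambda>x. \<integral>\<^sup>+y. f y * k (- y + x) \<partial>M) \<in> borel_measurable M"
  by (intro measurable_nn_integral_Borel) (simp add: split_beta')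

text \<open>The right translate of \<open>f\<close> by \<open>- z\<close> has norm
  \<open>\<Delta> z powr (1 / p)\<close> times that of \<open>f\<close>. Minkowski's inequality sums
  these norms with weight \<open>k z / \<Delta> z\<close>, which explains the exponent.\<close>

lemma Lp_enorm_nn_convolution:
  assumes p: "1 \<le> p" and [measurable]: "f \<in> borel_measurable M" "k \<in> borel_measurable M"
    and fin: "Lp_enorm M p f < top"
  shows "Lp_enorm M p (\<lambda>x. \<integral>\<^sup>+y. f y * k (- y + x) \<partial>M)
    \<le> Lp_enorm M p f * (\<integral>\<^sup>+z. k z * ennreal (\<Delta> z powr (enn2real (inverse p) - 1)) \<partial>M)"
  using p
proof (cases rule: exponent_cases)
  case top
  have "(\<integral>\<^sup>+y. f y * k (- y + x) \<partial>M) \<le> Lp_enorm M top f * (\<integral>\<^sup>+z. k z * ennreal (inverse (\<Delta> z)) \<partial>M)" for x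
  proof -
    have "AE z in M. f z \<le> Lp_enorm M top f"
      using Lp_enorm_top_le_iff[of f M "Lp_enorm M top f"] by auto
    then have "AE z in M. f (x + z) \<le> Lp_enorm M top f"
      by (rule AE_left_translation)
    then have "AE z in M. f (x + - z) \<le> Lp_enorm M top f"
      by (rule AE_minus)
    then have "(\<integral>\<^sup>+z. f (x + - z) * k z * ennreal (inverse (\<Delta> z)) \<partial>M)
        \<le> (\<integral>\<^sup>+z. Lp_enorm M top f * (k z * ennreal (inverse (\<Delta> z))) \<partial>M)"
      by (intro nn_integral_mono_AE) (auto elim!: eventually_mono simp: mult.assoc intro!: mult_right_mono)
    then show ?thesis
      by (simp add: nn_convolution_alt nn_integral_cmult)
  qed
  then show ?thesis
    using modular_pos unfolding top by (subst Lp_enorm_top_le_iff) (auto simp: powr_minus less_imp_le)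
next
  case (real r)
  show ?thesis
  \<comment> \<open>The bound \<open>c\<close> below must be positive, so norm zero is treated
    apart.\<close>
  proof (cases "Lp_enorm M p f = 0")
    case True
    then have "AE z in M. f z = 0"
      by (intro Lp_enorm_eq_0D[OF p]) auto
    then have "AE y in M. f y * k (- y + x) = 0" for x
      by eventually_elim simp
    then have "(\<integral>\<^sup>+y. f y * k (- y + x) \<partial>M) = 0" for x
      by (subst nn_integral_0_iff_AE) auto
    then show ?thesis by (simp add: p)
  next
    case False
    then obtain \<phi> where \<phi>: "Lp_enorm M p f = ennreal \<phi>" "0 < \<phi>"
      using fin by (cases "Lp_enorm M p f") (auto simp: less_le)
    define c where "c z = \<phi> * \<Delta> z powr (1 / r)" for z
    have c_pos: "0 < c z" for z
      using \<phi> modular_pos[of z] by (simp add: c_def)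
    have [measurable]: "c \<in> borel_measurable M"
      unfolding c_def by measurable
    \<comment> \<open>Kernel and modular factor go into the measure, which leaves the bare
      translates of \<open>f\<close> as integrand.\<close>
    define N where "N = density M (\<lambda>z. k z * ennreal (inverse (\<Delta> z)))"
    have [measurable_cong]: "sets N = sets M" by (simp add: N_def)
    have dens: "(\<integral>\<^sup>+z. h z \<partial>N) = (\<integral>\<^sup>+z. k z * ennreal (inverse (\<Delta> z)) * h z \<partial>M)"
      if [measurable]: "h \<in> borel_measurable M" for h
      unfolding N_def by (rule nn_integral_density) measurable
    have fr: "(\<integral>\<^sup>+x. ennreal_powr (f x) r \<partial>M) = ennreal (\<phi> powr r)"
      using Lp_enorm_ennreal_powr[of r M f] \<phi> real by (simp add: ennreal_powr_ennreal)
    have swap_m: "(\<lambda>(x, z). k z * ennreal (inverse (\<Delta> z)) * (ennreal_powr (f (x + - z)) r * ennreal (c z powr (1 - r))))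
        \<in> borel_measurable borel_prod"
      unfolding split_beta' by measurable
    have "(\<integral>\<^sup>+x. ennreal_powr (\<integral>\<^sup>+z. f (x + - z) \<partial>N) r \<partial>M)
      \<le> ennreal_powr (\<integral>\<^sup>+z. ennreal (c z) \<partial>N) r"
    proof (rule nn_integral_powr_Minkowski[OF \<open>1 \<le> r\<close>])
      fix z
      have "(\<integral>\<^sup>+x. ennreal_powr (f (x + - z)) r \<partial>M) = ennreal (\<Delta> z) * ennreal (\<phi> powr r)"
        using nn_integral_right_translation[of "\<lambda>x. ennreal_powr (f x) r" "- z"] by (simp add: fr)
      also have "\<dots> = ennreal (c z powr r)"
        using \<phi> modular_pos[of z] real
        by (simp add: c_def powr_mult powr_powr ennreal_mult[symmetric] less_imp_le mult.commute)
      finally show "(\<integral>\<^sup>+x. ennreal_powr (f (x + - z)) r \<partial>M) \<le> ennreal (c z powr r)" by simp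
    next
      have eq: "(\<integral>\<^sup>+z. ennreal_powr (f (x + - z)) r * ennreal (c z powr (1 - r)) \<partial>N)
        = (\<integral>\<^sup>+z. k z * ennreal (inverse (\<Delta> z)) * (ennreal_powr (f (x + - z)) r * ennreal (c z powr (1 - r))) \<partial>M)" for x
        by (rule dens) measurable
      show "(\<lambda>x. \<integral>\<^sup>+z. ennreal_powr (f (x + - z)) r * ennreal (c z powr (1 - r)) \<partial>N) \<in> borel_measurable M"
        unfolding eq by (rule measurable_nn_integral_Borel[OF swap_m])
      have "(\<integral>\<^sup>+z. \<integral>\<^sup>+x. ennreal_powr (f (x + - z)) r * ennreal (c z powr (1 - r)) \<partial>M \<partial>N)
        = (\<integral>\<^sup>+z. k z * ennreal (inverse (\<Delta> z)) * (\<integral>\<^sup>+x. ennreal_powr (f (x + - z)) r * ennreal (c z powr (1 - r)) \<partial>M) \<partial>M)"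
        by (intro dens measurable_nn_integral_Borel) (simp add: split_beta')
      also have "\<dots> = (\<integral>\<^sup>+z. \<integral>\<^sup>+x. k z * ennreal (inverse (\<Delta> z)) * (ennreal_powr (f (x + - z)) r * ennreal (c z powr (1 - r))) \<partial>M \<partial>M)"
        by (intro nn_integral_cong nn_integral_cmult[symmetric]) measurable
      finally show "(\<integral>\<^sup>+x. \<integral>\<^sup>+z. ennreal_powr (f (x + - z)) r * ennreal (c z powr (1 - r)) \<partial>N \<partial>M)
        = (\<integral>\<^sup>+z. \<integral>\<^sup>+x. ennreal_powr (f (x + - z)) r * ennreal (c z powr (1 - r)) \<partial>M \<partial>N)"
        unfolding eq using Fubini_nn_integral[OF swap_m] by simp
    qed (use c_pos in measurable)
    then have "Lp_enorm M p (\<lambda>x. \<integral>\<^sup>+z. f (x + - z) \<partial>N) \<le> (\<integral>\<^sup>+z. ennreal (c z) \<partial>N)"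
      using real by (simp add: Lp_enorm_ennreal_le_iff)
    also have "(\<lambda>x. \<integral>\<^sup>+z. f (x + - z) \<partial>N) = (\<lambda>x. \<integral>\<^sup>+y. f y * k (- y + x) \<partial>M)"
    proof
      fix x
      have "(\<integral>\<^sup>+z. f (x + - z) \<partial>N) = (\<integral>\<^sup>+z. k z * ennreal (inverse (\<Delta> z)) * f (x + - z) \<partial>M)"
        by (rule dens) measurable
      then show "(\<integral>\<^sup>+z. f (x + - z) \<partial>N) = (\<integral>\<^sup>+y. f y * k (- y + x) \<partial>M)"
        by (simp only: nn_convolution_alt[OF assms(2,3)] mult_ac)
    qed
    also have "(\<integral>\<^sup>+z. ennreal (c z) \<partial>N) = (\<integral>\<^sup>+z. k z * ennreal (inverse (\<Delta> z)) * ennreal (c z) \<partial>M)"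
      by (rule dens) measurable
    also have "\<dots> = (\<integral>\<^sup>+z. ennreal \<phi> * (k z * ennreal (\<Delta> z powr (1 / r - 1))) \<partial>M)"
    proof (intro nn_integral_cong)
      fix z
      have "inverse (\<Delta> z) * c z = \<phi> * \<Delta> z powr (1 / r - 1)"
        using modular_pos[of z] by (simp add: c_def powr_diff field_simps)
      then have "ennreal (inverse (\<Delta> z)) * ennreal (c z) = ennreal \<phi> * ennreal (\<Delta> z powr (1 / r - 1))"
        using modular_pos[of z] \<phi> c_pos[of z] by (simp add: ennreal_mult[symmetric])
      then show "k z * ennreal (inverse (\<Delta> z)) * ennreal (c z) = ennreal \<phi> * (k z * ennreal (\<Delta> z powr (1 / r - 1)))"
        by (simp add: mult.assoc mult.left_commute)
    qed
    also have "\<dots> = Lp_enorm M p f * (\<integral>\<^sup>+z. k z * ennreal (\<Delta> z powr (enn2real (inverse p) - 1)) \<partial>M)"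
      unfolding \<phi>(1) using real by (simp add: nn_integral_cmult inverse_ennreal inverse_eq_divide)
    finally show ?thesis .
  qed
qed

lemma Lp_enorm_left_translation:
  assumes p: "1 \<le> p" and [measurable]: "h \<in> borel_measurable M"
  shows "Lp_enorm M p (\<lambda>y. h (x + y)) \<le> Lp_enorm M p h"
  using p
proof (cases rule: exponent_cases)
  case top
  have "AE z in M. h z \<le> Lp_enorm M top h"
    using Lp_enorm_top_le_iff[of h M "Lp_enorm M top h"] by auto
  then have "AE z in M. h (x + z) \<le> Lp_enorm M top h"
    by (rule AE_left_translation)
  then show ?thesis
    unfolding top by (subst Lp_enorm_top_le_iff) auto
next
  case (real r)
  then show ?thesis
    using nn_integral_left_translation[of "\<lambda>z. ennreal_powr (h z) r" x] by (simp add: Lp_enorm_ennreal)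
qed

lemma integral_left_translation:
  fixes f :: "'a \<Rightarrow> complex"
  assumes [measurable]: "f \<in> borel_measurable M"
  shows "(LINT x|M. f (y + x)) = (LINT x|M. f x)"
  by (subst distr_left_translation[of y, symmetric]) (simp add: integral_distr)

end

section \<open>Moderate weights and their control weights\<close>

locale controlled_weight = haar_group M \<Delta>
  for M :: "'a::{topological_group_add, t2_space} measure" and \<Delta> +
  fixes p q :: ennreal and m w :: "'a \<Rightarrow> real"
  assumes p: "1 \<le> p" and conj: "inverse p + inverse q = 1"
    and moderate: "moderate_weight M m" and control: "control_weight M \<Delta> p q m w"
begin

abbreviation "Lp_norm \<equiv> weighted_Lp_norm M p m"

lemma m_measurable [measurable]: "m \<in> borel_measurable M" and m_pos: "0 < m x"
  using moderate by (auto simp: moderate_weight_def weight_def)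

lemma w_submult: "submultiplicative_weight M w"
  using control by (simp add: control_weight_def)

lemma w_measurable [measurable]: "w \<in> borel_measurable M" and w_pos: "0 < w x"
  using w_submult by (auto simp: submultiplicative_weight_def weight_def)

lemma m_le_alpha0: "m (y + x) \<le> alpha0 m y * m x"
proof -
  have "m (y + x) / m x \<le> alpha0 m y"
    unfolding alpha0_def using moderate by (intro cSUP_upper) (auto simp: moderate_weight_def)
  then show ?thesis using m_pos[of x] by (simp add: divide_le_eq)
qed

lemma m_le_beta0: "m (x + y) \<le> m x * beta0 m y"
proof -
  have "m (x + y) / m x \<le> beta0 m y"
    unfolding beta0_def using moderate by (intro cSUP_upper) (auto simp: moderate_weight_def)
  then show ?thesis using m_pos[of x] by (simp add: divide_le_eq mult.commute)
qed

lemma alpha0_pos: "0 < alpha0 m y"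
  using m_le_alpha0[of y 0] m_pos[of "y + 0"] m_pos[of 0] by (smt (verit) mult_nonpos_nonneg)

text \<open>Young's inequality brings the factor \<open>\<Delta> z powr (1 / p - 1)\<close>; the
  power \<open>1 / q\<close> cancels it and exactly \<open>w z\<close> remains.\<close>

lemma m_le_right: "m (x + z) \<le> m x * (w z * \<Delta> z powr enn2real (inverse q))"
proof -
  have "beta0 m z * \<Delta> z powr (- enn2real (inverse q)) \<le> w z"
    using control by (auto simp: control_weight_def)
  then have "beta0 m z \<le> w z * \<Delta> z powr enn2real (inverse q)"
    using modular_pos[of z] by (simp add: powr_minus field_simps)
  then show ?thesis
    using m_le_beta0[of x z] m_pos[of x] by (meson less_imp_le mult_left_mono order_trans)
qed

text \<open>The counterpart for a reflected kernel. Together with the factor from Young's inequality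
  the power of \<open>\<Delta> z\<close> is \<open>- 1\<close>, which is absorbed when
  \<open>z\<close> is replaced by \<open>- z\<close> in the integral.\<close>

lemma m_le_right_minus: "m (x + z) \<le> m x * (w (- z) * \<Delta> z powr (- enn2real (inverse p)))"
proof -
  have "beta0 m (- (- z)) * \<Delta> (- z) powr (- enn2real (inverse p)) \<le> w (- z)"
    using control by (auto simp: control_weight_def simp del: minus_minus)
  then have "beta0 m z \<le> w (- z) * \<Delta> z powr (- enn2real (inverse p))"
    using modular_pos[of z]
    by (simp add: modular_minus powr_minus_divide powr_divide inverse_eq_divide field_simps)
  then show ?thesis
    using m_le_beta0[of x z] m_pos[of x] by (meson less_imp_le mult_left_mono order_trans)
qed

lemma moderate_on_compact:
  assumes C: "compact C"
  obtains B where "0 < B" "\<And>x z. z \<in> C \<Longrightarrow> m (x + z) \<le> B * m x"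
proof -
  obtain B1 where B1: "\<And>z. z \<in> C \<Longrightarrow> w z \<le> B1"
    using submultiplicative_bounded_on_compact[OF w_submult C] by blast
  obtain B2 where B2: "\<And>z. z \<in> C \<Longrightarrow> \<Delta> z \<le> B2"
    using modular_bounded_on_compact[OF C] by blast
  \<comment> \<open>The 1 keeps \<open>B\<close> positive also when \<open>C\<close> is
    empty.\<close>
  define B where "B = max 1 (B1 * B2 powr enn2real (inverse q))"
  have "m (x + z) \<le> B * m x" if "z \<in> C" for x z
  proof -
    have "w z * \<Delta> z powr enn2real (inverse q) \<le> B1 * B2 powr enn2real (inverse q)"
      using B1[OF that] B2[OF that] w_pos[of z] modular_pos[of z]
      by (intro mult_mono powr_mono2) auto
    also have "\<dots> \<le> B" by (simp add: B_def)
    finally have "m x * (w z * \<Delta> z powr enn2real (inverse q)) \<le> m x * B"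
      using m_pos[of x] by (intro mult_left_mono) auto
    then show ?thesis using m_le_right[of x z] by (simp add: mult.commute)
  qed
  moreover have "0 < B" by (simp add: B_def)
  ultimately show ?thesis by (intro that)
qed

text \<open>The inequality \<open>m x \<le> m y * b (- y + x)\<close> distributes the weight over
  the two factors of the convolution, and the unweighted Young inequality applies to
  \<open>f\<close> times \<open>m\<close> and \<open>h\<close> times \<open>b\<close>.\<close>

lemma weighted_convolution_bound:
  fixes b :: "'a \<Rightarrow> real"
  assumes [measurable]: "f \<in> borel_measurable M" "h \<in> borel_measurable M" "b \<in> borel_measurable M"
    and b: "\<And>x z. m (x + z) \<le> m x * b z"
    and fin: "Lp_enorm M p (\<lambda>x. f x * ennreal (m x)) < top"
  shows "Lp_enorm M p (\<lambda>x. (\<integral>\<^sup>+y. f y * h (- y + x) \<partial>M) * ennreal (m x))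
    \<le> Lp_enorm M p (\<lambda>x. f x * ennreal (m x)) *
       (\<integral>\<^sup>+z. h z * ennreal (b z) * ennreal (\<Delta> z powr (enn2real (inverse p) - 1)) \<partial>M)"
proof -
  have b_nn: "0 \<le> b z" for z
    using b[of 0 z] m_pos[of "0 + z"] m_pos[of 0] by (smt (verit) mult_pos_neg)
  have "(\<integral>\<^sup>+y. f y * h (- y + x) \<partial>M) * ennreal (m x)
      \<le> (\<integral>\<^sup>+y. (f y * ennreal (m y)) * (h (- y + x) * ennreal (b (- y + x))) \<partial>M)" for x
  proof -
    have "(\<integral>\<^sup>+y. f y * h (- y + x) \<partial>M) * ennreal (m x) = (\<integral>\<^sup>+y. f y * h (- y + x) * ennreal (m x) \<partial>M)"
      by (rule nn_integral_multc[symmetric]) measurable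
    also have "\<dots> \<le> (\<integral>\<^sup>+y. (f y * ennreal (m y)) * (h (- y + x) * ennreal (b (- y + x))) \<partial>M)"
    proof (rule nn_integral_mono)
      fix y
      have "m x \<le> m y * b (- y + x)"
        using b[of y "- y + x"] by (simp add: add.assoc[symmetric])
      then have "ennreal (m x) \<le> ennreal (m y) * ennreal (b (- y + x))"
        using m_pos[of y] b_nn by (simp add: ennreal_mult[symmetric] ennreal_leI)
      then have "f y * h (- y + x) * ennreal (m x) \<le> f y * h (- y + x) * (ennreal (m y) * ennreal (b (- y + x)))"
        by (rule mult_left_mono) simp
      then show "f y * h (- y + x) * ennreal (m x) \<le> (f y * ennreal (m y)) * (h (- y + x) * ennreal (b (- y + x)))"
        by (simp only: mult_ac)
    qed
    finally show ?thesis .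
  qed
  then have "Lp_enorm M p (\<lambda>x. (\<integral>\<^sup>+y. f y * h (- y + x) \<partial>M) * ennreal (m x))
    \<le> Lp_enorm M p (\<lambda>x. \<integral>\<^sup>+y. (f y * ennreal (m y)) * (h (- y + x) * ennreal (b (- y + x))) \<partial>M)"
    by (intro Lp_enorm_mono_AE p AE_I2) measurable
  also have "\<dots> \<le> Lp_enorm M p (\<lambda>x. f x * ennreal (m x)) *
       (\<integral>\<^sup>+z. h z * ennreal (b z) * ennreal (\<Delta> z powr (enn2real (inverse p) - 1)) \<partial>M)"
    using fin by (intro Lp_enorm_nn_convolution[where k = "\<lambda>z. h z * ennreal (b z)"] p) measurable
  finally show ?thesis .
qed

lemma weighted_convolution_right:
  assumes [measurable]: "f \<in> borel_measurable M" "h \<in> borel_measurable M"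
    and fin: "Lp_enorm M p (\<lambda>x. f x * ennreal (m x)) < top"
  shows "Lp_enorm M p (\<lambda>x. (\<integral>\<^sup>+y. f y * h (- y + x) \<partial>M) * ennreal (m x))
    \<le> Lp_enorm M p (\<lambda>x. f x * ennreal (m x)) * (\<integral>\<^sup>+z. h z * ennreal (w z) \<partial>M)"
proof -
  have "enn2real (inverse q) + (enn2real (inverse p) - 1) = 0"
    using enn2real_inverse_conjugate[OF conj] by simp
  then have "ennreal (w z * \<Delta> z powr enn2real (inverse q)) * ennreal (\<Delta> z powr (enn2real (inverse p) - 1)) = ennreal (w z)" for z
    using modular_pos[of z] w_pos[of z]
    by (simp add: ennreal_mult[symmetric] mult.assoc powr_add[symmetric] less_imp_le)
  then show ?thesis
    using weighted_convolution_bound[OF assms(1,2) _ m_le_right fin] by (simp add: mult.assoc)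
qed

text \<open>A convolution with the reflection of \<open>h\<close>, the form in which the oscillation
  of \<open>G\<close> appears.\<close>

lemma weighted_convolution_right_minus:
  assumes [measurable]: "f \<in> borel_measurable M" "h \<in> borel_measurable M"
    and fin: "Lp_enorm M p (\<lambda>x. f x * ennreal (m x)) < top"
  shows "Lp_enorm M p (\<lambda>x. (\<integral>\<^sup>+y. f y * h (- x + y) \<partial>M) * ennreal (m x))
    \<le> Lp_enorm M p (\<lambda>x. f x * ennreal (m x)) * (\<integral>\<^sup>+z. h z * ennreal (w z) \<partial>M)"
proof -
  have "ennreal (w (- z) * \<Delta> z powr (- enn2real (inverse p))) * ennreal (\<Delta> z powr (enn2real (inverse p) - 1))
      = ennreal (w (- z)) * ennreal (\<Delta> (- z))" for z
    using modular_pos[of z] w_pos[of "- z"]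
    by (simp add: ennreal_mult[symmetric] mult.assoc powr_add[symmetric] less_imp_le modular_minus)
       (simp add: powr_minus divide_inverse)
  then have "(\<integral>\<^sup>+z. h (- z) * ennreal (w (- z) * \<Delta> z powr (- enn2real (inverse p))) *
        ennreal (\<Delta> z powr (enn2real (inverse p) - 1)) \<partial>M)
      = (\<integral>\<^sup>+z. h (- z) * ennreal (w (- z)) * ennreal (\<Delta> (- z)) \<partial>M)"
    by (simp add: mult.assoc)
  also have "\<dots> = (\<integral>\<^sup>+z. h z * ennreal (w z) \<partial>M)"
    by (rule nn_integral_minus_modular) measurable
  finally have eq: "(\<integral>\<^sup>+z. h (- z) * ennreal (w (- z) * \<Delta> z powr (- enn2real (inverse p))) *
        ennreal (\<Delta> z powr (enn2real (inverse p) - 1)) \<partial>M) = (\<integral>\<^sup>+z. h z * ennreal (w z) \<partial>M)" .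
  have "Lp_enorm M p (\<lambda>x. (\<integral>\<^sup>+y. f y * h (- (- y + x)) \<partial>M) * ennreal (m x))
    \<le> Lp_enorm M p (\<lambda>x. f x * ennreal (m x)) *
      (\<integral>\<^sup>+z. h (- z) * ennreal (w (- z) * \<Delta> z powr (- enn2real (inverse p))) *
        ennreal (\<Delta> z powr (enn2real (inverse p) - 1)) \<partial>M)"
    by (rule weighted_convolution_bound[where h = "\<lambda>z. h (- z)", OF _ _ _ m_le_right_minus fin]) measurable
  then show ?thesis
    unfolding eq by (simp add: minus_add)
qed

lemma Lp_norm_eq:
  "Lp_norm F = Lp_enorm M p (\<lambda>x. ennreal (cmod (F x)) * ennreal (m x))"
  using m_pos by (simp add: weighted_Lp_norm_def ennreal_mult less_imp_le)

lemma Lp_D: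
  assumes "F \<in> weighted_Lp M p m"
  shows "F \<in> borel_measurable M" "Lp_enorm M p (\<lambda>x. ennreal (cmod (F x)) * ennreal (m x)) < top"
  using assms by (simp_all add: weighted_Lp_def Lp_norm_eq)

lemmas Lp_space =
  weighted_Lp_norm_add[OF p m_measurable m_pos] weighted_Lp_norm_cmult[OF p m_measurable m_pos]
  weighted_Lp_add[OF p m_measurable m_pos] weighted_Lp_cmult[OF p m_measurable m_pos]
  weighted_Lp_zero[OF p m_measurable m_pos] weighted_Lp_diff[OF p m_measurable m_pos]

end

section \<open>Reconstruction operators by Neumann iteration\<close>

text \<open>\<open>T\<close>, which is \<open>S\<close> after \<open>E\<close>, is close to the
  identity and hence bijective on \<open>B\<close>; \<open>R\<close> is its inverse following
  \<open>S\<close>. The equation \<open>T f = h\<close> is solved for each \<open>h\<close>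
  separately; linearity and boundedness of the inverse then come from uniqueness and from the lower
  bound on \<open>T\<close>.\<close>

lemma neumann_left_inverse:
  fixes B :: "('s \<Rightarrow> complex) set" and Bd :: "('t \<Rightarrow> complex) set"
  assumes banach: "is_banach_fun_space B N"
    and S: "is_bounded_operator Bd Nd B N S"
    and E: "is_bounded_operator B N Bd Nd E"
    and \<kappa>: "0 \<le> \<kappa>" "\<kappa> < 1"
    and contr: "\<And>f. f \<in> B \<Longrightarrow> N (\<lambda>s. f s - S (E f) s) \<le> ennreal \<kappa> * N f"
  shows "\<exists>R. is_bounded_operator Bd Nd B N R \<and> (\<forall>f\<in>B. R (E f) = f)"
proof -
  define T where "T f = S (E f)" for f
  have add: "(\<lambda>s. f s + g s) \<in> B" and tri: "N (\<lambda>s. f s + g s) \<le> N f + N g" if "f \<in> B" "g \<in> B" for f g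
    using banach that by (auto simp: is_banach_fun_space_def is_normed_fun_space_def)
  have cmult: "(\<lambda>s. c * f s) \<in> B" and Ncmult: "N (\<lambda>s. c * f s) = ennreal (cmod c) * N f" if "f \<in> B" for c f
    using banach that by (auto simp: is_banach_fun_space_def is_normed_fun_space_def)
  have zero: "(\<lambda>s. 0) \<in> B"
    using banach by (auto simp: is_banach_fun_space_def is_normed_fun_space_def)
  have fin: "N f < top" if "f \<in> B" for f
    using banach that by (auto simp: is_banach_fun_space_def is_normed_fun_space_def)
  have N0: "f = (\<lambda>s. 0)" if "f \<in> B" "N f = 0" for f
    using banach that by (auto simp: is_banach_fun_space_def is_normed_fun_space_def)
  have diff: "(\<lambda>s. f s - g s) \<in> B" and tri_diff: "N (\<lambda>s. f s - g s) \<le> N f + N g"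
    if "f \<in> B" "g \<in> B" for f g
    using add[OF that(1) cmult[OF that(2), of "-1"]] tri[OF that(1) cmult[OF that(2), of "-1"]]
      Ncmult[OF that(2), of "-1"] by simp_all
  have commute: "N (\<lambda>s. f s - g s) = N (\<lambda>s. g s - f s)" if "f \<in> B" "g \<in> B" for f g
    using Ncmult[OF diff[OF that], of "-1"] by simp
  have T: "T f \<in> B" if "f \<in> B" for f
    using S E that by (auto simp: T_def is_bounded_operator_def)
  have Tadd: "T (\<lambda>s. f s + g s) = (\<lambda>s. T f s + T g s)" if "f \<in> B" "g \<in> B" for f g
    using S E that by (auto simp: T_def is_bounded_operator_def)
  have Tcmult: "T (\<lambda>s. c * f s) = (\<lambda>s. c * T f s)" if "f \<in> B" for c f
    using S E that by (auto simp: T_def is_bounded_operator_def)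
  have Tdiff: "T (\<lambda>s. f s - g s) = (\<lambda>s. T f s - T g s)" if "f \<in> B" "g \<in> B" for f g
    using Tadd[OF that(1) cmult[OF that(2), of "-1"]] Tcmult[OF that(2), of "-1"] by simp
  have contr: "N (\<lambda>s. f s - T f s) \<le> ennreal \<kappa> * N f" if "f \<in> B" for f
    using contr[OF that] by (simp add: T_def)
  \<comment> \<open>This one estimate gives injectivity, the Cauchy property of the iterates and the
    norm bound for the inverse.\<close>
  have lower: "N f \<le> ennreal (1 / (1 - \<kappa>)) * N (T f)" if f: "f \<in> B" for f
  proof -
    obtain a b where ab: "N f = ennreal a" "N (T f) = ennreal b" "0 \<le> a" "0 \<le> b"
      using fin[OF f] fin[OF T[OF f]] by (metis ennreal_cases less_irrefl)
    have "N f \<le> N (\<lambda>s. f s - T f s) + N (T f)"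
      using tri[OF diff[OF f T[OF f]] T[OF f]] by simp
    also have "\<dots> \<le> ennreal \<kappa> * N f + N (T f)"
      by (intro add_mono contr f order_refl)
    finally have "a \<le> \<kappa> * a + b"
      using ab \<kappa> by (simp add: ennreal_mult[symmetric] ennreal_plus[symmetric] del: ennreal_plus)
    then have "a \<le> 1 / (1 - \<kappa>) * b"
      using \<kappa> by (simp add: field_simps)
    then show ?thesis
      using ab \<kappa> by (simp add: ennreal_mult[symmetric] ennreal_leI)
  qed
  have upper: "N (T f) \<le> ennreal (1 + \<kappa>) * N f" if f: "f \<in> B" for f
  proof -
    have "N (T f) \<le> N f + N (\<lambda>s. f s - T f s)"
      using tri_diff[OF f diff[OF f T[OF f]]] by simp
    also have "\<dots> \<le> N f + ennreal \<kappa> * N f"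
      by (intro add_mono contr f order_refl)
    also have "\<dots> = ennreal (1 + \<kappa>) * N f"
      using \<kappa> by (simp add: distrib_right)
    finally show ?thesis .
  qed
  have inj: "f = g" if "f \<in> B" "g \<in> B" "T f = T g" for f g
  proof -
    have "N (T (\<lambda>s. f s - g s)) = 0"
      using that zero Ncmult[OF zero, of 0] by (simp add: Tdiff)
    then have "N (\<lambda>s. f s - g s) = 0"
      using lower[OF diff[OF that(1,2)]] by simp
    then show ?thesis
      using N0[OF diff[OF that(1,2)]] by (auto simp: fun_eq_iff)
  qed
  have surj: "\<exists>f\<in>B. T f = h" if h: "h \<in> B" for h
  proof -
    \<comment> \<open>\<open>r n\<close> is the residual \<open>h - T (F n)\<close>, the
      \<open>n\<close>-th power of the identity minus \<open>T\<close> applied to \<open>h\<close>;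
      its sums \<open>F n\<close> are the partial sums of the Neumann series.\<close>
    define r where "r = rec_nat h (\<lambda>n g s. g s - T g s)"
    have r0: "r 0 = h" and rS: "r (Suc n) = (\<lambda>s. r n s - T (r n) s)" for n
      by (simp_all add: r_def)
    define F where "F = rec_nat (\<lambda>s. 0) (\<lambda>n g s. g s + r n s)"
    have F0: "F 0 = (\<lambda>s. 0)" and FS: "F (Suc n) = (\<lambda>s. F n s + r n s)" for n
      by (simp_all add: F_def)
    have rB: "r n \<in> B" for n
      by (induction n) (auto simp: r0 rS h diff T)
    have FB: "F n \<in> B" for n
      by (induction n) (auto simp: F0 FS zero add rB)
    have TF: "T (F n) = (\<lambda>s. h s - r n s)" for n
    proof (induction n)
      case 0
      show ?case using Tcmult[OF zero, of 0] by (simp add: F0 r0)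
    next
      case (Suc n)
      then show ?case by (simp add: FS Tadd[OF FB rB] rS algebra_simps)
    qed
    have Nr: "N (r n) \<le> ennreal (\<kappa> ^ n) * N h" for n
    proof (induction n)
      case (Suc n)
      have "N (r (Suc n)) \<le> ennreal \<kappa> * N (r n)"
        unfolding rS by (rule contr[OF rB])
      also have "\<dots> \<le> ennreal \<kappa> * (ennreal (\<kappa> ^ n) * N h)"
        by (intro mult_left_mono Suc) simp
      finally show ?case
        using \<kappa> by (simp add: ennreal_mult mult.assoc)
    qed (simp add: r0)
    have lim: "(\<lambda>n. ennreal c * (ennreal (\<kappa> ^ n) * N h)) \<longlonglongrightarrow> 0" if "0 \<le> c" for c
    proof -
      obtain b where b: "N h = ennreal b" "0 \<le> b"
        using fin[OF h] by (cases "N h") auto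
      have "(\<lambda>n. ennreal (c * (\<kappa> ^ n * b))) \<longlonglongrightarrow> ennreal (c * (0 * b))"
        using \<kappa> by (intro tendsto_ennrealI tendsto_mult tendsto_const LIMSEQ_power_zero) auto
      then show ?thesis
        using b \<kappa> that by (simp add: ennreal_mult)
    qed
    have "\<exists>n0. \<forall>k\<ge>n0. \<forall>n\<ge>n0. N (\<lambda>s. F k s - F n s) < e" if e: "0 < e" for e
    proof -
      have "eventually (\<lambda>n. ennreal (2 / (1 - \<kappa>)) * (ennreal (\<kappa> ^ n) * N h) < e) sequentially"
        using \<kappa> e by (intro order_tendstoD(2)[OF lim]) auto
      then obtain n0 where n0: "ennreal (2 / (1 - \<kappa>)) * (ennreal (\<kappa> ^ n0) * N h) < e"
        by (auto simp: eventually_sequentially)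
      have "N (\<lambda>s. F k s - F n s) < e" if "n0 \<le> k" "n0 \<le> n" for k n
      proof -
        have Nr0: "N (r k) \<le> ennreal (\<kappa> ^ n0) * N h" if "n0 \<le> k" for k
          using that \<kappa> by (intro order_trans[OF Nr] mult_right_mono ennreal_leI power_decreasing) auto
        \<comment> \<open>The lower bound transfers smallness from the difference of residuals to
          the difference of iterates.\<close>
        have "N (\<lambda>s. F k s - F n s) \<le> ennreal (1 / (1 - \<kappa>)) * N (T (\<lambda>s. F k s - F n s))"
          by (rule lower[OF diff[OF FB FB]])
        also have "T (\<lambda>s. F k s - F n s) = (\<lambda>s. r n s - r k s)"
          by (simp add: Tdiff[OF FB FB] TF)
        also have "N (\<lambda>s. r n s - r k s) \<le> N (r n) + N (r k)"
          by (rule tri_diff[OF rB rB])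
        also have "\<dots> \<le> ennreal (\<kappa> ^ n0) * N h + ennreal (\<kappa> ^ n0) * N h"
          by (intro add_mono Nr0 that)
        also have "\<dots> = ennreal 2 * (ennreal (\<kappa> ^ n0) * N h)"
          by (simp add: mult_2)
        finally have "N (\<lambda>s. F k s - F n s) \<le> ennreal (1 / (1 - \<kappa>)) * (ennreal 2 * (ennreal (\<kappa> ^ n0) * N h))"
          by (simp add: mult_left_mono)
        also have "\<dots> = ennreal (2 / (1 - \<kappa>)) * (ennreal (\<kappa> ^ n0) * N h)"
        proof -
          have "ennreal (1 / (1 - \<kappa>)) * ennreal 2 = ennreal (2 / (1 - \<kappa>))"
            using \<kappa> by (subst ennreal_mult[symmetric]) auto
          then show ?thesis by (simp only: mult.assoc[symmetric])
        qed
        finally show ?thesis using n0 by simp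
      qed
      then show ?thesis by blast
    qed
    then have "\<exists>f\<in>B. (\<lambda>n. N (\<lambda>s. F n s - f s)) \<longlonglongrightarrow> 0"
      using banach FB unfolding is_banach_fun_space_def by blast
    then obtain f where f: "f \<in> B" "(\<lambda>n. N (\<lambda>s. F n s - f s)) \<longlonglongrightarrow> 0"
      by blast
    have "N (\<lambda>s. T f s - h s) \<le> ennreal (1 + \<kappa>) * N (\<lambda>s. F n s - f s) + ennreal 1 * (ennreal (\<kappa> ^ n) * N h)" for n
    proof -
      have eq: "(\<lambda>s. T f s - h s) = (\<lambda>s. T (\<lambda>s. f s - F n s) s - r n s)"
        by (simp add: Tdiff[OF f(1) FB] TF)
      have "N (\<lambda>s. T f s - h s) \<le> N (T (\<lambda>s. f s - F n s)) + N (r n)"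
        unfolding eq by (intro tri_diff T diff f FB rB)
      also have "\<dots> \<le> ennreal (1 + \<kappa>) * N (\<lambda>s. f s - F n s) + ennreal (\<kappa> ^ n) * N h"
        by (intro add_mono Nr upper diff f FB)
      finally show ?thesis by (simp add: commute[OF f(1) FB])
    qed
    moreover have "(\<lambda>n. ennreal (1 + \<kappa>) * N (\<lambda>s. F n s - f s) + ennreal 1 * (ennreal (\<kappa> ^ n) * N h))
        \<longlonglongrightarrow> ennreal (1 + \<kappa>) * 0 + 0"
      by (intro tendsto_add ennreal_tendsto_cmult f lim) auto
    ultimately have "N (\<lambda>s. T f s - h s) \<le> ennreal (1 + \<kappa>) * 0 + 0"
      by (intro LIMSEQ_le_const) auto
    then have "(\<lambda>s. T f s - h s) = (\<lambda>s. 0)"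
      by (intro N0 diff T f h) simp
    then have "T f = h" by (auto simp: fun_eq_iff)
    with f show ?thesis by blast
  qed
  \<comment> \<open>The inverse of \<open>T\<close> at \<open>S c\<close>. For
    \<open>c = E f\<close> the equation to be solved has the right-hand side \<open>T f\<close>,
    hence the solution \<open>f\<close>.\<close>
  define R where "R c = (THE f. f \<in> B \<and> T f = S c)" for c
  have R: "R c = f" if "f \<in> B" "T f = S c" for c f
    unfolding R_def using that inj by (intro the_equality) auto
  have SB: "S c \<in> B" if "c \<in> Bd" for c
    using S that by (auto simp: is_bounded_operator_def)
  have RB: "R c \<in> B \<and> T (R c) = S c" if "c \<in> Bd" for c
    using surj[OF SB[OF that]] R by blast
  obtain C where C: "\<And>c. c \<in> Bd \<Longrightarrow> N (S c) \<le> ennreal C * Nd c"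
    using S unfolding is_bounded_operator_def by blast
  have "is_bounded_operator Bd Nd B N R"
    unfolding is_bounded_operator_def
  proof (intro conjI ballI allI exI)
    fix c d assume cd: "c \<in> Bd" "d \<in> Bd"
    show "R (\<lambda>s. c s + d s) = (\<lambda>t. R c t + R d t)"
      using RB[OF cd(1)] RB[OF cd(2)] S cd
      by (intro R) (auto simp: add Tadd is_bounded_operator_def)
  next
    fix c a assume c: "c \<in> Bd"
    show "R (\<lambda>s. a * c s) = (\<lambda>t. a * R c t)"
      using RB[OF c] S c by (intro R) (auto simp: cmult Tcmult is_bounded_operator_def)
  next
    fix c assume c: "c \<in> Bd"
    show "R c \<in> B" using RB[OF c] by simp
    have "N (R c) \<le> ennreal (1 / (1 - \<kappa>)) * N (T (R c))"
      using RB[OF c] by (intro lower) simp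
    also have "\<dots> \<le> ennreal (1 / (1 - \<kappa>)) * (ennreal C * Nd c)"
      using RB[OF c] C[OF c] by (intro mult_left_mono) auto
    \<comment> \<open>\<open>C\<close> may be negative, which \<open>ennreal\<close> reads as 0, so
      only the first factor is known to be nonnegative.\<close>
    also have "\<dots> = ennreal (1 / (1 - \<kappa>) * C) * Nd c"
      using \<kappa> by (subst ennreal_mult'[of "1 / (1 - \<kappa>)"]) (simp_all add: mult.assoc)
    finally show "N (R c) \<le> ennreal (1 / (1 - \<kappa>) * C) * Nd c" .
  qed
  moreover have "R (E f) = f" if "f \<in> B" for f
    using that by (intro R) (simp_all add: T_def)
  ultimately show ?thesis by blast
qed

section \<open>The reproducing kernel space\<close>

locale reproducing_kernel = controlled_weight M \<Delta> p q m w
  for M :: "'a::{topological_group_add, t2_space} measure" and \<Delta> p q m w +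
  fixes G :: "'a \<Rightarrow> complex"
  assumes G_L1: "G \<in> weighted_Lp M 1 w" and G_Lq: "G \<in> weighted_Lp M q (\<lambda>y. 1 / m y)"
    and G_involution: "AE y in M. G y = involution G y"
    and G_idem: "AE y in M. G y = convolution M G G y"
begin

abbreviation "repr \<equiv> repr_space M p m G"

lemma G_measurable [measurable]: "G \<in> borel_measurable M"
  using G_L1 by (simp add: weighted_Lp_def)

lemma G_norm_eq: "weighted_Lp_norm M 1 w G = (\<integral>\<^sup>+z. ennreal (cmod (G z)) * ennreal (w z) \<partial>M)"
  using w_pos by (simp add: weighted_Lp_norm_def Lp_enorm_one ennreal_mult less_imp_le)

lemma G_norm_finite: "weighted_Lp_norm M 1 w G < top"
  using G_L1 by (simp add: weighted_Lp_def)

lemma G_translate_AE: "AE y in M. G (- y + x) = cnj (G (- x + y))"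
  using AE_minus_translation[OF G_involution, of x] by (simp add: involution_def minus_add)

text \<open>Hoelder's inequality between \<open>L^p_m\<close> and \<open>L^q_{1/m}\<close>, applied
  to \<open>f\<close> and a left translate of \<open>G\<close>; the factor
  \<open>alpha0 m (- x)\<close> pays for translating the weight along with \<open>G\<close>. As this
  works for each single \<open>x\<close>, convolutions with \<open>G\<close> are defined at every
  point.\<close>

lemma kernel_pairing_finite:
  assumes [measurable]: "f \<in> borel_measurable M"
    and fin: "Lp_enorm M p (\<lambda>x. f x * ennreal (m x)) < top"
  shows "(\<integral>\<^sup>+y. f y * ennreal (cmod (G (- y + x))) \<partial>M) < top"
proof -
  have q: "1 \<le> q" using conj by (rule conjugate_exponent_ge_1)
  let ?h = "\<lambda>y. ennreal (cmod (G y) * (1 / m y))"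
  have "Lp_enorm M q (\<lambda>y. ennreal (cmod (G (- x + y)) * (1 / m y)))
      \<le> Lp_enorm M q (\<lambda>y. ennreal (alpha0 m (- x)) * ?h (- x + y))"
  proof (intro Lp_enorm_mono_AE q AE_I2)
    fix y
    have "m (- x + y) \<le> alpha0 m (- x) * m y" by (rule m_le_alpha0)
    then have "1 / m y \<le> alpha0 m (- x) * (1 / m (- x + y))"
      using m_pos[of y] m_pos[of "- x + y"] by (simp add: field_simps)
    then have "cmod (G (- x + y)) * (1 / m y) \<le> cmod (G (- x + y)) * (alpha0 m (- x) * (1 / m (- x + y)))"
      by (intro mult_left_mono) auto
    then show "ennreal (cmod (G (- x + y)) * (1 / m y)) \<le> ennreal (alpha0 m (- x)) * ?h (- x + y)"
      using alpha0_pos[of "- x"] m_pos[of "- x + y"]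
      by (simp add: ennreal_mult[symmetric] ennreal_leI mult_ac)
  qed measurable
  also have "\<dots> \<le> ennreal (alpha0 m (- x)) * Lp_enorm M q (\<lambda>y. ?h (- x + y))"
    by (intro Lp_enorm_cmult_le q) measurable
  also have "\<dots> \<le> ennreal (alpha0 m (- x)) * Lp_enorm M q ?h"
    by (intro mult_left_mono Lp_enorm_left_translation[of q ?h] q) auto
  also have "\<dots> < top"
    using G_Lq by (simp add: weighted_Lp_def weighted_Lp_norm_def ennreal_mult_less_top)
  finally have "(\<integral>\<^sup>+y. (f y * ennreal (m y)) * ennreal (cmod (G (- x + y)) * (1 / m y)) \<partial>M) < top"
    using fin by (intro nn_integral_mult_finite[OF conj p]) auto
  also have "(\<integral>\<^sup>+y. (f y * ennreal (m y)) * ennreal (cmod (G (- x + y)) * (1 / m y)) \<partial>M)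
      = (\<integral>\<^sup>+y. f y * ennreal (cmod (G (- y + x))) \<partial>M)"
  proof (intro nn_integral_cong_AE, use G_translate_AE[of x] in eventually_elim)
    case (elim y)
    have "ennreal (m y) * ennreal (cmod (G (- x + y)) * (1 / m y)) = ennreal (cmod (G (- x + y)))"
      using m_pos[of y] by (simp add: ennreal_mult[symmetric])
    then show ?case using elim by (simp add: mult.assoc)
  qed
  finally show ?thesis .
qed

lemma convolution_integrable:
  assumes F: "F \<in> weighted_Lp M p m"
  shows "integrable M (\<lambda>y. F y * G (- y + x))"
proof -
  note [measurable] = Lp_D(1)[OF F]
  show ?thesis
    using kernel_pairing_finite[OF _ Lp_D(2)[OF F], of x]
    by (simp add: integrable_iff_bounded norm_mult ennreal_mult)
qed

lemma measurable_convolution [measurable]: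
  assumes [measurable]: "F \<in> borel_measurable M"
  shows "convolution M F G \<in> borel_measurable M"
  unfolding convolution_def by (intro measurable_integral_Borel) (simp add: split_beta')

lemma norm_convolution_le:
  assumes F: "F \<in> weighted_Lp M p m"
  shows "ennreal (cmod (convolution M F G x)) \<le> (\<integral>\<^sup>+y. ennreal (cmod (F y)) * ennreal (cmod (G (- y + x))) \<partial>M)"
  unfolding convolution_def
  using integral_norm_bound_ennreal[OF convolution_integrable[OF F, of x]] by (simp add: norm_mult ennreal_mult)

lemma convolution_norm_le:
  assumes F: "F \<in> weighted_Lp M p m"
  shows "Lp_norm (convolution M F G) \<le> Lp_norm F * weighted_Lp_norm M 1 w G"
proof -
  note [measurable] = Lp_D(1)[OF F]
  have "Lp_norm (convolution M F G)
      \<le> Lp_enorm M p (\<lambda>x. (\<integral>\<^sup>+y. ennreal (cmod (F y)) * ennreal (cmod (G (- y + x))) \<partial>M) * ennreal (m x))"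
    unfolding Lp_norm_eq
    by (intro Lp_enorm_mono_AE p AE_I2 mult_right_mono norm_convolution_le F) auto
  also have "\<dots> \<le> Lp_norm F * weighted_Lp_norm M 1 w G"
    unfolding Lp_norm_eq G_norm_eq
    by (rule weighted_convolution_right[where h = "\<lambda>z. ennreal (cmod (G z))"]) (use Lp_D(2)[OF F] in auto)
  finally show ?thesis .
qed

lemma convolution_in_Lp: "F \<in> weighted_Lp M p m \<Longrightarrow> convolution M F G \<in> weighted_Lp M p m"
  using convolution_norm_le[of F] G_norm_finite
  by (auto simp: weighted_Lp_def ennreal_mult_less_top intro: le_less_trans)

lemma convolution_add:
  "F \<in> weighted_Lp M p m \<Longrightarrow> H \<in> weighted_Lp M p m \<Longrightarrow>
    convolution M (\<lambda>x. F x + H x) G = (\<lambda>x. convolution M F G x + convolution M H G x)"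
  by (simp add: convolution_def distrib_right convolution_integrable)

lemma convolution_cmult: "convolution M (\<lambda>x. c * F x) G = (\<lambda>x. c * convolution M F G x)"
  by (simp add: convolution_def mult.assoc)

lemma convolution_diff:
  "F \<in> weighted_Lp M p m \<Longrightarrow> H \<in> weighted_Lp M p m \<Longrightarrow>
    convolution M (\<lambda>x. F x - H x) G = (\<lambda>x. convolution M F G x - convolution M H G x)"
  by (simp add: convolution_def left_diff_distrib convolution_integrable)

text \<open>Associativity together with \<open>G * G = G\<close>. For Fubini's theorem,
  \<open>|F| * |G|\<close> has finite \<open>L^p_m\<close> norm and can thus be paired with a
  translate of \<open>G\<close> once more. Idempotence of \<open>G\<close> holds almost everywhere
  but is used under an integral, so the conclusion holds at every point.\<close>

lemma convolution_idem:
  assumes F: "F \<in> weighted_Lp M p m"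
  shows "convolution M (convolution M F G) G = convolution M F G"
proof
  fix x
  note [measurable] = Lp_D(1)[OF F]
  have m: "(\<lambda>(y, z). F z * G (- z + y) * G (- y + x)) \<in> borel_measurable borel_prod"
    unfolding split_beta' by measurable
  define H where "H y = (\<integral>\<^sup>+z. ennreal (cmod (F z)) * ennreal (cmod (G (- z + y))) \<partial>M)" for y
  have Hm [measurable]: "H \<in> borel_measurable M"
    unfolding H_def by (rule measurable_nn_convolution[where k = "\<lambda>z. ennreal (cmod (G z))"]) measurable
  have "Lp_enorm M p (\<lambda>x. H x * ennreal (m x)) \<le> Lp_norm F * weighted_Lp_norm M 1 w G"
    unfolding Lp_norm_eq G_norm_eq H_def
    by (rule weighted_convolution_right[where h = "\<lambda>z. ennreal (cmod (G z))"]) (use Lp_D(2)[OF F] in auto)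
  also have "\<dots> < top"
    using F G_norm_finite by (simp add: weighted_Lp_def ennreal_mult_less_top)
  finally have "(\<integral>\<^sup>+y. H y * ennreal (cmod (G (- y + x))) \<partial>M) < top"
    by (intro kernel_pairing_finite) auto
  also have "(\<integral>\<^sup>+y. H y * ennreal (cmod (G (- y + x))) \<partial>M)
      = (\<integral>\<^sup>+y. \<integral>\<^sup>+z. ennreal (cmod (F z * G (- z + y) * G (- y + x))) \<partial>M \<partial>M)"
    unfolding H_def by (simp add: nn_integral_multc[symmetric] norm_mult ennreal_mult)
  finally have fin: "(\<integral>\<^sup>+y. \<integral>\<^sup>+z. ennreal (cmod (F z * G (- z + y) * G (- y + x))) \<partial>M \<partial>M) < top" .
  have "convolution M (convolution M F G) G x = (LINT y|M. LINT z|M. F z * G (- z + y) * G (- y + x))"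
    by (simp add: convolution_def)
  also have "\<dots> = (LINT z|M. LINT y|M. F z * G (- z + y) * G (- y + x))"
    by (rule Fubini_integral[OF m fin])
  also have "\<dots> = (LINT z|M. F z * convolution M G G (- z + x))"
  proof (intro Bochner_Integration.integral_cong refl)
    fix z
    have "(LINT y|M. F z * G (- z + y) * G (- y + x)) = F z * (LINT y|M. G (- z + y) * G (- y + x))"
      by (simp add: mult.assoc)
    also have "(LINT y|M. G (- z + y) * G (- y + x)) = (LINT y|M. G (- z + (z + y)) * G (- (z + y) + x))"
      by (rule integral_left_translation[symmetric]) measurable
    also have "\<dots> = convolution M G G (- z + x)"
      by (simp add: convolution_def minus_add add.assoc[symmetric])
    finally show "(LINT y|M. F z * G (- z + y) * G (- y + x)) = F z * convolution M G G (- z + x)" .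
  qed
  also have "\<dots> = (LINT z|M. F z * G (- z + x))"
    using AE_minus_translation[OF G_idem, of x] by (intro integral_cong_AE) (auto elim: eventually_mono)
  finally show "convolution M (convolution M F G) G x = convolution M F G x"
    by (simp add: convolution_def)
qed

lemma convolution_in_repr_space: "F \<in> weighted_Lp M p m \<Longrightarrow> convolution M F G \<in> repr"
  by (simp add: repr_space_def convolution_in_Lp convolution_idem)

lemma repr_spaceD: "F \<in> repr \<Longrightarrow> F \<in> weighted_Lp M p m"
  "F \<in> repr \<Longrightarrow> convolution M F G = F"
  by (simp_all add: repr_space_def)

lemma repr_spaceI: "F \<in> weighted_Lp M p m \<Longrightarrow> convolution M F G = F \<Longrightarrow> F \<in> repr"
  by (simp add: repr_space_def)

text \<open>The reproducing equation settles what almost-everywhere information leaves open: an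
  element of norm zero vanishes at every point, and an \<open>L^p_m\<close> limit \<open>g\<close>
  is replaced by its projection \<open>convolution M g G\<close>.\<close>

lemma repr_space_banach: "is_banach_fun_space repr (Lp_norm)"
  unfolding is_banach_fun_space_def
proof (intro conjI allI impI)
  show "is_normed_fun_space repr (Lp_norm)"
    unfolding is_normed_fun_space_def
  proof (intro conjI ballI allI impI)
    show "(\<lambda>s. 0) \<in> repr"
      by (intro repr_spaceI Lp_space) (simp add: convolution_def)
  next
    fix f g assume fg: "f \<in> repr" "g \<in> repr"
    then show "(\<lambda>s. f s + g s) \<in> repr"
      by (intro repr_spaceI Lp_space) (auto simp: convolution_add repr_spaceD)
    show "Lp_norm (\<lambda>s. f s + g s) \<le> Lp_norm f + Lp_norm g"
      using fg by (intro Lp_space Lp_D repr_spaceD)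
  next
    fix c f assume f: "f \<in> repr"
    then show "(\<lambda>s. c * f s) \<in> repr"
      by (intro repr_spaceI Lp_space) (auto simp: convolution_cmult repr_spaceD)
    show "Lp_norm (\<lambda>s. c * f s) = ennreal (cmod c) * Lp_norm f"
      using f by (intro Lp_space Lp_D repr_spaceD)
  next
    fix f assume f: "f \<in> repr"
    then show "Lp_norm f < top"
      by (simp add: repr_space_def weighted_Lp_def)
    assume "Lp_norm f = 0"
    then have 0: "AE y in M. f y = 0"
      using f by (intro weighted_Lp_norm_eq_0D[OF p m_measurable m_pos] Lp_D repr_spaceD)
    have "convolution M f G x = 0" for x
    proof -
      have "AE y in M. f y * G (- y + x) = 0"
        using 0 by eventually_elim simp
      then show ?thesis
        unfolding convolution_def by (rule integral_eq_zero_AE)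
    qed
    then show "f = (\<lambda>s. 0)"
      using repr_spaceD(2)[OF f] by (metis ext)
  qed
next
  fix f :: "nat \<Rightarrow> 'a \<Rightarrow> complex"
  let ?N = "Lp_norm"
  assume A: "(\<forall>n. f n \<in> repr) \<and>
    (\<forall>\<epsilon>>0. \<exists>n0. \<forall>k\<ge>n0. \<forall>n\<ge>n0. ?N (\<lambda>s. f k s - f n s) < \<epsilon>)"
  then have fR: "f n \<in> repr" and f: "f n \<in> weighted_Lp M p m" for n
    by (auto simp: repr_spaceD)
  have "\<exists>g\<in>weighted_Lp M p m. (\<lambda>n. ?N (\<lambda>x. f n x - g x)) \<longlonglongrightarrow> 0"
    using A by (intro weighted_Lp_complete[OF p m_measurable m_pos f]) simp
  then obtain g where g: "g \<in> weighted_Lp M p m" "(\<lambda>n. ?N (\<lambda>x. f n x - g x)) \<longlonglongrightarrow> 0"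
    by blast
  show "\<exists>g\<in>repr. (\<lambda>n. ?N (\<lambda>s. f n s - g s)) \<longlonglongrightarrow> 0"
  proof (intro bexI)
    show "convolution M g G \<in> repr"
      by (rule convolution_in_repr_space[OF g(1)])
    \<comment> \<open>As \<open>f n\<close> reproduces itself, its distance to the projection is the
      norm of a convolution, that of \<open>f n - g\<close> with \<open>G\<close>.\<close>
    have le: "?N (\<lambda>s. f n s - convolution M g G s) \<le> weighted_Lp_norm M 1 w G * ?N (\<lambda>s. f n s - g s)" for n
    proof -
      have "(\<lambda>s. f n s - convolution M g G s) = convolution M (\<lambda>s. f n s - g s) G"
        by (simp add: convolution_diff f g repr_spaceD(2)[OF fR])
      then show ?thesis
        using convolution_norm_le[OF Lp_space(6)[OF f g(1)]] by (simp only: mult.commute)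
    qed
    have "(\<lambda>n. weighted_Lp_norm M 1 w G * ?N (\<lambda>s. f n s - g s)) \<longlonglongrightarrow> weighted_Lp_norm M 1 w G * 0"
      using G_norm_finite by (intro ennreal_tendsto_cmult g)
    then have lim: "(\<lambda>n. weighted_Lp_norm M 1 w G * ?N (\<lambda>s. f n s - g s)) \<longlonglongrightarrow> 0"
      by (simp only: mult_zero_right)
    show "(\<lambda>n. ?N (\<lambda>s. f n s - convolution M g G s)) \<longlonglongrightarrow> 0"
      by (rule tendsto_sandwich[OF always_eventually always_eventually tendsto_const lim])
         (intro allI zero_le le)+
  qed
qed

lemma pairing_left_translate:
  assumes F: "F \<in> repr"
  shows "pairing M F (left_translate x G) = F x"
proof -
  note [measurable] = Lp_D(1)[OF repr_spaceD(1)[OF F]]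
  have [measurable]: "cnj \<in> borel \<rightarrow>\<^sub>M borel"
    by (intro borel_measurable_continuous_onI continuous_intros)
  have "pairing M F (left_translate x G) = (LINT y|M. F y * G (- y + x))"
    unfolding pairing_def left_translate_def using G_translate_AE[of x]
    by (intro integral_cong_AE) (auto elim: eventually_mono)
  also have "\<dots> = convolution M F G x" by (simp add: convolution_def)
  finally show ?thesis by (simp add: repr_spaceD(2)[OF F])
qed

end

section \<open>Sampling on well-spread families\<close>

locale sampling = reproducing_kernel M \<Delta> p q m w G
  for M :: "'a::{topological_group_add, t2_space} measure" and \<Delta> p q m w G +
  fixes U :: "'a set" and x :: "'i \<Rightarrow> 'a"
  assumes U_nhd: "compact_nhd_neutral U"
    and small: "osc_norm M w U G * weighted_Lp_norm M 1 w G < 1"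
    and spread: "well_spread U x"
begin

section \<open>The neighbourhood \<open>U\<close> and the local oscillation of elements of
  \<open>repr\<close>\<close>

lemma U_compact: "compact U"
  using U_nhd by (simp add: compact_nhd_neutral_def)

lemma U_sets [measurable]: "U \<in> sets M"
  using U_compact by (simp add: sets_eq_borel compact_imp_closed)

lemma countable_index: "countable (UNIV :: 'i set)"
  using spread by (simp add: well_spread_def)

lemma emeasure_U: "0 < emeasure M U" "emeasure M U < top"
proof -
  have "0 < emeasure M (interior U)"
    using U_nhd by (intro emeasure_open_pos[of _ 0]) (auto simp: compact_nhd_neutral_def)
  also have "\<dots> \<le> emeasure M U"
    by (intro emeasure_mono interior_subset) measurable
  finally show "0 < emeasure M U" .
  show "emeasure M U < top" by (rule emeasure_compact[OF U_compact])
qed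

text \<open>
  The oscillation is an essential supremum, so it controls translations only by almost every element
  of \<open>U\<close>. A null set of exceptional elements is harmless, since the translates of \<open>U\<close> still
  cover the group up to a null set when it is removed.
\<close>

definition U' :: "'a set" where
  "U' = (SOME V. V \<in> sets M \<and> V \<subseteq> U \<and> U - V \<in> null_sets M \<and>
     (\<forall>u\<in>V. AE z in M. ennreal (cmod (G (u + z) - G z)) \<le> osc M U G z))"

lemma U': "U' \<in> sets M" "U' \<subseteq> U" "U - U' \<in> null_sets M"
  "u \<in> U' \<Longrightarrow> AE z in M. ennreal (cmod (G (u + z) - G z)) \<le> osc M U G z"
proof -
  obtain N where N: "N \<in> null_sets M"
    "{u \<in> space M. \<not> (u \<in> U \<longrightarrow> (AE z in M. ennreal (cmod (G (u + z) - G z)) \<le> osc M U G z))} \<subseteq> N"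
    using osc_AE[OF G_measurable U_compact] unfolding eventually_ae_filter by blast
  have "U - (U - N) \<in> null_sets M"
    using N(1) U_sets by (intro null_sets_subset[OF N(1)]) auto
  then have "U - N \<in> sets M \<and> U - N \<subseteq> U \<and> U - (U - N) \<in> null_sets M \<and>
     (\<forall>u\<in>U - N. AE z in M. ennreal (cmod (G (u + z) - G z)) \<le> osc M U G z)"
    using N U_sets by auto
  then have *: "U' \<in> sets M \<and> U' \<subseteq> U \<and> U - U' \<in> null_sets M \<and>
     (\<forall>u\<in>U'. AE z in M. ennreal (cmod (G (u + z) - G z)) \<le> osc M U G z)"
    unfolding U'_def by (rule someI)
  then show "U' \<in> sets M" "U' \<subseteq> U" "U - U' \<in> null_sets M"
    "u \<in> U' \<Longrightarrow> AE z in M. ennreal (cmod (G (u + z) - G z)) \<le> osc M U G z"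
    by blast+
qed

lemma U'_measurable [measurable]: "U' \<in> sets M"
  by (rule U')

lemma emeasure_U': "emeasure M U' = emeasure M U"
proof -
  have "emeasure M U' = emeasure M (U' \<union> (U - U'))"
    using U' by (intro emeasure_Un_null_set[symmetric]) auto
  also have "U' \<union> (U - U') = U" using U'(2) by auto
  finally show ?thesis .
qed

lemma osc_measurable [measurable]: "osc M U G \<in> borel_measurable M"
  by (rule measurable_osc[OF G_measurable U_compact])

lemma osc_norm_eq: "osc_norm M w U G = (\<integral>\<^sup>+z. osc M U G z * ennreal (w z) \<partial>M)"
  by (simp add: osc_norm_def Lp_enorm_one)

text \<open>The convolution of \<open>|F|\<close> with the reflection of the oscillation: the
  argument is \<open>- y + v\<close> with \<open>v\<close> the integration variable.\<close>

definition osc_majorant :: "('a \<Rightarrow> complex) \<Rightarrow> 'a \<Rightarrow> ennreal" where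
  "osc_majorant F y = (\<integral>\<^sup>+v. ennreal (cmod (F v)) * osc M U G (- y + v) \<partial>M)"

lemma measurable_osc_majorant [measurable]:
  assumes [measurable]: "F \<in> borel_measurable M"
  shows "osc_majorant F \<in> borel_measurable M"
  unfolding osc_majorant_def by (intro measurable_nn_integral_Borel) (simp add: split_beta')

lemma osc_majorant_norm:
  assumes F: "F \<in> weighted_Lp M p m"
  shows "Lp_enorm M p (\<lambda>y. osc_majorant F y * ennreal (m y)) \<le> Lp_norm F * osc_norm M w U G"
  unfolding osc_majorant_def Lp_norm_eq osc_norm_eq
  by (rule weighted_convolution_right_minus) (use Lp_D[OF F] in auto)

text \<open>By symmetry the kernel difference at \<open>- y + (z + u)\<close> and
  \<open>- y + z\<close> has the modulus of the difference at \<open>- (z + u) + y\<close> and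
  \<open>- z + y\<close>. The latter point is \<open>u\<close> added on the left to the former, a
  displacement measured by \<open>osc\<close>; this is why the majorant is evaluated at
  \<open>z + u\<close>.\<close>

lemma local_oscillation:
  assumes F: "F \<in> repr" and u: "u \<in> U'"
  shows "ennreal (cmod (F (z + u) - F z)) \<le> osc_majorant F (z + u)"
proof -
  note FL = repr_spaceD(1)[OF F]
  note [measurable] = Lp_D(1)[OF FL]
  have "F (z + u) - F z = convolution M F G (z + u) - convolution M F G z"
    by (simp add: repr_spaceD(2)[OF F])
  also have "\<dots> = (LINT y|M. F y * G (- y + (z + u)) - F y * G (- y + z))"
    unfolding convolution_def by (intro Bochner_Integration.integral_diff[symmetric] convolution_integrable FL)
  finally have "ennreal (cmod (F (z + u) - F z)) \<le> (\<integral>\<^sup>+y. ennreal (cmod (F y * G (- y + (z + u)) - F y * G (- y + z))) \<partial>M)"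
    using integral_norm_bound_ennreal[OF Bochner_Integration.integrable_diff[OF
        convolution_integrable[OF FL, of "z + u"] convolution_integrable[OF FL, of z]]] by simp
  also have "\<dots> \<le> osc_majorant F (z + u)"
    unfolding osc_majorant_def
  proof (rule nn_integral_mono_AE)
    have "AE y in M. ennreal (cmod (G (u + (- (z + u) + y)) - G (- (z + u) + y))) \<le> osc M U G (- (z + u) + y)"
      using AE_left_translation[OF U'(4)[OF u]] .
    with G_translate_AE[of "z + u"] G_translate_AE[of z]
    show "AE y in M. ennreal (cmod (F y * G (- y + (z + u)) - F y * G (- y + z)))
        \<le> ennreal (cmod (F y)) * osc M U G (- (z + u) + y)"
    proof eventually_elim
      case (elim y)
      have "u + (- (z + u) + y) = - z + y"
        by (simp add: minus_add add.assoc[symmetric] del: add_uminus_conv_diff)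
      then have "cmod (G (- y + (z + u)) - G (- y + z)) = cmod (G (u + (- (z + u) + y)) - G (- (z + u) + y))"
        unfolding elim(1,2) complex_cnj_diff[symmetric] complex_mod_cnj by (simp add: norm_minus_commute)
      then have "ennreal (cmod (G (- y + (z + u)) - G (- y + z))) \<le> osc M U G (- (z + u) + y)"
        using elim(3) by simp
      then have "ennreal (cmod (F y)) * ennreal (cmod (G (- y + (z + u)) - G (- y + z)))
          \<le> ennreal (cmod (F y)) * osc M U G (- (z + u) + y)"
        by (rule mult_left_mono) simp
      then show ?case
        by (simp add: right_diff_distrib[symmetric] norm_mult ennreal_mult)
    qed
  qed
  finally show ?thesis .
qed

text \<open>The first index in an enumeration whose cell \<open>x i + U'\<close> contains
  \<open>y\<close>; no distance is involved. A choice by least natural number is measurable, and it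
  is unspecified only where no cell contains \<open>y\<close>, which is a null set.\<close>

definition nearest :: "'a \<Rightarrow> 'i" where
  "nearest y = from_nat_into UNIV (LEAST n. - x (from_nat_into UNIV n) + y \<in> U')"

lemma measurable_nearest [measurable]: "nearest \<in> M \<rightarrow>\<^sub>M count_space UNIV"
  unfolding nearest_def by measurable

lemma measurable_step_function [measurable]:
  fixes a :: "'i \<Rightarrow> 'b::topological_space"
  shows "(\<lambda>y. a (nearest y)) \<in> borel_measurable M"
  by (rule measurable_compose[OF measurable_nearest]) simp

text \<open>Countably many translates of the null set \<open>U - U'\<close> form a null set; off it,
  \<open>U\<close> may be replaced by \<open>U'\<close> in the covering.\<close>

lemma nearest_AE: "AE y in M. - x (nearest y) + y \<in> U'"
proof -
  have "AE z in M. z \<notin> U - U'"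
    using U'(3) by (rule AE_not_in)
  then have "AE y in M. \<forall>n. - x (from_nat_into UNIV n) + y \<notin> U - U'"
    unfolding AE_all_countable by (intro allI AE_left_translation)
  then show ?thesis
  proof eventually_elim
    case (elim y)
    have "y \<in> (\<Union>i. (\<lambda>u. x i + u) ` U)"
      using spread by (simp add: well_spread_def dense_family_def)
    then obtain i u where iu: "u \<in> U" "y = x i + u" by auto
    obtain n where n: "from_nat_into UNIV n = i"
      using from_nat_into_surj[OF countable_index, of i] by auto
    have "- x (from_nat_into UNIV n) + y = u"
      unfolding n iu(2) by (simp add: add.assoc[symmetric])
    then have "- x (from_nat_into UNIV n) + y \<in> U'"
      using elim iu(1) by (metis DiffI)
    then show ?case
      unfolding nearest_def by (rule LeastI)
  qed
qed

text \<open>Up to a null set the points with \<open>nearest y = i\<close> lie in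
  \<open>x i + U\<close>, and all these translates have the measure of \<open>U\<close>.\<close>

lemma nearest_norm:
  "\<exists>C. 0 < C \<and> (\<forall>a :: 'i \<Rightarrow> ennreal.
     Lp_enorm M p (\<lambda>y. a (nearest y)) \<le> ennreal C * Lp_enorm (count_space UNIV) p a)"
  using p
proof (cases rule: exponent_cases)
  case top
  have "Lp_enorm M p (\<lambda>y. a (nearest y)) \<le> ennreal 1 * Lp_enorm (count_space UNIV) p a" for a :: "'i \<Rightarrow> ennreal"
  proof -
    have "a i \<le> Lp_enorm (count_space UNIV) top a" for i
      using Lp_enorm_top_le_iff[of a "count_space UNIV" "Lp_enorm (count_space UNIV) top a"]
      by (auto simp: AE_count_space)
    then show ?thesis
      unfolding top by (subst Lp_enorm_top_le_iff) auto
  qed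
  then show ?thesis by (intro exI[of _ 1]) auto
next
  case (real r)
  obtain \<mu> where \<mu>: "emeasure M U = ennreal \<mu>" "0 < \<mu>"
    using emeasure_U by (cases "emeasure M U") auto
  have "Lp_enorm M p (\<lambda>y. a (nearest y)) \<le> ennreal (\<mu> powr (1 / r)) * Lp_enorm (count_space UNIV) p a"
    for a :: "'i \<Rightarrow> ennreal"
  proof -
    have "(\<integral>\<^sup>+y. ennreal_powr (a (nearest y)) r \<partial>M)
        \<le> (\<integral>\<^sup>+y. \<integral>\<^sup>+i. ennreal_powr (a i) r * indicator U (- x i + y) \<partial>count_space UNIV \<partial>M)"
    proof (rule nn_integral_mono_AE, use nearest_AE in eventually_elim)
      case (elim y)
      then have "- x (nearest y) + y \<in> U" using U'(2) by blast
      then have "ennreal_powr (a (nearest y)) r = ennreal_powr (a (nearest y)) r * indicator U (- x (nearest y) + y)"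
        by simp
      also have "\<dots> \<le> (\<integral>\<^sup>+i. ennreal_powr (a i) r * indicator U (- x i + y) \<partial>count_space UNIV)"
        by (rule nn_integral_ge_point) simp
      finally show ?case .
    qed
    also have "\<dots> = (\<integral>\<^sup>+i. \<integral>\<^sup>+y. ennreal_powr (a i) r * indicator U (- x i + y) \<partial>M \<partial>count_space UNIV)"
      by (intro nn_integral_count_space_nn_integral countable_index) measurable
    also have "\<dots> = (\<integral>\<^sup>+i. ennreal_powr (a i) r * emeasure M U \<partial>count_space UNIV)"
      by (intro nn_integral_cong) (simp add: nn_integral_cmult nn_integral_cell)
    also have "\<dots> = ennreal \<mu> * ennreal_powr (Lp_enorm (count_space UNIV) p a) r"
      using real unfolding \<mu>(1)
      by (subst nn_integral_multc) (simp_all add: Lp_enorm_ennreal_powr mult.commute)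
    also have "\<dots> = ennreal_powr (ennreal (\<mu> powr (1 / r)) * Lp_enorm (count_space UNIV) p a) r"
      using real \<mu> by (simp add: ennreal_powr_mult ennreal_powr_ennreal powr_powr)
    finally show ?thesis
      using real by (simp add: Lp_enorm_ennreal_le_iff)
  qed
  then show ?thesis using \<mu> by (intro exI[of _ "\<mu> powr (1 / r)"]) auto
qed

text \<open>All cells containing \<open>y\<close> meet a fixed one of them in \<open>y\<close>, and
  relative separation counts the translates of \<open>U\<close> that meet a given translate.\<close>

lemma overlap_bound:
  obtains L :: nat where "\<And>y. (\<integral>\<^sup>+i. indicator U' (- x i + y) \<partial>count_space UNIV) \<le> of_nat L"
proof -
  let ?near = "\<lambda>i. {j. (\<lambda>k. x i + k) ` U \<inter> (\<lambda>k. x j + k) ` U \<noteq> {}}"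
  obtain L where L: "\<And>i. finite (?near i) \<and> card (?near i) \<le> L"
    using spread U_compact unfolding well_spread_def relatively_separated_def by blast
  have "(\<integral>\<^sup>+i. indicator U' (- x i + y) \<partial>count_space UNIV) \<le> of_nat L" for y
  proof -
    let ?J = "{i. - x i + y \<in> U'}"
    have "(\<integral>\<^sup>+i. indicator U' (- x i + y) \<partial>count_space UNIV) = (\<integral>\<^sup>+i. indicator ?J i \<partial>count_space UNIV)"
      by (intro nn_integral_cong) (simp add: indicator_def)
    also have "\<dots> = emeasure (count_space UNIV) ?J" by simp
    also have "\<dots> \<le> of_nat L"
    proof (cases "?J = {}")
      case False
      then obtain i where i: "- x i + y \<in> U'" by auto
      have "?J \<subseteq> ?near i"
      proof
        fix j assume "j \<in> ?J"
        then have j: "- x j + y \<in> U'" by simp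
        have "y = x i + (- x i + y)" "y = x j + (- x j + y)"
          by (simp_all add: add.assoc[symmetric])
        then have "y \<in> (\<lambda>k. x i + k) ` U" "y \<in> (\<lambda>k. x j + k) ` U"
          using i j U'(2) by blast+
        then show "j \<in> ?near i" by blast
      qed
      then have "finite ?J" "card ?J \<le> L"
        using L[of i] by (auto intro: finite_subset dest: card_mono[rotated])
      then show ?thesis by simp
    qed simp
    finally show ?thesis .
  qed
  then show ?thesis by (rule that)
qed

text \<open>Integrating over the cell of \<open>x i\<close> bounds a point value by an average of
  \<open>g\<close>; summing over \<open>i\<close> counts each point at most as often as the cells
  overlap.\<close>

lemma sampling_norm:
  "\<exists>C. 0 < C \<and> (\<forall>(a :: 'i \<Rightarrow> ennreal) g. g \<in> borel_measurable M \<longrightarrow>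
     (\<forall>i. \<forall>u\<in>U'. a i \<le> g (x i + u)) \<longrightarrow>
     Lp_enorm (count_space UNIV) p a \<le> ennreal C * Lp_enorm M p g)"
  using p
proof (cases rule: exponent_cases)
  case top
  have "Lp_enorm (count_space UNIV) p a \<le> ennreal 1 * Lp_enorm M p g"
    if [measurable]: "g \<in> borel_measurable M" and le: "\<forall>i. \<forall>u\<in>U'. a i \<le> g (x i + u)"
    for a :: "'i \<Rightarrow> ennreal" and g
  proof -
    have "a i \<le> Lp_enorm M top g" for i
    proof -
      have "AE y in M. g y \<le> Lp_enorm M top g"
        using Lp_enorm_top_le_iff[of g M "Lp_enorm M top g"] by auto
      then have AE: "AE u in M. g (x i + u) \<le> Lp_enorm M top g"
        by (rule AE_left_translation)
      \<comment> \<open>\<open>U'\<close> has positive measure, so it contains a point at which the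
        almost-everywhere bound is true.\<close>
      have "\<exists>u\<in>U'. g (x i + u) \<le> Lp_enorm M top g"
      proof (rule ccontr)
        assume "\<not> ?thesis"
        with AE have "AE u in M. u \<notin> U'"
          by (auto elim!: eventually_mono)
        then have "emeasure M U' = 0"
          by (subst (asm) AE_iff_measurable[of U']) auto
        then show False using emeasure_U by (simp add: emeasure_U')
      qed
      then show ?thesis using le by (blast intro: order_trans)
    qed
    then show ?thesis
      unfolding top by (subst Lp_enorm_top_le_iff) (auto simp: AE_count_space)
  qed
  then show ?thesis by (intro exI[of _ 1]) auto
next
  case (real r)
  obtain L :: nat where L: "\<And>y. (\<integral>\<^sup>+i. indicator U' (- x i + y) \<partial>count_space UNIV) \<le> of_nat L"
    by (rule overlap_bound) (rule that)
  obtain \<mu> where \<mu>: "emeasure M U = ennreal \<mu>" "0 < \<mu>"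
    using emeasure_U by (cases "emeasure M U") auto
  \<comment> \<open>\<open>Suc L\<close> in place of \<open>L\<close> keeps \<open>C\<close>
    positive.\<close>
  define C where "C = (real (Suc L) / \<mu>) powr (1 / r)"
  have C: "0 < C" "C powr r = real (Suc L) / \<mu>"
    using \<mu> real by (auto simp: C_def powr_powr)
  have "Lp_enorm (count_space UNIV) p a \<le> ennreal C * Lp_enorm M p g"
    if [measurable]: "g \<in> borel_measurable M" and le: "\<forall>i. \<forall>u\<in>U'. a i \<le> g (x i + u)"
    for a :: "'i \<Rightarrow> ennreal" and g
  proof -
    let ?S = "\<integral>\<^sup>+i. ennreal_powr (a i) r \<partial>count_space UNIV"
    have "ennreal \<mu> * ?S = (\<integral>\<^sup>+i. ennreal_powr (a i) r * emeasure M U' \<partial>count_space UNIV)"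
      unfolding emeasure_U' \<mu>(1) by (subst nn_integral_multc) (simp_all add: mult.commute)
    also have "\<dots> = (\<integral>\<^sup>+i. \<integral>\<^sup>+y. ennreal_powr (a i) r * indicator U' (- x i + y) \<partial>M \<partial>count_space UNIV)"
      by (intro nn_integral_cong) (simp add: nn_integral_cmult nn_integral_cell)
    also have "\<dots> \<le> (\<integral>\<^sup>+i. \<integral>\<^sup>+y. ennreal_powr (g y) r * indicator U' (- x i + y) \<partial>M \<partial>count_space UNIV)"
    proof (intro nn_integral_mono)
      fix i y
      show "ennreal_powr (a i) r * indicator U' (- x i + y) \<le> ennreal_powr (g y) r * indicator U' (- x i + y)"
      proof (cases "- x i + y \<in> U'")
        case True
        then have "a i \<le> g (x i + (- x i + y))" using le by blast
        then have "a i \<le> g y" by (simp add: add.assoc[symmetric])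
        then show ?thesis using real by (intro mult_right_mono ennreal_powr_mono) auto
      qed simp
    qed
    also have "\<dots> = (\<integral>\<^sup>+y. \<integral>\<^sup>+i. ennreal_powr (g y) r * indicator U' (- x i + y) \<partial>count_space UNIV \<partial>M)"
      by (intro nn_integral_count_space_nn_integral[symmetric] countable_index) measurable
    also have "\<dots> \<le> (\<integral>\<^sup>+y. ennreal_powr (g y) r * of_nat (Suc L) \<partial>M)"
    proof (intro nn_integral_mono)
      fix y
      have "(\<integral>\<^sup>+i. ennreal_powr (g y) r * indicator U' (- x i + y) \<partial>count_space UNIV)
          = ennreal_powr (g y) r * (\<integral>\<^sup>+i. indicator U' (- x i + y) \<partial>count_space UNIV)"
        by (rule nn_integral_cmult) simp
      also have "\<dots> \<le> ennreal_powr (g y) r * of_nat (Suc L)"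
        using L[of y] by (intro mult_left_mono) (auto intro: order_trans)
      finally show "(\<integral>\<^sup>+i. ennreal_powr (g y) r * indicator U' (- x i + y) \<partial>count_space UNIV)
          \<le> ennreal_powr (g y) r * of_nat (Suc L)" .
    qed
    also have "\<dots> = ennreal (real (Suc L)) * ennreal_powr (Lp_enorm M p g) r"
      using real by (simp add: nn_integral_multc Lp_enorm_ennreal_powr mult.commute
          ennreal_of_nat_eq_real_of_nat del: of_nat_Suc)
    finally have "ennreal (1 / \<mu>) * (ennreal \<mu> * ?S)
        \<le> ennreal (1 / \<mu>) * (ennreal (real (Suc L)) * ennreal_powr (Lp_enorm M p g) r)"
      by (rule mult_left_mono) simp
    then have "?S \<le> ennreal (C powr r) * ennreal_powr (Lp_enorm M p g) r"
      using \<mu>(2) unfolding C(2) by (simp add: mult.assoc[symmetric] ennreal_mult[symmetric] del: of_nat_Suc)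
    also have "\<dots> = ennreal_powr (ennreal C * Lp_enorm M p g) r"
      using C by (simp add: ennreal_powr_mult ennreal_powr_ennreal)
    finally show ?thesis
      using real by (simp add: Lp_enorm_ennreal_le_iff)
  qed
  then show ?thesis using C by blast
qed

section \<open>The sequence space, synthesis and analysis\<close>

abbreviation "lp \<equiv> weighted_lp p (\<lambda>i. m (x i))"

abbreviation "lp_norm \<equiv> weighted_lp_norm p (\<lambda>i. m (x i))"

lemma lp_eq: "lp = weighted_Lp (count_space UNIV) p (\<lambda>i. m (x i))"
  by (rule weighted_lp_eq[OF countable_index p m_pos])

lemma lp_norm_eq: "lp_norm = weighted_Lp_norm (count_space UNIV) p (\<lambda>i. m (x i))"
  by (rule weighted_lp_norm_eq[OF countable_index p m_pos])

lemma lp_banach: "is_banach_fun_space lp lp_norm"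
  unfolding is_banach_fun_space_def
proof (intro conjI allI impI)
  have fin: "weighted_Lp_norm (count_space UNIV) p (\<lambda>i. m (x i)) f < top"
    if "f \<in> weighted_Lp (count_space UNIV) p (\<lambda>i. m (x i))" for f
    using that by (simp add: weighted_Lp_def)
  show "is_normed_fun_space lp lp_norm"
    unfolding is_normed_fun_space_def lp_eq lp_norm_eq
  proof (intro conjI ballI allI impI)
    fix f assume "f \<in> weighted_Lp (count_space UNIV) p (\<lambda>i. m (x i))"
      and "weighted_Lp_norm (count_space UNIV) p (\<lambda>i. m (x i)) f = 0"
    then show "f = (\<lambda>s. 0)"
      using weighted_Lp_norm_eq_0D[of p "\<lambda>i. m (x i)" "count_space UNIV" f] p m_pos by (auto simp: AE_count_space)
  qed (use p m_pos in \<open>auto intro: fin weighted_Lp_add weighted_Lp_cmult weighted_Lp_zero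
      weighted_Lp_norm_add weighted_Lp_norm_cmult\<close>)
next
  fix f :: "nat \<Rightarrow> 'i \<Rightarrow> complex"
  assume "(\<forall>n. f n \<in> lp) \<and> (\<forall>\<epsilon>>0. \<exists>n0. \<forall>k\<ge>n0. \<forall>n\<ge>n0. lp_norm (\<lambda>s. f k s - f n s) < \<epsilon>)"
  then show "\<exists>g\<in>lp. (\<lambda>n. lp_norm (\<lambda>s. f n s - g s)) \<longlonglongrightarrow> 0"
    unfolding lp_eq lp_norm_eq using p m_pos by (intro weighted_Lp_complete) auto
qed

definition synthesis :: "('i \<Rightarrow> complex) \<Rightarrow> 'a \<Rightarrow> complex" where
  "synthesis c = convolution M (\<lambda>y. c (nearest y)) G"

text \<open>On the cell of \<open>x i\<close> the weight \<open>m y\<close> is at most a constant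
  times \<open>m (x i)\<close>, by \<open>moderate_on_compact\<close> for \<open>U\<close>;
  \<open>nearest_norm\<close> does the counting.\<close>

lemma step_function_norm:
  "\<exists>C. 0 < C \<and> (\<forall>c. Lp_norm (\<lambda>y. c (nearest y)) \<le> ennreal C * lp_norm c)"
proof -
  obtain C where C: "0 < C" "\<And>a :: 'i \<Rightarrow> ennreal.
      Lp_enorm M p (\<lambda>y. a (nearest y)) \<le> ennreal C * Lp_enorm (count_space UNIV) p a"
    using nearest_norm by blast
  obtain B where B: "0 < B" "\<And>y u. u \<in> U \<Longrightarrow> m (y + u) \<le> B * m y"
    by (rule moderate_on_compact[OF U_compact]) (rule that)
  have "Lp_norm (\<lambda>y. c (nearest y)) \<le> ennreal (B * C) * lp_norm c" for c
  proof -
    let ?a = "\<lambda>i. ennreal (cmod (c i) * m (x i))"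
    have "Lp_norm (\<lambda>y. c (nearest y)) \<le> Lp_enorm M p (\<lambda>y. ennreal B * ?a (nearest y))"
      unfolding weighted_Lp_norm_def
    proof (intro Lp_enorm_mono_AE p)
      show "AE y in M. ennreal (cmod (c (nearest y)) * m y) \<le> ennreal B * ?a (nearest y)"
        using nearest_AE
      proof eventually_elim
        case (elim y)
        then have "m (x (nearest y) + (- x (nearest y) + y)) \<le> B * m (x (nearest y))"
          using U'(2) by (intro B) blast
        then have "m y \<le> B * m (x (nearest y))" by (simp add: add.assoc[symmetric])
        then have "cmod (c (nearest y)) * m y \<le> cmod (c (nearest y)) * (B * m (x (nearest y)))"
          by (intro mult_left_mono) auto
        then show ?case
          using B(1) m_pos[of "x (nearest y)"]
          by (simp add: ennreal_mult[symmetric] ennreal_leI less_imp_le mult_ac)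
      qed
    qed measurable
    also have "\<dots> = ennreal B * Lp_enorm M p (\<lambda>y. ?a (nearest y))"
      using B(1) by (intro Lp_enorm_cmult p) auto
    also have "\<dots> \<le> ennreal B * (ennreal C * lp_norm c)"
      unfolding lp_norm_eq weighted_Lp_norm_def by (intro mult_left_mono C(2)) auto
    finally show ?thesis
      using B(1) C(1) by (simp add: ennreal_mult mult.assoc less_imp_le)
  qed
  then show ?thesis using B(1) C(1) by (intro exI[of _ "B * C"]) auto
qed

lemma step_function_in_Lp:
  assumes c: "c \<in> lp"
  shows "(\<lambda>y. c (nearest y)) \<in> weighted_Lp M p m"
proof -
  obtain C where C: "Lp_norm (\<lambda>y. c (nearest y)) \<le> ennreal C * lp_norm c"
    using step_function_norm by blast
  also have "\<dots> < top"
    using c by (simp add: weighted_lp_def ennreal_mult_less_top)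
  finally show ?thesis
    by (simp add: weighted_Lp_def)
qed

lemma synthesis_bounded:
  "is_bounded_operator lp lp_norm repr (Lp_norm) synthesis"
  unfolding is_bounded_operator_def
proof (intro conjI ballI allI)
  fix c assume "c \<in> lp"
  then show "synthesis c \<in> repr"
    unfolding synthesis_def by (intro convolution_in_repr_space step_function_in_Lp)
next
  fix c d assume "c \<in> lp" "d \<in> lp"
  then show "synthesis (\<lambda>s. c s + d s) = (\<lambda>t. synthesis c t + synthesis d t)"
    unfolding synthesis_def by (intro convolution_add step_function_in_Lp)
next
  fix a c
  show "synthesis (\<lambda>s. a * c s) = (\<lambda>t. a * synthesis c t)"
    unfolding synthesis_def by (rule convolution_cmult)
next
  obtain C where C: "0 < C" "\<And>c. Lp_norm (\<lambda>y. c (nearest y)) \<le> ennreal C * lp_norm c"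
    using step_function_norm by blast
  obtain \<gamma> where \<gamma>: "weighted_Lp_norm M 1 w G = ennreal \<gamma>" "0 \<le> \<gamma>"
    using G_norm_finite by (cases "weighted_Lp_norm M 1 w G") auto
  have "Lp_norm (synthesis c) \<le> ennreal (C * \<gamma>) * lp_norm c" if "c \<in> lp" for c
  proof -
    have "Lp_norm (synthesis c) \<le> Lp_norm (\<lambda>y. c (nearest y)) * ennreal \<gamma>"
      unfolding synthesis_def \<gamma>(1)[symmetric] by (intro convolution_norm_le step_function_in_Lp that)
    also have "\<dots> \<le> (ennreal C * lp_norm c) * ennreal \<gamma>"
      by (intro mult_right_mono C) auto
    also have "\<dots> = ennreal (C * \<gamma>) * lp_norm c"
      using C(1) \<gamma>(2) by (simp add: ennreal_mult mult_ac)
    finally show ?thesis .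
  qed
  then show "\<exists>C. \<forall>c\<in>lp. Lp_norm (synthesis c) \<le> ennreal C * lp_norm c"
    by blast
qed

text \<open>
  The oscillation norm can only be infinite when \<open>G\<close> vanishes almost everywhere; then all elements
  of the reproducing kernel space have norm zero.
\<close>

lemma osc_norm_real:
  obtains \<omega> where "0 \<le> \<omega>"
    "\<And>F. F \<in> repr \<Longrightarrow>
      Lp_norm F * osc_norm M w U G \<le> Lp_norm F * ennreal \<omega>"
proof (cases "osc_norm M w U G")
  case (real \<omega>)
  then show ?thesis by (intro that[of \<omega>]) auto
next
  case top
  then have "weighted_Lp_norm M 1 w G = 0"
    using small by (auto simp: ennreal_top_mult split: if_splits)
  then have "Lp_norm F = 0" if "F \<in> repr" for F
    using convolution_norm_le[OF repr_spaceD(1)[OF that]] repr_spaceD(2)[OF that] by simp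
  then show ?thesis by (intro that[of 0]) auto
qed

text \<open>\<open>local_oscillation\<close> compares \<open>F (x i)\<close> with \<open>F\<close>
  at all points \<open>x i + u\<close> with \<open>u\<close> in \<open>U'\<close>, and
  \<open>moderate_on_compact\<close> for \<open>- U\<close> compares the weights, so that
  \<open>sampling_norm\<close> applies. The factor \<open>1 + \<omega>\<close> adds the
  contributions of \<open>F\<close> and of its oscillation majorant.\<close>

lemma analysis_norm:
  "\<exists>C. 0 < C \<and> (\<forall>F\<in>repr. lp_norm (\<lambda>i. F (x i)) \<le> ennreal C * Lp_norm F)"
proof -
  obtain C where C: "0 < C" "\<And>(a :: 'i \<Rightarrow> ennreal) g. g \<in> borel_measurable M \<Longrightarrow>
     (\<And>i u. u \<in> U' \<Longrightarrow> a i \<le> g (x i + u)) \<Longrightarrow>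
     Lp_enorm (count_space UNIV) p a \<le> ennreal C * Lp_enorm M p g"
    using sampling_norm by blast
  have "compact (uminus ` U)"
    using U_compact by (intro compact_continuous_image continuous_intros)
  then obtain B where B: "0 < B" "\<And>y u. u \<in> uminus ` U \<Longrightarrow> m (y + u) \<le> B * m y"
    by (rule moderate_on_compact) (rule that)
  obtain \<omega> where \<omega>: "0 \<le> \<omega>" "\<And>F. F \<in> repr \<Longrightarrow>
      Lp_norm F * osc_norm M w U G \<le> Lp_norm F * ennreal \<omega>"
    by (rule osc_norm_real) (rule that)
  have "lp_norm (\<lambda>i. F (x i)) \<le> ennreal (C * B * (1 + \<omega>)) * Lp_norm F"
    if F: "F \<in> repr" for F
  proof -
    note FL = repr_spaceD(1)[OF F]
    note [measurable] = Lp_D(1)[OF FL]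
    let ?g = "\<lambda>y. ennreal B * (ennreal (cmod (F y)) * ennreal (m y) + osc_majorant F y * ennreal (m y))"
    have "lp_norm (\<lambda>i. F (x i)) \<le> ennreal C * Lp_enorm M p ?g"
      unfolding lp_norm_eq weighted_Lp_norm_def
    proof (rule C(2))
      fix i u assume u: "u \<in> U'"
      have "m ((x i + u) + - u) \<le> B * m (x i + u)"
        using u U'(2) by (intro B) auto
      then have mle: "m (x i) \<le> B * m (x i + u)" by (simp add: add.assoc)
      have "ennreal (cmod (F (x i))) \<le> ennreal (cmod (F (x i + u)) + cmod (F (x i + u) - F (x i)))"
        using norm_triangle_ineq4[of "F (x i + u)" "F (x i + u) - F (x i)"] by (intro ennreal_leI) simp
      also have "\<dots> \<le> ennreal (cmod (F (x i + u))) + osc_majorant F (x i + u)"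
        using local_oscillation[OF F u, of "x i"] by (simp add: add_left_mono)
      finally have "ennreal (cmod (F (x i)) * m (x i))
          \<le> (ennreal (cmod (F (x i + u))) + osc_majorant F (x i + u)) * ennreal (B * m (x i + u))"
        using mle m_pos[of "x i"] by (simp add: ennreal_mult less_imp_le mult_mono ennreal_leI)
      then show "ennreal (cmod (F (x i)) * m (x i)) \<le> ?g (x i + u)"
        using B(1) m_pos[of "x i + u"] by (simp add: ennreal_mult less_imp_le distrib_left distrib_right mult_ac)
    qed measurable
    also have "Lp_enorm M p ?g = ennreal B * Lp_enorm M p (\<lambda>y. ennreal (cmod (F y)) * ennreal (m y) + osc_majorant F y * ennreal (m y))"
      using B(1) by (intro Lp_enorm_cmult p) auto
    also have "Lp_enorm M p (\<lambda>y. ennreal (cmod (F y)) * ennreal (m y) + osc_majorant F y * ennreal (m y))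
        \<le> Lp_norm F + Lp_enorm M p (\<lambda>y. osc_majorant F y * ennreal (m y))"
      unfolding Lp_norm_eq by (intro Lp_enorm_add p) measurable
    also have "Lp_enorm M p (\<lambda>y. osc_majorant F y * ennreal (m y)) \<le> Lp_norm F * ennreal \<omega>"
      using osc_majorant_norm[OF FL] \<omega>(2)[OF F] by (rule order_trans)
    finally have "lp_norm (\<lambda>i. F (x i))
        \<le> ennreal C * (ennreal B * (Lp_norm F + Lp_norm F * ennreal \<omega>))"
      by (simp add: mult_left_mono add_left_mono)
    also have "\<dots> = ennreal (C * B * (1 + \<omega>)) * Lp_norm F"
      using B(1) C(1) \<omega>(1) by (simp add: ennreal_mult less_imp_le distrib_left distrib_right mult_ac)
    finally show ?thesis .
  qed
  then show ?thesis
    using B(1) C(1) \<omega>(1) by (intro exI[of _ "C * B * (1 + \<omega>)"]) auto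
qed

lemma analysis_bounded:
  "is_bounded_operator repr (Lp_norm) lp lp_norm (\<lambda>F i. F (x i))"
proof -
  obtain C where C: "\<And>F. F \<in> repr \<Longrightarrow> lp_norm (\<lambda>i. F (x i)) \<le> ennreal C * Lp_norm F"
    using analysis_norm by blast
  have "(\<lambda>i. F (x i)) \<in> lp" if "F \<in> repr" for F
  proof -
    have "ennreal C * Lp_norm F < top"
      using that by (simp add: repr_space_def weighted_Lp_def ennreal_mult_less_top)
    then show ?thesis
      using C[OF that] by (simp add: weighted_lp_def)
  qed
  then show ?thesis
    using C by (auto simp: is_bounded_operator_def)
qed

lemma synthesis_analysis_contraction:
  assumes F: "F \<in> repr"
  shows "Lp_norm (\<lambda>s. F s - synthesis (\<lambda>i. F (x i)) s)
    \<le> (osc_norm M w U G * weighted_Lp_norm M 1 w G) * Lp_norm F"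
proof -
  note FL = repr_spaceD(1)[OF F]
  note [measurable] = Lp_D(1)[OF FL]
  have "(\<lambda>i. F (x i)) \<in> lp"
    using analysis_bounded F by (auto simp: is_bounded_operator_def)
  then have SL: "(\<lambda>y. F (x (nearest y))) \<in> weighted_Lp M p m"
    by (rule step_function_in_Lp)
  note [measurable] = Lp_D(1)[OF SL]
  have "(\<lambda>s. F s - synthesis (\<lambda>i. F (x i)) s) = convolution M (\<lambda>y. F y - F (x (nearest y))) G"
    by (simp add: synthesis_def convolution_diff FL SL repr_spaceD(2)[OF F])
  then have "Lp_norm (\<lambda>s. F s - synthesis (\<lambda>i. F (x i)) s)
      \<le> Lp_norm (\<lambda>y. F y - F (x (nearest y))) * weighted_Lp_norm M 1 w G"
    using convolution_norm_le[OF Lp_space(6)[OF FL SL]] by simp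
  also have "Lp_norm (\<lambda>y. F y - F (x (nearest y)))
      \<le> Lp_enorm M p (\<lambda>y. osc_majorant F y * ennreal (m y))"
    unfolding Lp_norm_eq
  proof (intro Lp_enorm_mono_AE p)
    show "AE y in M. ennreal (cmod (F y - F (x (nearest y)))) * ennreal (m y) \<le> osc_majorant F y * ennreal (m y)"
      using nearest_AE
    proof eventually_elim
      case (elim y)
      show ?case
        using local_oscillation[OF F elim, of "x (nearest y)"]
        by (intro mult_right_mono) (simp_all add: add.assoc[symmetric])
    qed
  qed measurable
  also have "\<dots> \<le> Lp_norm F * osc_norm M w U G"
    by (rule osc_majorant_norm[OF FL])
  finally show ?thesis
    by (simp add: mult_right_mono mult_ac)
qed

section \<open>Reconstruction and the frame bounds\<close>

lemma reconstruction:
  "\<exists>R. is_bounded_operator lp lp_norm repr (Lp_norm) R \<and>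
    (\<forall>F\<in>repr. R (\<lambda>i. F (x i)) = F)"
proof -
  obtain \<kappa> where \<kappa>: "osc_norm M w U G * weighted_Lp_norm M 1 w G = ennreal \<kappa>" "0 \<le> \<kappa>"
    using small by (cases "osc_norm M w U G * weighted_Lp_norm M 1 w G") auto
  have "\<kappa> < 1" using small \<kappa> by simp
  show ?thesis
    using neumann_left_inverse[OF repr_space_banach synthesis_bounded analysis_bounded \<kappa>(2) \<open>\<kappa> < 1\<close>]
      synthesis_analysis_contraction by (simp add: \<kappa>(1))
qed

text \<open>The lower bound is the boundedness of the reconstruction operator, evaluated on sampled
  sequences.\<close>

lemma norm_equivalence:
  "\<exists>a b::real. 0 < a \<and> a \<le> b \<and>
    (\<forall>F \<in> repr.
       ennreal a * Lp_norm F \<le> lp_norm (\<lambda>i. F (x i)) \<and>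
       lp_norm (\<lambda>i. F (x i)) \<le> ennreal b * Lp_norm F)"
proof -
  obtain R where R: "is_bounded_operator lp lp_norm repr (Lp_norm) R"
    "\<And>F. F \<in> repr \<Longrightarrow> R (\<lambda>i. F (x i)) = F"
    using reconstruction by blast
  then obtain C where C: "\<And>c. c \<in> lp \<Longrightarrow> Lp_norm (R c) \<le> ennreal C * lp_norm c"
    unfolding is_bounded_operator_def by blast
  obtain b where b: "0 < b" "\<And>F. F \<in> repr \<Longrightarrow> lp_norm (\<lambda>i. F (x i)) \<le> ennreal b * Lp_norm F"
    using analysis_norm by blast
  \<comment> \<open>\<open>max 1 C\<close> guards against a nonpositive \<open>C\<close>, and the
    minimum with \<open>b\<close> secures \<open>a \<le> b\<close>.\<close>
  define a where "a = min b (1 / max 1 C)"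
  have a: "0 < a" "a \<le> b" "a * max 1 C \<le> 1"
    using b(1) by (auto simp: a_def min_def field_simps)
  have "ennreal a * Lp_norm F \<le> lp_norm (\<lambda>i. F (x i))" if F: "F \<in> repr" for F
  proof -
    have "(\<lambda>i. F (x i)) \<in> lp"
      using analysis_bounded F by (auto simp: is_bounded_operator_def)
    then have "Lp_norm F \<le> ennreal C * lp_norm (\<lambda>i. F (x i))"
      using C[of "\<lambda>i. F (x i)"] R(2)[OF F] by simp
    also have "\<dots> \<le> ennreal (max 1 C) * lp_norm (\<lambda>i. F (x i))"
      by (intro mult_right_mono ennreal_leI) auto
    finally have "ennreal a * Lp_norm F \<le> ennreal a * (ennreal (max 1 C) * lp_norm (\<lambda>i. F (x i)))"
      by (rule mult_left_mono) simp
    also have "\<dots> = ennreal (a * max 1 C) * lp_norm (\<lambda>i. F (x i))"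
      using a(1) by (simp add: ennreal_mult mult.assoc)
    also have "\<dots> \<le> 1 * lp_norm (\<lambda>i. F (x i))"
      using a(3) by (intro mult_right_mono) auto
    finally show ?thesis by simp
  qed
  then show ?thesis
    using a b by (intro exI[of _ a] exI[of _ b]) auto
qed

text \<open>One term of a sequence is bounded by its norm, so point evaluation at \<open>x i\<close>
  inherits the upper sampling bound.\<close>

lemma sampling_functional_bounded:
  "is_bounded_functional repr (Lp_norm)
     (\<lambda>F. pairing M F (left_translate (x i) G))"
proof -
  obtain b where b: "0 < b" "\<And>F. F \<in> repr \<Longrightarrow> lp_norm (\<lambda>i. F (x i)) \<le> ennreal b * Lp_norm F"
    using analysis_norm by blast
  have bound: "ennreal (cmod (F (x i))) \<le> ennreal (b / m (x i)) * Lp_norm F"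
    if F: "F \<in> repr" for F
  proof -
    have "ennreal (cmod (F (x i)) * m (x i)) \<le> lp_norm (\<lambda>i. F (x i))"
      by (rule le_weighted_lp_norm[OF countable_index p m_pos])
    also note b(2)[OF F]
    finally have "ennreal (1 / m (x i)) * ennreal (cmod (F (x i)) * m (x i))
        \<le> ennreal (1 / m (x i)) * (ennreal b * Lp_norm F)"
      by (rule mult_left_mono) simp
    then show ?thesis
      using m_pos[of "x i"] b(1)
      by (simp add: mult.assoc[symmetric] ennreal_mult[symmetric] less_imp_le)
  qed
  have closed: "(\<lambda>s. f s + g s) \<in> repr" "(\<lambda>s. c * f s) \<in> repr"
    if "f \<in> repr" "g \<in> repr" for f g c
    using repr_space_banach that by (auto simp: is_banach_fun_space_def is_normed_fun_space_def)
  show ?thesis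
    unfolding is_bounded_functional_def
    using bound closed by (auto simp: pairing_left_translate intro!: exI[of _ "b / m (x i)"])
qed

end

theorem theorem5p3p7:
  fixes M :: "'a::{topological_group_add, t2_space} measure"
    and \<Delta> m w :: "'a \<Rightarrow> real"
    and p q :: ennreal
    and G :: "'a \<Rightarrow> complex"
    and U :: "'a set"
    and x :: "'i \<Rightarrow> 'a"
  assumes "locally_compact_space (euclidean :: 'a topology)"
    and "sigma_compact_space (euclidean :: 'a topology)"
    and "left_haar_measure M"
    and "modular_function M \<Delta>"
    and "1 \<le> p"
    and "inverse p + inverse q = 1"
    and "moderate_weight M m"
    and "control_weight M \<Delta> p q m w"
    and "G \<in> W_L1 M w \<inter> weighted_Lp M q (\<lambda>y. 1 / m y)"
    and "AE y in M. G y = involution G y"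
    and "AE y in M. G y = convolution M G G y"
    and "compact_nhd_neutral U"
    and "osc_norm M w U G * weighted_Lp_norm M 1 w G < 1"
    and "well_spread U x"
  shows "(\<exists>a b::real. 0 < a \<and> a \<le> b \<and>
            (\<forall>F \<in> repr_space M p m G.
               ennreal a * weighted_Lp_norm M p m F
                 \<le> weighted_lp_norm p (\<lambda>i. m (x i)) (\<lambda>i. F (x i)) \<and>
               weighted_lp_norm p (\<lambda>i. m (x i)) (\<lambda>i. F (x i))
                 \<le> ennreal b * weighted_Lp_norm M p m F)) \<and>
         (\<exists>R. is_bounded_operator
                (weighted_lp p (\<lambda>i. m (x i))) (weighted_lp_norm p (\<lambda>i. m (x i)))
                (repr_space M p m G) (weighted_Lp_norm M p m) R \<and>
              (\<forall>F \<in> repr_space M p m G. R (\<lambda>i. F (x i)) = F)) \<and>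
         banach_frame
           (repr_space M p m G) (weighted_Lp_norm M p m)
           (weighted_lp p (\<lambda>i. m (x i))) (weighted_lp_norm p (\<lambda>i. m (x i)))
           (\<lambda>i F. pairing M F (left_translate (x i) G))"
proof -
  interpret sampling M \<Delta> p q m w G U x
    using assms by unfold_locales (auto simp: W_L1_def)
  \<comment> \<open>On \<open>repr\<close> the pairing with a translate of \<open>G\<close> is a
    point value, so the frame properties are those of the sampling map.\<close>
  have "banach_frame (repr_space M p m G) (weighted_Lp_norm M p m) lp lp_norm
      (\<lambda>i F. pairing M F (left_translate (x i) G))"
    unfolding banach_frame_def
    using repr_space_banach lp_banach sampling_functional_bounded norm_equivalence reconstruction analysis_bounded
    by (simp add: pairing_left_translate is_bounded_operator_def cong: ball_cong)
  then show ?thesis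
    using norm_equivalence reconstruction by blast
qed

end
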